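(* Suppose that $k$, $r$ and $t$ are positive integers with $$k\ge 2,\quad \max\{2,\tfrac12(k-1)\}\le t\le k,\quad 1\le r\le k,\quad r+t\ge k.$$ Define $$\kappa=\kappa(r,t,k)=r(t+1)-\tfrac12(t+r-k)\left(t+r-k-1+\frac{2r-2}{t-1}\right).$$ Then for each $\varepsilon>0$ one has $$J_{r(t+1),k}(X)\ll X^{2r(t+1)-\kappa+\varepsilon},$$ where the implicit constant may depend on $k,r,t$ and $\varepsilon$.
   Context: For natural numbers $k,s$ and real $X\ge 1$, $J_{s,k}(X)$ denotes the number of integral solutions $(x_1,\dots,x_s,y_1,\dots,y_s)$ of the system $\sum_{i=1}^s (x_i^j-y_i^j)=0$ $(1\le j\le k)$ with $1\le x_i,y_i\le X$ $(1\le i\le s)$. *)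

theory Defs
  imports "HOL-Analysis.Analysis"
begin

(* Tuples are extensional functions on {1..s}, so that each integral solution
   is counted exactly once. *)
definition vinogradov_solutions :: "nat \<Rightarrow> nat \<Rightarrow> real \<Rightarrow> ((nat \<Rightarrow> int) \<times> (nat \<Rightarrow> int)) set" where
  "vinogradov_solutions s k X =
     {(x, y). x \<in> {1..s} \<rightarrow>\<^sub>E {a. 1 \<le> a \<and> real_of_int a \<le> X} \<and>
              y \<in> {1..s} \<rightarrow>\<^sub>E {a. 1 \<le> a \<and> real_of_int a \<le> X} \<and>
              (\<forall>j\<in>{1..k}. (\<Sum>i\<in>{1..s}. x i ^ j - y i ^ j) = 0)}"

definition vinogradov_J :: "nat \<Rightarrow> nat \<Rightarrow> real \<Rightarrow> nat" where
  "vinogradov_J s k X = card (vinogradov_solutions s k X)"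

(* The cardinality above is that of a finite set, hence not the default value 0. *)
lemma finite_vinogradov_solutions: "finite (vinogradov_solutions s k X)"
proof -
  let ?A = "{a. 1 \<le> a \<and> real_of_int a \<le> X}"
  have "?A \<subseteq> {1..\<lfloor>X\<rfloor>}"
    by (auto simp: le_floor_iff)
  then have "finite ?A"
    by (rule finite_subset) simp
  then have "finite (({1..s} \<rightarrow>\<^sub>E ?A) \<times> ({1..s} \<rightarrow>\<^sub>E ?A))"
    by (intro finite_cartesian_product finite_PiE) auto
  then show ?thesis
    by (rule rev_finite_subset) (auto simp: vinogradov_solutions_def)
qed

definition kappa :: "nat \<Rightarrow> nat \<Rightarrow> nat \<Rightarrow> real" where
  "kappa r t k =
     real r * (real t + 1)
     - 1/2 * (real t + real r - real k)
           * (real t + real r - real k - 1 + (2 * real r - 2) / (real t - 1))"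

end

theory Submission
  imports Defs
begin

text \<open>
  Fix a prime \<open>q\<close> that is large in terms of \<open>r\<close>, \<open>t\<close> and \<open>k\<close>, and let \<open>X = q\<^sup>n\<close>. Efficient congruencing is run
  with powers of this fixed prime instead of powers of a prime of size \<open>X\<^sup>\<theta>\<close>. Write
  \<open>f\<^sub>b(\<eta>)\<close> for the exponential sum over \<open>x \<equiv> \<eta> (mod q\<^sup>b)\<close> and consider the mixed mean values
  \<open>I(a,b)\<close> of \<open>|\<Prod>\<^sub>l f\<^sub>a\<^sub>+\<^sub>1(\<xi>\<^sub>l)|\<^sup>2 |f\<^sub>b(\<eta>)|\<^sup>2\<^sup>r\<^sup>t\<close>, with \<open>r\<close> classes \<open>\<xi>\<^sub>l\<close> that agree modulo \<open>q\<^sup>a\<close> and differ modulo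
  \<open>q\<^sup>a\<^sup>+\<^sup>1\<close>. If no single subclass modulo \<open>q\<^sup>b\<^sup>+\<^sup>1\<close> dominates \<open>f\<^sub>b(\<eta>)\<close>, then \<open>r\<close> subclasses are
  comparable with it. The resulting system of congruences modulo \<open>q\<^sup>j\<^sup>b\<close> in degrees \<open>j \<le> k\<close>
  restricts the \<open>r\<close> variables to few residues modulo \<open>q\<^sup>t\<^sup>b\<close>, and Hoelder's inequality bounds \<open>I(a,b)\<close> by
  \<open>I(b,tb)\<^sup>1\<^sup>/\<^sup>t\<close> times a power of the mean value for \<open>X / q\<^sup>b\<close>. If the mean value for \<open>X\<close> is bounded with an
  exponent that exceeds the claimed one by some positive amount, then each step gains a fixed power of \<open>q\<^sup>b\<close>,
  and sufficiently many steps lower the exponent by a fixed positive amount.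
\<close>

text \<open>The claimed exponent is a fixed point. If the mean values grow with exponent
  \<open>E\<close>, one congruencing step improves the decay of \<open>I(a,b)\<close> in
  \<open>b\<close> from the rate \<open>\<beta>\<close> to \<open>\<beta> + g\<close>, where
  \<open>g = (1 - 1 / t) * E + \<alpha> / t - mu - r * t\<close>, \<open>\<alpha> = r - nu\<close>,
  and \<open>mu\<close>, \<open>nu\<close> are the costs of the congruences in powers of
  \<open>q ^ b\<close> and \<open>q ^ a\<close>. Solving \<open>g = 0\<close> for \<open>E\<close>
  gives \<open>2 * r * (t + 1) - kappa\<close>; this is the origin of \<open>kappa\<close>. The
  obstacle to a fixed prime is that constants accumulate, since \<open>b\<close> is raised by one a
  number of times that can be proportional to \<open>n\<close>. A dominant subclass costs only a
  power of \<open>2 * r\<close> and one factor \<open>q\<close>, while raising \<open>b\<close>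
  saves at least \<open>q ^ (r * t)\<close> with \<open>r * t >= 2\<close>. Hence it suffices that
  \<open>q\<close> is large in terms of \<open>r\<close> and \<open>t\<close>, and exceeds
  \<open>k\<close> so that \<open>fact k\<close> is a unit modulo \<open>q\<close>. The assumption
  \<open>t >= (k - 1) / 2\<close> makes the step repeatable: it needs
  \<open>(k - t - 1) * a <= b\<close>, and for the next pair \<open>(b, t * b)\<close> this reads
  \<open>(k - t - 1) * b <= t * b\<close>.\<close>

section \<open>Solutions of systems of congruences\<close>

text \<open>\<open>k!\<close> times the antiderivative; the factor keeps the coefficients integral when \<open>degree P < k\<close>.\<close>

definition anti_poly :: "nat \<Rightarrow> int poly \<Rightarrow> int poly" where
  "anti_poly k P = (\<Sum>j<k. monom (fact k div int (Suc j) * coeff P j) (Suc j))"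

lemma coeff_anti_poly_0 [simp]: "coeff (anti_poly k P) 0 = 0"
  by (simp add: anti_poly_def coeff_sum)

lemma coeff_anti_poly_Suc:
  "coeff (anti_poly k P) (Suc j) = (if j < k then fact k div int (Suc j) * coeff P j else 0)"
  by (simp add: anti_poly_def coeff_sum sum.delta if_distrib cong: if_cong)

lemma degree_anti_poly: "degree (anti_poly k P) \<le> k"
proof (rule degree_le, intro allI impI)
  fix i assume "k < i"
  then obtain j where "i = Suc j" "k \<le> j" by (cases i) auto
  then show "coeff (anti_poly k P) i = 0" by (simp add: coeff_anti_poly_Suc)
qed

lemma Suc_mult_fact_div:
  assumes "j < k" shows "int (Suc j) * (fact k div int (Suc j)) = fact k"
proof -
  have "Suc j dvd fact k" using assms by (intro dvd_fact) auto
  then have "int (Suc j) dvd fact k"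
    by (metis of_nat_dvd_iff of_nat_fact)
  then show ?thesis by simp
qed

lemma pderiv_anti_poly:
  assumes "degree P < k"
  shows "pderiv (anti_poly k P) = smult (fact k) P"
proof (rule poly_eqI)
  fix j
  show "coeff (pderiv (anti_poly k P)) j = coeff (smult (fact k) P) j"
  proof (cases "j < k")
    case True
    have "coeff (pderiv (anti_poly k P)) j
            = int (Suc j) * (fact k div int (Suc j)) * coeff P j"
      using True by (simp add: coeff_pderiv coeff_anti_poly_Suc algebra_simps)
    then show ?thesis using Suc_mult_fact_div[OF True] by simp
  next
    case False
    then have "coeff P j = 0" using assms by (intro coeff_eq_0) auto
    then show ?thesis using False by (simp add: coeff_pderiv coeff_anti_poly_Suc)
  qed
qed

text \<open>Up to \<open>fact k\<close>, the difference is the integral of \<open>P\<close> from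
  \<open>z\<close> to \<open>z + c * d\<close>. After substitution the integrand is
  \<open>c * M * R\<close>, and integrating \<open>R\<close> from 0 to \<open>d\<close> gives
  \<open>d\<close> times the constant coefficient plus multiples of \<open>d ^ 2\<close>. In the
  application \<open>q\<close> divides \<open>d\<close>, so \<open>coeff R 0\<close> alone decides
  divisibility of the last factor by \<open>q\<close>.\<close>

lemma anti_poly_diff:
  assumes deg: "degree P < k" and R: "pcompose P [:z, c:] = smult M R"
  shows "\<exists>W. poly (anti_poly k P) (z + c * d) - poly (anti_poly k P) z
              = c * M * d * (fact k * coeff R 0 + d * W)"
proof -
  define Q where "Q = pcompose (anti_poly k P) [:z, c:]"
  have "degree Q \<le> degree (anti_poly k P) * degree [:z, c:]"
    unfolding Q_def by (rule degree_pcompose_le)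
  also have "\<dots> \<le> k * 1"
    by (intro mult_mono degree_anti_poly) auto
  finally have degQ: "degree Q \<le> k" by simp
  have "pderiv Q = smult (fact k * c * M) R"
    unfolding Q_def pderiv_pcompose pderiv_anti_poly[OF deg]
    by (simp add: pcompose_smult R pderiv_pCons mult_ac)
  then have co: "int (Suc e) * coeff Q (Suc e) = fact k * c * M * coeff R e" for e
    by (metis coeff_pderiv coeff_smult of_nat_Suc)
  have coQ: "coeff Q (Suc e) = c * M * (fact k div int (Suc e)) * coeff R e" if "e < k" for e
  proof -
    have "int (Suc e) * coeff Q (Suc e)
        = int (Suc e) * (c * M * (fact k div int (Suc e)) * coeff R e)"
      using co[of e] Suc_mult_fact_div[OF that] by (metis mult.assoc mult.commute)
    then show ?thesis by simp
  qed
  obtain k' where k': "k = Suc k'" using deg by (cases k) auto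
  have "poly Q d = (\<Sum>i\<le>k. coeff Q i * d ^ i)"
    using degQ by (subst poly_as_sum_of_monoms'[symmetric, of Q k])
      (simp_all add: poly_sum poly_monom)
  also have "\<dots> = coeff Q 0 + (\<Sum>e\<le>k'. coeff Q (Suc e) * d ^ Suc e)"
    unfolding k' by (subst sum.atMost_Suc_shift) simp
  also have "(\<Sum>e\<le>k'. coeff Q (Suc e) * d ^ Suc e)
      = c * M * d * (\<Sum>e\<le>k'. (fact k div int (Suc e)) * coeff R e * d ^ e)"
    unfolding sum_distrib_left by (intro sum.cong) (auto simp: coQ k')
  also have "(\<Sum>e\<le>k'. (fact k div int (Suc e)) * coeff R e * d ^ e)
      = fact k * coeff R 0
        + d * (\<Sum>e<k'. (fact k div int (Suc (Suc e))) * coeff R (Suc e) * d ^ e)"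
    by (subst sum.atMost_shift) (simp add: sum_distrib_left mult_ac)
  finally have "poly Q d - coeff Q 0 = c * M * d * (fact k * coeff R 0
        + d * (\<Sum>e<k'. (fact k div int (Suc (Suc e))) * coeff R (Suc e) * d ^ e))" by simp
  moreover have "poly Q d = poly (anti_poly k P) (z + c * d)"
    by (simp add: Q_def poly_pcompose mult_ac)
  moreover have "coeff Q 0 = poly (anti_poly k P) z"
    unfolding Q_def by (simp add: poly_0_coeff_0[symmetric] poly_pcompose)
  ultimately show ?thesis by metis
qed

text \<open>The nodes are the residue classes of the variables. As \<open>node_poly e \<theta> i\<close> vanishes at the first \<open>i\<close>
  nodes, the differences of its antiderivative form a triangular system modulo \<open>q\<close>; the factor
  \<open>X ^ e\<close> removes all power sums of degree at most \<open>e\<close>.\<close>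

definition node_poly :: "nat \<Rightarrow> (nat \<Rightarrow> int) \<Rightarrow> nat \<Rightarrow> int poly" where
  "node_poly e \<theta> i = monom 1 e * (\<Prod>l<i. [:- \<theta> l, 1:])"

lemma degree_node_poly: "degree (node_poly e \<theta> i) = e + i"
proof -
  have "degree (\<Prod>l<i. [:- \<theta> l, 1:]) = i"
    by (subst degree_prod_eq_sum_degree) auto
  moreover have "(\<Prod>l<i. [:- \<theta> l, 1:]) \<noteq> 0" by (simp add: prod_zero_iff)
  ultimately show ?thesis
    unfolding node_poly_def by (subst degree_mult_eq) (auto simp: degree_monom_eq)
qed

lemma coeff_node_poly_eq_0: "j < e \<Longrightarrow> coeff (node_poly e \<theta> i) j = 0"
  by (simp add: node_poly_def coeff_monom_mult)

lemma pcompose_power_eq: "pcompose (p ^ n) q = pcompose p q ^ n"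
  for p :: "'a :: comm_semiring_1 poly"
  by (induction n) (auto simp: pcompose_mult pcompose_1)

text \<open>Each linear factor turns into \<open>c\<close> times a factor with constant term
  \<open>w l\<close>, so \<open>c\<close> can be extracted once for every node. This extracted power
  is the source of the loss \<open>nu_exp\<close>.\<close>

lemma pcompose_node_poly:
  assumes "\<And>l. l < i \<Longrightarrow> z - \<theta> l = c * w l"
  shows "\<exists>R. pcompose (node_poly e \<theta> i) [:z, c:] = smult (c ^ i) R
             \<and> coeff R 0 = z ^ e * (\<Prod>l<i. w l)"
proof -
  define R where "R = [:z, c:] ^ e * (\<Prod>l<i. [:w l, 1:])"
  have "pcompose (node_poly e \<theta> i) [:z, c:] = [:z, c:] ^ e * (\<Prod>l<i. [:z - \<theta> l, c:])"
    unfolding node_poly_def pcompose_mult pcompose_prod monom_altdef pcompose_smult pcompose_power_eq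
    by (simp add: pcompose_pCons)
  also have "(\<Prod>l<i. [:z - \<theta> l, c:]) = (\<Prod>l<i. smult c [:w l, 1:])"
    by (intro prod.cong) (auto simp: assms)
  also have "\<dots> = smult (c ^ i) (\<Prod>l<i. [:w l, 1:])"
    by (simp only: prod_smult prod_constant card_lessThan)
  finally have "pcompose (node_poly e \<theta> i) [:z, c:] = smult (c ^ i) R"
    by (simp add: R_def)
  moreover have "coeff R 0 = z ^ e * (\<Prod>l<i. w l)"
    unfolding R_def by (simp add: coeff_0_prod_list poly_0_coeff_0[symmetric] poly_prod)
  ultimately show ?thesis by blast
qed

lemma poly_anti_node:
  "poly (anti_poly k (node_poly e \<theta> i)) z
     = (\<Sum>j\<in>{e<..k}. coeff (anti_poly k (node_poly e \<theta> i)) j * z ^ j)"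
proof -
  let ?P = "anti_poly k (node_poly e \<theta> i)"
  have "poly ?P z = (\<Sum>j\<le>k. coeff ?P j * z ^ j)"
    using degree_anti_poly by (subst poly_as_sum_of_monoms'[symmetric, of ?P k])
      (simp_all add: poly_sum poly_monom)
  also have "\<dots> = (\<Sum>j\<in>{e<..k}. coeff ?P j * z ^ j)"
  proof (rule sum.mono_neutral_right)
    show "\<forall>j\<in>{..k} - {e<..k}. coeff ?P j * z ^ j = 0"
    proof
      fix j assume "j \<in> {..k} - {e<..k}"
      then have "j \<le> e" by auto
      then show "coeff ?P j * z ^ j = 0"
        by (cases j) (auto simp: coeff_anti_poly_Suc coeff_node_poly_eq_0)
    qed
  qed auto
  finally show ?thesis .
qed

lemma not_dvd_fact_int:
  assumes "prime (q :: int)" "int k < q" shows "\<not> q dvd fact k"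
  using assms(2)
proof (induction k)
  case 0
  then show ?case using assms(1) by (simp add: not_prime_unit)
next
  case (Suc k)
  have "\<not> q dvd int (Suc k)"
    using Suc.prems zdvd_imp_le[of q "int (Suc k)"] by linarith
  moreover have "\<not> q dvd fact k" using Suc by simp
  ultimately have "\<not> q dvd int (Suc k) * fact k"
    using prime_dvd_mult_iff[OF assms(1)] by blast
  then show ?case by simp
qed

text \<open>Modulo \<open>q\<close>, \<open>V\<close> is \<open>fact k * z ^ e\<close> times the
  product of \<open>(z - \<theta> m) / q ^ a\<close> over \<open>m < i\<close>. For
  \<open>l < i\<close> the factor with \<open>m = l\<close> is divisible by \<open>q\<close>. For
  \<open>l = i\<close> all factors are units: the nodes differ modulo \<open>q ^ Suc a\<close>,
  \<open>z\<close> is prime to \<open>q\<close>, and \<open>q\<close> exceeds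
  \<open>k\<close>.\<close>

lemma node_poly_triangular:
  fixes q :: int
  assumes q: "prime q" "int k < q" and deg: "e + i < k" and l: "l < r" and i: "i < r"
    and z: "q ^ Suc a dvd z - \<theta> l" and z': "q ^ Suc a dvd z' - \<theta> l"
    and sep: "\<And>l m. l < r \<Longrightarrow> m < r \<Longrightarrow> l \<noteq> m \<Longrightarrow> q ^ a dvd \<theta> l - \<theta> m \<and> \<not> q ^ Suc a dvd \<theta> l - \<theta> m"
    and unit: "\<not> q dvd \<theta> l"
  shows "\<exists>V. poly (anti_poly k (node_poly e \<theta> i)) z' - poly (anti_poly k (node_poly e \<theta> i)) z
            = (q ^ a) ^ i * (z' - z) * V \<and> (l < i \<longrightarrow> q dvd V) \<and> (l = i \<longrightarrow> \<not> q dvd V)"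
proof -
  have q0: "q ^ a \<noteq> 0" using prime_gt_0_int[OF q(1)] by simp
  have za: "q ^ a dvd z - \<theta> l"
    using z by (rule power_le_dvd) simp
  define w where "w m = (z - \<theta> m) div q ^ a" for m
  have w: "z - \<theta> m = q ^ a * w m" if "m < r" for m
  proof -
    have "q ^ a dvd \<theta> l - \<theta> m" using sep[OF l that] by (cases "l = m") simp_all
    from dvd_add[OF za this] have "q ^ a dvd z - \<theta> m" by simp
    then show ?thesis unfolding w_def by (rule dvd_mult_div_cancel[symmetric])
  qed
  have "q ^ Suc a dvd z' - z"
    using dvd_diff[OF z' z] by simp
  then obtain d' where "z' - z = q ^ Suc a * d'" ..
  \<comment> \<open>Only \<open>q ^ a\<close> of the available \<open>q ^ Suc a\<close> goes into
    the step length. The spare factor \<open>q\<close> stays in \<open>d\<close> and kills the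
    higher terms modulo \<open>q\<close>.\<close>
  then obtain d where d: "z' = z + q ^ a * d" "q dvd d"
    by (metis add.commute diff_add_cancel dvd_triv_left mult.assoc power_Suc2)
  obtain R where R: "pcompose (node_poly e \<theta> i) [:z, q ^ a:] = smult ((q ^ a) ^ i) R"
    "coeff R 0 = z ^ e * (\<Prod>m<i. w m)"
    using pcompose_node_poly[of i z \<theta> "q ^ a" w e] w i by auto
  have "degree (node_poly e \<theta> i) < k" using deg by (simp add: degree_node_poly)
  from anti_poly_diff[OF this R(1), of d] obtain W where
    W: "poly (anti_poly k (node_poly e \<theta> i)) z' - poly (anti_poly k (node_poly e \<theta> i)) z
          = q ^ a * (q ^ a) ^ i * d * (fact k * coeff R 0 + d * W)"
    unfolding d(1) by blast
  define V where "V = fact k * coeff R 0 + d * W"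
  have V: "q dvd V \<longleftrightarrow> q dvd fact k * coeff R 0"
    unfolding V_def using d(2) by (simp add: dvd_add_left_iff)
  have "q dvd V" if "l < i"
  proof -
    have "q ^ a * q dvd q ^ a * w l" using z unfolding w[OF l] power_Suc2 .
    then have "q dvd w l" using q0 by (metis dvd_mult_cancel_left)
    then have "q dvd (\<Prod>m<i. w m)"
      using that by (meson dvd_prodI dvd_trans finite_lessThan lessThan_iff)
    then show ?thesis unfolding V R by simp
  qed
  moreover have "\<not> q dvd V" if "l = i"
  proof
    assume "q dvd V"
    then have "q dvd fact k \<or> q dvd z ^ e \<or> q dvd (\<Prod>m<i. w m)"
      unfolding V R using prime_dvd_mult_iff[OF q(1)] by blast
    moreover have "\<not> q dvd fact k" using q by (rule not_dvd_fact_int)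
    moreover have "q dvd z ^ e \<Longrightarrow> q dvd z" using q(1) by (rule prime_dvd_power)
    moreover have "q dvd (\<Prod>m<i. w m) \<Longrightarrow> \<exists>m\<in>{..<i}. q dvd w m"
      using prime_dvd_prod_iff[OF finite_lessThan q(1)] by (rule iffD1)
    ultimately have "q dvd z \<or> (\<exists>m\<in>{..<i}. q dvd w m)" by blast
    then consider "q dvd z" | m where "m < i" "q dvd w m" by auto
    then show False
    proof cases
      case 1
      have "q dvd z - \<theta> l" using z by (metis dvd_mult_left power_Suc)
      then have "q dvd z - (z - \<theta> l)" using 1 by (rule dvd_diff[rotated])
      then show False using unit by simp
    next
      case 2
      then have m: "m < r" "l \<noteq> m" using i that by auto
      have "q ^ Suc a dvd z - \<theta> m"
        unfolding w[OF m(1)] power_Suc2 using 2(2) by (rule mult_dvd_mono[OF dvd_refl])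
      then have "q ^ Suc a dvd (z - \<theta> m) - (z - \<theta> l)" using z by (rule dvd_diff)
      then show False using sep[OF l m] by simp
    qed
  qed
  moreover have "poly (anti_poly k (node_poly e \<theta> i)) z' - poly (anti_poly k (node_poly e \<theta> i)) z
            = (q ^ a) ^ i * (z' - z) * V"
    unfolding W V_def using d by simp
  ultimately show ?thesis by blast
qed

text \<open>A Hensel-type lifting: the \<open>q\<close>-adic precision of \<open>z' - z\<close> is raised one step at a time, solving the
  triangular system from the last variable backwards.\<close>

lemma residues_determined:
  fixes q :: int
  assumes q: "prime q" "int k < q" and deg: "\<And>i. i < r \<Longrightarrow> e i + i < k"
    and z: "\<And>l. l < r \<Longrightarrow> q ^ Suc a dvd z l - \<theta> l"
    and z': "\<And>l. l < r \<Longrightarrow> q ^ Suc a dvd z' l - \<theta> l"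
    and sep: "\<And>l m. l < r \<Longrightarrow> m < r \<Longrightarrow> l \<noteq> m \<Longrightarrow> q ^ a dvd \<theta> l - \<theta> m \<and> \<not> q ^ Suc a dvd \<theta> l - \<theta> m"
    and unit: "\<And>l. l < r \<Longrightarrow> \<not> q dvd \<theta> l"
    and H: "\<And>i. i < r \<Longrightarrow> q ^ (B + a * i) dvd
       (\<Sum>l<r. poly (anti_poly k (node_poly (e i) \<theta> i)) (z' l)
             - poly (anti_poly k (node_poly (e i) \<theta> i)) (z l))"
    and l: "l < r"
  shows "q ^ B dvd z' l - z l"
proof -
  have ex: "\<exists>V. poly (anti_poly k (node_poly (e i) \<theta> i)) (z' l) - poly (anti_poly k (node_poly (e i) \<theta> i)) (z l)
            = (q ^ a) ^ i * (z' l - z l) * V \<and> (l < i \<longrightarrow> q dvd V) \<and> (l = i \<longrightarrow> \<not> q dvd V)"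
    if i: "i < r" and l: "l < r" for i l
    by (rule node_poly_triangular[where \<theta> = \<theta> and r = r and l = l and a = a,
          OF q deg[OF i] l i z[OF l] z'[OF l] sep unit[OF l]])
  define Pd where "Pd i l V \<longleftrightarrow>
      poly (anti_poly k (node_poly (e i) \<theta> i)) (z' l) - poly (anti_poly k (node_poly (e i) \<theta> i)) (z l)
            = (q ^ a) ^ i * (z' l - z l) * V \<and> (l < i \<longrightarrow> q dvd V) \<and> (l = i \<longrightarrow> \<not> q dvd V)"
    for i l V
  have "\<forall>i l. \<exists>V. i < r \<longrightarrow> l < r \<longrightarrow> Pd i l V"
    using ex unfolding Pd_def by blast
  then obtain V where "\<And>i l. i < r \<Longrightarrow> l < r \<Longrightarrow> Pd i l (V i l)" by metis
  then have V: "\<And>i l. i < r \<Longrightarrow> l < r \<Longrightarrow>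
      poly (anti_poly k (node_poly (e i) \<theta> i)) (z' l) - poly (anti_poly k (node_poly (e i) \<theta> i)) (z l)
            = (q ^ a) ^ i * (z' l - z l) * V i l"
      "\<And>i l. i < r \<Longrightarrow> l < i \<Longrightarrow> q dvd V i l" "\<And>i. i < r \<Longrightarrow> \<not> q dvd V i i"
    unfolding Pd_def using less_trans by blast+
  have H': "q ^ B dvd (\<Sum>l<r. (z' l - z l) * V i l)" if "i < r" for i
  proof -
    have "(\<Sum>l<r. poly (anti_poly k (node_poly (e i) \<theta> i)) (z' l)
             - poly (anti_poly k (node_poly (e i) \<theta> i)) (z l))
        = (q ^ a) ^ i * (\<Sum>l<r. (z' l - z l) * V i l)"
      unfolding sum_distrib_left by (intro sum.cong) (auto simp: V that)
    with H[OF that] have "(q ^ a) ^ i * q ^ B dvd (q ^ a) ^ i * (\<Sum>l<r. (z' l - z l) * V i l)"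
      by (simp add: power_add power_mult mult.commute)
    moreover have "(q ^ a) ^ i \<noteq> 0" using prime_gt_0_int[OF q(1)] by simp
    ultimately show ?thesis by (metis dvd_mult_cancel_left)
  qed
  have "\<forall>l<r. q ^ B' dvd z' l - z l" if "B' \<le> B" for B'
    using that
  proof (induction B')
    case (Suc B')
    then have IH: "q ^ B' dvd z' l - z l" if "l < r" for l using that by simp
    have "q ^ Suc B' dvd z' i - z i" if "i < r" for i
      using that
    proof (induction "r - i" arbitrary: i rule: less_induct)
      case (less i)
      have dv: "q ^ Suc B' dvd (\<Sum>l<r. (z' l - z l) * V i l)"
        using H'[OF less.prems] Suc.prems by (meson power_le_dvd)
      have split: "(\<Sum>l<r. (z' l - z l) * V i l)
          = (z' i - z i) * V i i + (\<Sum>l\<in>{..<r} - {i}. (z' l - z l) * V i l)"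
        using less.prems by (subst sum.remove[of _ i]) auto
      \<comment> \<open>Below the diagonal the missing factor \<open>q\<close> comes from
        \<open>V i l\<close>; above it the precision of \<open>z' l - z l\<close> has already been
        raised by the inner induction.\<close>
      have "q ^ Suc B' dvd (\<Sum>l\<in>{..<r} - {i}. (z' l - z l) * V i l)"
      proof (rule dvd_sum)
        fix l assume "l \<in> {..<r} - {i}"
        then have l: "l < r" "l < i \<or> i < l" by auto
        from l(2) show "q ^ Suc B' dvd (z' l - z l) * V i l"
        proof
          assume "l < i"
          then have "q ^ B' * q dvd (z' l - z l) * V i l"
            using IH[OF l(1)] V(2)[OF less.prems] by (intro mult_dvd_mono)
          then show ?thesis by (simp add: mult.commute)
        next
          assume "i < l"
          then have "q ^ Suc B' dvd z' l - z l"
            using l less.prems by (intro less.hyps) auto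
          then show ?thesis by (rule dvd_mult2)
        qed
      qed
      from dvd_add_left_iff[OF this] have "q ^ Suc B' dvd (z' i - z i) * V i i"
        using dv unfolding split by blast
      moreover have "coprime q (V i i)"
        using q(1) V(3)[OF less.prems] by (rule prime_imp_coprime)
      ultimately show ?case
        using coprime_dvd_mult_left_iff coprime_power_left_iff by blast
    qed
    then show ?case by blast
  qed auto
  then show ?thesis using l by blast
qed

section \<open>Counting residue classes\<close>

lemma card_residues_le:
  fixes M N c :: int
  assumes "M > 0" "N > 0"
  shows "finite {y \<in> {0..<M * N}. M dvd y - c}" "int (card {y \<in> {0..<M * N}. M dvd y - c}) \<le> N"
proof -
  show "finite {y \<in> {0..<M * N}. M dvd y - c}"
    by (rule finite_subset[of _ "{0..<M * N}"]) auto
  have "{y \<in> {0..<M * N}. M dvd y - c} \<subseteq> (\<lambda>s. c mod M + M * s) ` {0..<N}"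
  proof
    fix y assume "y \<in> {y \<in> {0..<M * N}. M dvd y - c}"
    then have y: "0 \<le> y" "y < M * N" "y mod M = c mod M" by (auto simp: mod_eq_dvd_iff)
    have "y = c mod M + M * (y div M)" using y(3) by (metis mod_mult_div_eq)
    moreover have "0 \<le> y div M" using y assms by (simp add: pos_imp_zdiv_nonneg_iff)
    moreover have "y div M < N"
    proof (rule ccontr)
      assume "\<not> y div M < N"
      then have "M * N \<le> M * (y div M)" using assms by (intro mult_left_mono) auto
      also have "\<dots> \<le> y" using assms mult_div_mod_eq[of M y] pos_mod_sign[of M y] by linarith
      finally show False using y by simp
    qed
    ultimately show "y \<in> (\<lambda>s. c mod M + M * s) ` {0..<N}" by auto
  qed
  then have "card {y \<in> {0..<M * N}. M dvd y - c} \<le> card ((\<lambda>s. c mod M + M * s) ` {0..<N})"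
    by (intro card_mono) auto
  also have "\<dots> \<le> card {0..<N}" by (intro card_image_le) auto
  finally show "int (card {y \<in> {0..<M * N}. M dvd y - c}) \<le> N" using assms by simp
qed

text \<open>On \<open>A\<close> the value of \<open>u i\<close> modulo \<open>M i\<close> is
  constant, so that refining the modulus to \<open>M i * N i\<close> leaves at most
  \<open>N i\<close> choices in each coordinate.\<close>

lemma card_refined_residues_le:
  fixes u :: "'i \<Rightarrow> 'x \<Rightarrow> int"
  assumes I: "finite I" and pos: "\<And>i. i \<in> I \<Longrightarrow> M i > 0 \<and> N i > 0"
    and cong: "\<And>x y i. x \<in> A \<Longrightarrow> y \<in> A \<Longrightarrow> i \<in> I \<Longrightarrow> M i dvd u i x - u i y"
  shows "finite ((\<lambda>x. \<lambda>i\<in>I. u i x mod (M i * N i)) ` A)"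
    "int (card ((\<lambda>x. \<lambda>i\<in>I. u i x mod (M i * N i)) ` A)) \<le> (\<Prod>i\<in>I. N i)"
proof -
  have "finite ((\<lambda>x. \<lambda>i\<in>I. u i x mod (M i * N i)) ` A) \<and>
    int (card ((\<lambda>x. \<lambda>i\<in>I. u i x mod (M i * N i)) ` A)) \<le> (\<Prod>i\<in>I. N i)"
  proof (cases "A = {}")
    case True
    have "0 \<le> (\<Prod>i\<in>I. N i)" using pos by (intro prod_nonneg) (auto intro: less_imp_le)
    with True show ?thesis by simp
  next
    case False
    then obtain x0 where x0: "x0 \<in> A" by auto
    let ?R = "\<lambda>i. {y \<in> {0..<M i * N i}. M i dvd y - u i x0}"
    have "(\<lambda>x. \<lambda>i\<in>I. u i x mod (M i * N i)) ` A \<subseteq> PiE I ?R"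
    proof
      fix v assume "v \<in> (\<lambda>x. \<lambda>i\<in>I. u i x mod (M i * N i)) ` A"
      then obtain x where x: "x \<in> A" "v = (\<lambda>i\<in>I. u i x mod (M i * N i))" by auto
      have "u i x mod (M i * N i) \<in> ?R i" if "i \<in> I" for i
      proof -
        have "M i dvd (u i x - u i x0) - M i * (N i * (u i x div (M i * N i)))"
          by (rule dvd_diff[OF cong[OF x(1) x0 that] dvd_triv_left])
        also have "(u i x - u i x0) - M i * (N i * (u i x div (M i * N i)))
            = u i x mod (M i * N i) - u i x0"
          by (simp add: minus_mult_div_eq_mod[symmetric] mult.assoc)
        finally show ?thesis using pos[OF that] by simp
      qed
      then show "v \<in> PiE I ?R" unfolding x(2) by auto
    qed
    moreover have fin: "finite (PiE I ?R)"
      using I pos card_residues_le(1) by (intro finite_PiE) blast+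
    ultimately have "finite ((\<lambda>x. \<lambda>i\<in>I. u i x mod (M i * N i)) ` A)"
      "card ((\<lambda>x. \<lambda>i\<in>I. u i x mod (M i * N i)) ` A) \<le> card (PiE I ?R)"
      by (auto intro: finite_subset card_mono)
    moreover have "int (card (PiE I ?R)) = (\<Prod>i\<in>I. int (card (?R i)))"
      using I by (simp add: card_PiE)
    moreover have "\<dots> \<le> (\<Prod>i\<in>I. N i)"
      using pos card_residues_le(2) by (intro prod_mono) auto
    ultimately show ?thesis by linarith
  qed
  then show "finite ((\<lambda>x. \<lambda>i\<in>I. u i x mod (M i * N i)) ` A)"
    "int (card ((\<lambda>x. \<lambda>i\<in>I. u i x mod (M i * N i)) ` A)) \<le> (\<Prod>i\<in>I. N i)" by auto
qed

lemma card_image_determined: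
  assumes "\<And>x y. x \<in> A \<Longrightarrow> y \<in> A \<Longrightarrow> d x = d y \<Longrightarrow> z x = z y" and "finite (d ` A)"
  shows "finite (z ` A)" "card (z ` A) \<le> card (d ` A)"
proof -
  let ?g = "\<lambda>v. z (SOME x. x \<in> A \<and> d x = v)"
  have "z x = ?g (d x)" if "x \<in> A" for x
  proof -
    have "(SOME y. y \<in> A \<and> d y = d x) \<in> A \<and> d (SOME y. y \<in> A \<and> d y = d x) = d x"
      by (rule someI[of _ x]) (use that in auto)
    then show ?thesis using assms(1) that by metis
  qed
  then have eq: "z ` A = ?g ` (d ` A)" by (auto simp: image_iff)
  show "finite (z ` A)" unfolding eq using assms(2) by simp
  show "card (z ` A) \<le> card (d ` A)" unfolding eq using assms(2) by (rule card_image_le)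
qed

lemma card_image_two_stage:
  assumes d: "finite (d ` A)" and B: "\<And>v. v \<in> d ` A \<Longrightarrow> finite (z ` {x \<in> A. d x = v}) \<and> card (z ` {x \<in> A. d x = v}) \<le> B"
  shows "finite (z ` A)" "card (z ` A) \<le> card (d ` A) * B"
proof -
  have eq: "z ` A = (\<Union>v\<in>d ` A. z ` {x \<in> A. d x = v})" by auto
  show "finite (z ` A)" unfolding eq using d B by blast
  have "card (z ` A) \<le> (\<Sum>v\<in>d ` A. card (z ` {x \<in> A. d x = v}))"
    unfolding eq using d by (rule card_UN_le)
  also have "\<dots> \<le> (\<Sum>v\<in>d ` A. B)" using B by (intro sum_mono) auto
  finally show "card (z ` A) \<le> card (d ` A) * B" by simp
qed

text \<open>Cost, in powers of \<open>q ^ b\<close>, of prescribing modulo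
  \<open>q ^ (t * b)\<close> the power sums of degree \<open>j\<close> that are known only modulo
  \<open>q ^ (j * b)\<close>.\<close>

definition mu_exp :: "nat \<Rightarrow> nat \<Rightarrow> nat \<Rightarrow> nat" where
  "mu_exp r t k = (\<Sum>j\<in>{k - r<..t}. t - j)"

text \<open>Cost, in powers of \<open>q ^ a\<close>, of the close nodes: row \<open>i\<close> of the
  triangular system carries the factor \<open>q ^ (a * i)\<close>, hence needs that much extra
  precision. The rows with \<open>i < k - t\<close> have it already.\<close>

definition nu_exp :: "nat \<Rightarrow> nat \<Rightarrow> nat \<Rightarrow> nat" where
  "nu_exp r t k = (\<Sum>i\<in>{k - t..<r}. i)"

text \<open>Two refinements determine the variables modulo \<open>q ^ (t * b)\<close>. Prescribing
  the power sums of degrees between \<open>k - r\<close> and \<open>t\<close> modulo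
  \<open>q ^ (t * b)\<close> costs \<open>mu_exp\<close>; prescribing the antiderivative sums
  \<open>\<sigma> i\<close> modulo \<open>q ^ (t * b + a * i)\<close> for \<open>i >= k - t\<close>
  costs \<open>nu_exp\<close>. Then \<open>residues_determined\<close> applies.\<close>

lemma card_congruence_solutions:
  fixes q \<eta> :: int and \<xi> :: "nat \<Rightarrow> int"
  assumes q: "prime q" "int k < q" and rt: "r \<le> k" "t \<le> k" "k \<le> r + t"
    and ab: "(k - t - 1) * a \<le> b"
    and sep: "\<And>l m. l < r \<Longrightarrow> m < r \<Longrightarrow> l \<noteq> m \<Longrightarrow> q ^ a dvd \<xi> l - \<xi> m \<and> \<not> q ^ Suc a dvd \<xi> l - \<xi> m"
    and unit: "\<And>l. l < r \<Longrightarrow> \<not> q dvd \<xi> l - \<eta>"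
    and cls: "\<And>x l. x \<in> A \<Longrightarrow> l < r \<Longrightarrow> q ^ Suc a dvd x l - \<xi> l"
    and sys: "\<And>x y j. x \<in> A \<Longrightarrow> y \<in> A \<Longrightarrow> 1 \<le> j \<Longrightarrow> j \<le> k \<Longrightarrow>
        q ^ (j * b) dvd (\<Sum>l<r. (x l - \<eta>) ^ j) - (\<Sum>l<r. (y l - \<eta>) ^ j)"
  shows "finite ((\<lambda>x. \<lambda>l\<in>{..<r}. x l mod q ^ (t * b)) ` A)"
    "int (card ((\<lambda>x. \<lambda>l\<in>{..<r}. x l mod q ^ (t * b)) ` A)) \<le> q ^ (mu_exp r t k * b + nu_exp r t k * a)"
proof -
  have q0: "q > 0" using q by (simp add: prime_gt_0_int)
  define \<theta> where "\<theta> l = \<xi> l - \<eta>" for l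
  \<comment> \<open>Antiderivatives with \<open>e i = t\<close> involve only degrees above \<open>t\<close>, whose power sums are known modulo
    \<open>q ^ ((t + 1) * b)\<close>, so that the first \<open>k - t\<close> of them cost no additional residues.\<close>
  define e where "e i = (if i < k - t then t else k - r)" for i
  have deg: "e i + i < k" if "i < r" for i using that rt by (auto simp: e_def)
  define h where "h i = anti_poly k (node_poly (e i) \<theta> i)" for i
  define s where "s j x = (\<Sum>l<r. (x l - \<eta>) ^ j)" for j and x :: "nat \<Rightarrow> int"
  define \<sigma> where "\<sigma> i x = (\<Sum>l<r. poly (h i) (x l - \<eta>))" for i and x :: "nat \<Rightarrow> int"
  have \<sigma>_s: "\<sigma> i x = (\<Sum>j\<in>{e i<..k}. coeff (h i) j * s j x)" for i x
    unfolding \<sigma>_def s_def h_def poly_anti_node sum_distrib_left by (rule sum.swap)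
  have \<sigma>_dvd: "q ^ c dvd \<sigma> i x - \<sigma> i y"
    if "\<And>j. e i < j \<Longrightarrow> j \<le> k \<Longrightarrow> q ^ c dvd s j x - s j y" for c i x y
    unfolding \<sigma>_s sum_subtractf[symmetric] right_diff_distrib[symmetric]
    by (intro dvd_sum dvd_mult) (use that in auto)
  have sys': "q ^ c dvd s j x - s j y" if "x \<in> A" "y \<in> A" "1 \<le> j" "j \<le> k" "c \<le> j * b" for x y j c
    using sys[OF that(1-4)] that(5) unfolding s_def by (meson power_le_dvd)
  define z where "z = (\<lambda>x :: nat \<Rightarrow> int. \<lambda>l\<in>{..<r}. x l mod q ^ (t * b))"
  define J where "J = {k - r<..t}"
  define I where "I = {k - t..<r}"
  define d1 where "d1 = (\<lambda>x. \<lambda>j\<in>J. s j x mod (q ^ (j * b) * q ^ ((t - j) * b)))"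
  define d2 where "d2 = (\<lambda>x. \<lambda>i\<in>I. \<sigma> i x mod (q ^ (t * b) * q ^ (i * a)))"
  have d1: "finite (d1 ` A)" "int (card (d1 ` A)) \<le> (\<Prod>j\<in>J. q ^ ((t - j) * b))"
    unfolding d1_def
    by (rule card_refined_residues_le; use q0 rt in \<open>auto simp: J_def intro!: sys'\<close>)+
  have "finite (z ` {x \<in> A. d1 x = v}) \<and> card (z ` {x \<in> A. d1 x = v}) \<le> nat (\<Prod>i\<in>I. q ^ (i * a))"
    for v
  proof -
    let ?A = "{x \<in> A. d1 x = v}"
    have low: "q ^ (t * b) dvd s j x - s j y"
      if x: "x \<in> ?A" and y: "y \<in> ?A" and j: "k - r < j" "j \<le> k" for x y j
    proof (cases "j \<le> t")
      case True
      then have "j \<in> J" using j by (auto simp: J_def)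
      moreover have "d1 x j = d1 y j" using x y by auto
      ultimately have "s j x mod q ^ (j * b + (t - j) * b) = s j y mod q ^ (j * b + (t - j) * b)"
        by (simp add: d1_def power_add)
      moreover have "j * b + (t - j) * b = t * b" using True by (simp flip: add_mult_distrib)
      ultimately show ?thesis by (simp add: mod_eq_dvd_iff)
    next
      case False
      then show ?thesis using x y j by (intro sys') auto
    qed
    have d2: "finite (d2 ` ?A)" "int (card (d2 ` ?A)) \<le> (\<Prod>i\<in>I. q ^ (i * a))"
      unfolding d2_def
      by (rule card_refined_residues_le; use q0 in \<open>auto simp: I_def e_def intro!: \<sigma>_dvd low\<close>)+
    have det: "z x = z y" if x: "x \<in> ?A" and y: "y \<in> ?A" and xy: "d2 x = d2 y" for x y
    proof -
      have "q ^ (t * b + a * i) dvd \<sigma> i x - \<sigma> i y" if "i < r" for i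
      proof (cases "i < k - t")
        case True
        \<comment> \<open>The extra precision \<open>a * i\<close> has to fit into the one spare
          \<open>b\<close> between the moduli for \<open>t * b\<close> and
          \<open>(t + 1) * b\<close>; this is what \<open>ab\<close> provides.\<close>
        have "i * a \<le> (k - t - 1) * a" using True by (intro mult_le_mono1) linarith
        with ab have ia: "a * i \<le> b" by (metis mult.commute order_trans)
        show ?thesis
        proof (rule \<sigma>_dvd, rule sys')
          fix j assume "e i < j" "j \<le> k"
          then have "t + 1 \<le> j" "1 \<le> j" using True by (auto simp: e_def)
          then have "(t + 1) * b \<le> j * b" by (intro mult_right_mono) auto
          then show "t * b + a * i \<le> j * b" using ia by simp
        qed (use x y in auto)
      next
        case False
        then have "i \<in> I" using that by (auto simp: I_def)
        moreover have "d2 x i = d2 y i" using xy by simp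
        ultimately have "\<sigma> i x mod q ^ (t * b + i * a) = \<sigma> i y mod q ^ (t * b + i * a)"
          by (simp add: d2_def power_add)
        then show ?thesis by (simp add: mod_eq_dvd_iff mult.commute)
      qed
      then have H: "q ^ (t * b + a * i) dvd (\<Sum>l<r. poly (h i) (x l - \<eta>) - poly (h i) (y l - \<eta>))"
        if "i < r" for i using that unfolding \<sigma>_def sum_subtractf by blast
      have "q ^ (t * b) dvd (x l - \<eta>) - (y l - \<eta>)" if "l < r" for l
      proof (rule residues_determined[where z' = "\<lambda>l. x l - \<eta>" and z = "\<lambda>l. y l - \<eta>" and
              \<theta> = \<theta> and r = r and e = e and k = k and a = a, OF q deg])
        fix l assume l: "l < r"
        show "q ^ Suc a dvd y l - \<eta> - \<theta> l" "q ^ Suc a dvd x l - \<eta> - \<theta> l" "\<not> q dvd \<theta> l"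
          using cls[of y l] cls[of x l] unit[OF l] x y l by (simp_all add: \<theta>_def)
      next
        fix l m assume "l < r" "m < r" "l \<noteq> m"
        then show "q ^ a dvd \<theta> l - \<theta> m \<and> \<not> q ^ Suc a dvd \<theta> l - \<theta> m"
          using sep[of l m] by (simp add: \<theta>_def)
      next
        fix i assume "i < r"
        from H[OF this] show "q ^ (t * b + a * i) dvd
           (\<Sum>l<r. poly (anti_poly k (node_poly (e i) \<theta> i)) (x l - \<eta>)
             - poly (anti_poly k (node_poly (e i) \<theta> i)) (y l - \<eta>))"
          unfolding h_def .
      qed (use that in auto)
      then show ?thesis by (auto simp: z_def mod_eq_dvd_iff)
    qed
    from card_image_determined[of ?A d2 z, OF det d2(1)] d2(2) show ?thesis by linarith
  qed
  from card_image_two_stage[OF d1(1), of z, OF this]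
  have fin: "finite (z ` A)" and le: "card (z ` A) \<le> card (d1 ` A) * nat (\<Prod>i\<in>I. q ^ (i * a))" by auto
  show "finite ((\<lambda>x. \<lambda>l\<in>{..<r}. x l mod q ^ (t * b)) ` A)" using fin by (simp add: z_def)
  have pos: "0 \<le> (\<Prod>i\<in>I. q ^ (i * a))" using q0 by (intro prod_nonneg) auto
  have "int (card (z ` A)) \<le> int (card (d1 ` A)) * (\<Prod>i\<in>I. q ^ (i * a))"
    using le pos by (metis int_nat_eq nat_0_le of_nat_le_iff of_nat_mult)
  also have "\<dots> \<le> (\<Prod>j\<in>J. q ^ ((t - j) * b)) * (\<Prod>i\<in>I. q ^ (i * a))"
    using d1(2) pos by (rule mult_right_mono)
  also have "\<dots> = q ^ (mu_exp r t k * b + nu_exp r t k * a)"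
    by (simp add: power_add mu_exp_def nu_exp_def J_def I_def power_sum sum_distrib_right)
  finally show "int (card ((\<lambda>x. \<lambda>l\<in>{..<r}. x l mod q ^ (t * b)) ` A)) \<le> q ^ (mu_exp r t k * b + nu_exp r t k * a)"
    by (simp add: z_def)
qed

section \<open>Inequalities\<close>

text \<open>Translation invariance: by the binomial theorem a shifted power sum is a fixed linear
  combination of the power sums of degree at most \<open>j\<close>. Degree 0 is harmless because
  both sides have equally many variables.\<close>

lemma power_sums_shift:
  fixes x y :: "'a \<Rightarrow> int" and v w :: "'b \<Rightarrow> int"
  assumes eq: "\<forall>j\<in>{1..k}. (\<Sum>i\<in>I. x i ^ j) + (\<Sum>i\<in>J. v i ^ j) = (\<Sum>i\<in>I. y i ^ j) + (\<Sum>i\<in>J. w i ^ j)"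
    and j: "j \<le> k"
  shows "(\<Sum>i\<in>I. (x i - c) ^ j) + (\<Sum>i\<in>J. (v i - c) ^ j)
       = (\<Sum>i\<in>I. (y i - c) ^ j) + (\<Sum>i\<in>J. (w i - c) ^ j)"
proof -
  have expand: "(\<Sum>i\<in>A. (u i - c) ^ j) = (\<Sum>l\<le>j. int (j choose l) * (- c) ^ (j - l) * (\<Sum>i\<in>A. u i ^ l))"
    for u and A :: "'c set"
  proof -
    have "(\<Sum>i\<in>A. (u i - c) ^ j) = (\<Sum>i\<in>A. \<Sum>l\<le>j. int (j choose l) * (- c) ^ (j - l) * u i ^ l)"
      using binomial_ring[of "u _" "- c" j] by (simp add: mult_ac)
    then show ?thesis by (subst (asm) sum.swap) (simp add: sum_distrib_left)
  qed
  have eq': "(\<Sum>i\<in>I. x i ^ l) + (\<Sum>i\<in>J. v i ^ l) = (\<Sum>i\<in>I. y i ^ l) + (\<Sum>i\<in>J. w i ^ l)" if "l \<le> j" for l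
    using eq that j by (cases "l = 0") auto
  show ?thesis
    unfolding expand sum.distrib[symmetric] distrib_left[symmetric]
    by (intro sum.cong refl arg_cong[of _ _ "\<lambda>s. _ * s"] eq') simp
qed

text \<open>Call \<open>c\<close> large if \<open>g c\<close> is at least
  \<open>F / (2 * card C)\<close>. The other classes together contribute at most
  \<open>F / 2\<close>, so the large ones carry the remaining half; if there are fewer than
  \<open>R\<close> of them, the largest one carries \<open>F / (2 * R)\<close>. The first constant
  does not involve \<open>card C\<close>, which is essential later.\<close>

lemma few_or_many_large:
  fixes g :: "'c \<Rightarrow> real"
  assumes C: "finite C" "C \<noteq> {}" and g: "\<And>c. c \<in> C \<Longrightarrow> g c \<ge> 0" and F: "F \<le> sum g C"
  shows "(\<exists>c\<in>C. F \<le> 2 * real R * g c) \<or>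
    (\<exists>\<sigma>\<in>PiE {..<R} (\<lambda>_. C). inj_on \<sigma> {..<R} \<and> (\<forall>i<R. F \<le> 2 * real (card C) * g (\<sigma> i)))"
proof -
  define L where "L = {c \<in> C. F \<le> 2 * real (card C) * g c}"
  have finL: "finite L" using C by (simp add: L_def)
  have cC: "real (card C) > 0" using C by (simp add: card_gt_0_iff)
  have small: "sum g (C - L) \<le> F / 2" if "F \<ge> 0"
  proof -
    have "sum g (C - L) \<le> (\<Sum>c\<in>C - L. F / (2 * real (card C)))"
      using cC by (intro sum_mono) (auto simp: L_def field_simps)
    also have "\<dots> = real (card (C - L)) * (F / (2 * real (card C)))" by simp
    also have "\<dots> \<le> real (card C) * (F / (2 * real (card C)))"
      using C that by (intro mult_right_mono) (auto intro!: card_mono)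
    finally show ?thesis using cC by simp
  qed
  show ?thesis
  proof (cases "R \<le> card L")
    case True
    then obtain \<tau> where \<tau>: "\<tau> ` {..<R} \<subseteq> L" "inj_on \<tau> {..<R}"
      using card_le_inj[of "{..<R}" L] finL by auto
    have "restrict \<tau> {..<R} \<in> PiE {..<R} (\<lambda>_. C)" "inj_on (restrict \<tau> {..<R}) {..<R}"
      using \<tau> by (auto simp: L_def inj_on_def)
    moreover have "\<forall>i<R. F \<le> 2 * real (card C) * g (restrict \<tau> {..<R} i)"
      using \<tau>(1) by (auto simp: L_def)
    ultimately show ?thesis by blast
  next
    case False
    show ?thesis
    proof (cases "F \<ge> 0 \<and> L \<noteq> {}")
      case True
      obtain c where c: "c \<in> L" "\<And>d. d \<in> L \<Longrightarrow> g d \<le> g c"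
      proof -
        have "Max (g ` L) \<in> g ` L" using True finL by (intro Max_in) auto
        then obtain c where "c \<in> L" "g c = Max (g ` L)" by auto
        then show thesis using that finL by simp
      qed
      have "sum g C = sum g L + sum g (C - L)"
        using C by (intro sum.subset_diff[of L C g, unfolded add.commute[of "sum g (C - L)"]]) (auto simp: L_def)
      moreover have "sum g L \<le> real (card L) * g c"
        using c by (intro sum_bounded_above) auto
      ultimately have "F \<le> 2 * real (card L) * g c" using F small True by linarith
      also have "\<dots> \<le> 2 * real R * g c"
        using False c(1) g by (intro mult_right_mono) (auto simp: L_def)
      finally show ?thesis using c(1) by (auto simp: L_def)
    next
      case neg: False
      obtain c where c: "c \<in> C" using C by auto
      have "F \<le> 0"
      proof (cases "F \<ge> 0")
        case True
        then have "L = {}" using neg by simp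
        then show ?thesis using small[OF True] F by simp
      qed simp
      moreover have "0 \<le> 2 * real R * g c" using g[OF c] by simp
      ultimately show ?thesis using c by force
    qed
  qed
qed

text \<open>Comparison with the largest summand. It is weaker than Hoelder by a factor
  \<open>card C\<close>, which is affordable because \<open>card C\<close> will be the fixed number
  \<open>q\<close>.\<close>

lemma sum_power_le:
  fixes g :: "'c \<Rightarrow> real"
  assumes "finite C" "C \<noteq> {}" "\<And>c. c \<in> C \<Longrightarrow> g c \<ge> 0" "0 \<le> F" "F \<le> sum g C"
  shows "F ^ p \<le> real (card C) ^ p * (\<Sum>c\<in>C. g c ^ p)"
proof -
  have "Max (g ` C) \<in> g ` C" using assms by (intro Max_in) auto
  then obtain c where c: "c \<in> C" "g c = Max (g ` C)" by auto
  have "F \<le> real (card C) * g c"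
    using assms(5) sum_bounded_above[of C g "g c"] c assms(1) by (force simp: c(2))
  then have "F ^ p \<le> (real (card C) * g c) ^ p" using assms by (intro power_mono)
  also have "\<dots> \<le> real (card C) ^ p * (\<Sum>c\<in>C. g c ^ p)"
    unfolding power_mult_distrib using assms c(1) by (intro mult_left_mono member_le_sum) auto
  finally show ?thesis .
qed

text \<open>The largest factor bounds the product, and its power is one of the summands. This
  separates a product over \<open>r\<close> classes into means over single classes at the cost of a
  factor \<open>r\<close>.\<close>

lemma prod_power_le_sum:
  fixes x :: "nat \<Rightarrow> real"
  assumes "r > 0" and x: "\<And>l. l < r \<Longrightarrow> x l \<ge> 0"
  shows "(\<Prod>l<r. x l) ^ m \<le> (\<Sum>l<r. x l ^ (r * m))"
proof -
  obtain l0 where l0: "l0 < r" "\<And>l. l < r \<Longrightarrow> x l \<le> x l0"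
  proof -
    have "finite (x ` {..<r})" "x ` {..<r} \<noteq> {}" using assms by auto
    then have "Max (x ` {..<r}) \<in> x ` {..<r}" by (rule Max_in)
    then obtain l0 where "l0 < r" "x l0 = Max (x ` {..<r})" by auto
    then show thesis using that by simp
  qed
  have "(\<Prod>l<r. x l) \<le> (\<Prod>l<r. x l0)" using l0 x by (intro prod_mono) auto
  then have "(\<Prod>l<r. x l) ^ m \<le> (x l0 ^ r) ^ m"
    using x by (intro power_mono prod_nonneg) auto
  also have "\<dots> = x l0 ^ (r * m)" by (simp add: power_mult)
  also have "\<dots> \<le> (\<Sum>l<r. x l ^ (r * m))"
    using l0 x by (intro member_le_sum) auto
  finally show ?thesis .
qed

text \<open>Dividing by the two sums reduces the claim to Young's inequality for each
  summand.\<close>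

lemma sum_holder:
  fixes F G :: "'a \<Rightarrow> real"
  assumes fin: "finite A" and F: "\<And>x. x \<in> A \<Longrightarrow> F x \<ge> 0" and G: "\<And>x. x \<in> A \<Longrightarrow> G x \<ge> 0"
    and p: "0 < p" "p < 1"
  shows "(\<Sum>x\<in>A. F x powr p * G x powr (1 - p)) \<le> sum F A powr p * sum G A powr (1 - p)"
proof (cases "sum F A = 0 \<or> sum G A = 0")
  case True
  then have "\<forall>x\<in>A. F x = 0 \<or> G x = 0"
    using sum_nonneg_eq_0_iff[of A F] sum_nonneg_eq_0_iff[of A G] fin F G by blast
  then have "(\<Sum>x\<in>A. F x powr p * G x powr (1 - p)) = 0" by (intro sum.neutral) auto
  then show ?thesis by simp
next
  case False
  define a where "a = sum F A"
  define b where "b = sum G A"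
  have ab: "a > 0" "b > 0"
    using False sum_nonneg[of A F] sum_nonneg[of A G] F G by (force simp: a_def b_def)+
  have "(\<Sum>x\<in>A. (F x / a) powr p * (G x / b) powr (1 - p))
      \<le> (\<Sum>x\<in>A. p * (F x / a) + (1 - p) * (G x / b))"
  proof (intro sum_mono)
    fix x assume x: "x \<in> A"
    show "(F x / a) powr p * (G x / b) powr (1 - p) \<le> p * (F x / a) + (1 - p) * (G x / b)"
    proof (cases "F x = 0 \<or> G x = 0")
      case True
      then show ?thesis using F[OF x] G[OF x] ab p by auto
    next
      case False
      then have "F x / a > 0" "G x / b > 0" using F[OF x] G[OF x] ab by (auto simp: less_le)
      then show ?thesis using p by (intro Youngs_inequality_0) auto
    qed
  qed
  also have "\<dots> = p * (sum F A / a) + (1 - p) * (sum G A / b)"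
    by (simp add: sum.distrib sum_distrib_left sum_divide_distrib)
  also have "\<dots> = 1" using ab by (simp add: a_def b_def)
  also have "(\<Sum>x\<in>A. (F x / a) powr p * (G x / b) powr (1 - p))
      = (\<Sum>x\<in>A. F x powr p * G x powr (1 - p)) / (a powr p * b powr (1 - p))"
    unfolding sum_divide_distrib using F G ab
    by (intro sum.cong) (auto simp: powr_divide)
  finally show ?thesis using ab by (simp add: a_def b_def field_simps)
qed

text \<open>The natural exponents may be 0, where \<open>0 ^ 0 = 1\<close> meets
  \<open>0 powr p = 0\<close>. The positivity assumptions ensure that at base 0 both sides
  vanish.\<close>

lemma power_powr_interpolation:
  fixes x y p :: real
  assumes "x \<ge> 0" "y \<ge> 0" "0 < p" "p < 1"
    and "real c * p + real d * (1 - p) = real m" "real c' * p + real d' * (1 - p) = real m'"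
    and "m > 0" "m' > 0" "c > 0 \<or> d > 0" "c' > 0 \<or> d' > 0"
  shows "(x ^ c * y ^ c') powr p * (x ^ d * y ^ d') powr (1 - p) = x ^ m * y ^ m'"
proof -
  have *: "(z ^ c) powr p * (z ^ d) powr (1 - p) = z ^ m"
    if "z \<ge> 0" "real c * p + real d * (1 - p) = real m" "m > 0" "c > 0 \<or> d > 0" for z :: real and c d m
  proof (cases "z = 0")
    case True
    then show ?thesis using that by (auto simp: power_0_left)
  next
    case False
    then have z: "z > 0" using that by simp
    then have "(z ^ c) powr p * (z ^ d) powr (1 - p) = z powr (real c * p + real d * (1 - p))"
      by (simp add: powr_realpow[symmetric] powr_powr powr_add)
    also have "\<dots> = z ^ m" using z that(2) by (simp add: powr_realpow)
    finally show ?thesis .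
  qed
  have "(x ^ c * y ^ c') powr p * (x ^ d * y ^ d') powr (1 - p)
      = ((x ^ c) powr p * (x ^ d) powr (1 - p)) * ((y ^ c') powr p * (y ^ d') powr (1 - p))"
    using assms(1,2) by (simp add: powr_mult)
  then show ?thesis using *[of x c d m] *[of y c' d' m'] assms by simp
qed

section \<open>Exponential sums on a finite torus\<close>

text \<open>The circle method integral over the unit cube is replaced by the mean over the points
  \<open>\<alpha> / N\<close> with \<open>\<alpha> \<in> {0..<N}\<^sup>k\<close>, which is exact for trigonometric polynomials whose frequencies
  are smaller than \<open>N\<close>; all integrals become finite sums.\<close>

locale torus =
  fixes k N :: nat
  assumes N_pos: "N > 0"
begin

definition points :: "(nat \<Rightarrow> nat) set" where
  "points = PiE {1..k} (\<lambda>_. {..<N})"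

definition mean :: "((nat \<Rightarrow> nat) \<Rightarrow> 'a :: real_normed_field) \<Rightarrow> 'a" where
  "mean F = (\<Sum>\<alpha>\<in>points. F \<alpha>) / of_nat (card points)"

text \<open>The additive character of \<open>(Z/N)^k\<close> with frequency vector
  \<open>h\<close>.\<close>

definition chi :: "(nat \<Rightarrow> int) \<Rightarrow> (nat \<Rightarrow> nat) \<Rightarrow> complex" where
  "chi h \<alpha> = (\<Prod>j\<in>{1..k}. cis (2 * pi * real (\<alpha> j) * of_int (h j) / N))"

lemma finite_points [simp]: "finite points"
  by (auto simp: points_def intro: finite_PiE)

lemma card_points: "card points = N ^ k"
  by (simp add: points_def card_PiE)

lemma card_points_pos: "card points > 0"
  using N_pos by (simp add: card_points)

lemma mean_add: "mean (\<lambda>\<alpha>. F \<alpha> + G \<alpha>) = mean F + mean G"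
  by (simp add: mean_def sum.distrib add_divide_distrib)

lemma mean_cmult: "mean (\<lambda>\<alpha>. c * F \<alpha>) = c * mean F"
  by (simp add: mean_def sum_distrib_left)

lemma mean_sum: "mean (\<lambda>\<alpha>. \<Sum>i\<in>I. F i \<alpha>) = (\<Sum>i\<in>I. mean (F i))"
  by (simp add: mean_def sum_divide_distrib sum.swap[of _ I])

lemma mean_of_real: "mean (\<lambda>\<alpha>. of_real (F \<alpha>)) = of_real (mean F)"
  by (simp add: mean_def)

lemma mean_mono: "(\<And>\<alpha>. F \<alpha> \<le> G \<alpha>) \<Longrightarrow> mean F \<le> (mean G :: real)"
  unfolding mean_def by (intro divide_right_mono sum_mono) auto

lemma mean_nonneg: "(\<And>\<alpha>. 0 \<le> F \<alpha>) \<Longrightarrow> 0 \<le> (mean F :: real)"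
  unfolding mean_def by (intro divide_nonneg_nonneg sum_nonneg) auto

lemma mean_holder:
  fixes F G :: "(nat \<Rightarrow> nat) \<Rightarrow> real"
  assumes F: "\<And>\<alpha>. F \<alpha> \<ge> 0" and G: "\<And>\<alpha>. G \<alpha> \<ge> 0" and p: "0 < p" "p < 1"
  shows "mean (\<lambda>\<alpha>. F \<alpha> powr p * G \<alpha> powr (1 - p)) \<le> mean F powr p * mean G powr (1 - p)"
proof -
  let ?c = "real (card points)"
  have c: "?c > 0" using card_points_pos by simp
  have "mean (\<lambda>\<alpha>. F \<alpha> powr p * G \<alpha> powr (1 - p))
      \<le> (sum F points powr p * sum G points powr (1 - p)) / ?c"
    unfolding mean_def using sum_holder[of points F G p] F G p by (intro divide_right_mono) auto
  also have "\<dots> = mean F powr p * mean G powr (1 - p)"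
    unfolding mean_def using c
    by (simp add: powr_divide sum_nonneg F G powr_diff)
  finally show ?thesis .
qed

text \<open>Hoelder's inequality in the form used below: the exponent pair \<open>(m, m')\<close> is
  the convex combination of \<open>(c, c')\<close> and \<open>(d, d')\<close> with weights
  \<open>p\<close> and \<open>1 - p\<close>.\<close>

lemma mean_interpolation:
  fixes p :: real
  assumes X: "\<And>\<alpha>. X \<alpha> \<ge> 0" and Y: "\<And>\<alpha>. Y \<alpha> \<ge> 0" and "0 < p" "p < 1"
    and "real c * p + real d * (1 - p) = real m" "real c' * p + real d' * (1 - p) = real m'"
    and "m > 0" "m' > 0" "c > 0 \<or> d > 0" "c' > 0 \<or> d' > 0"
  shows "mean (\<lambda>\<alpha>. X \<alpha> ^ m * Y \<alpha> ^ m')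
    \<le> mean (\<lambda>\<alpha>. X \<alpha> ^ c * Y \<alpha> ^ c') powr p * mean (\<lambda>\<alpha>. X \<alpha> ^ d * Y \<alpha> ^ d') powr (1 - p)"
proof -
  have "mean (\<lambda>\<alpha>. X \<alpha> ^ m * Y \<alpha> ^ m')
      = mean (\<lambda>\<alpha>. (X \<alpha> ^ c * Y \<alpha> ^ c') powr p * (X \<alpha> ^ d * Y \<alpha> ^ d') powr (1 - p))"
    using assms by (subst power_powr_interpolation[where m = m and m' = m']) auto
  also have "\<dots> \<le> mean (\<lambda>\<alpha>. X \<alpha> ^ c * Y \<alpha> ^ c') powr p * mean (\<lambda>\<alpha>. X \<alpha> ^ d * Y \<alpha> ^ d') powr (1 - p)"
    by (rule mean_holder) (use assms in auto)
  finally show ?thesis .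
qed

lemma chi_add: "chi (\<lambda>j. g j + h j) \<alpha> = chi g \<alpha> * chi h \<alpha>"
  unfolding chi_def prod.distrib[symmetric]
  by (intro prod.cong) (auto simp: cis_mult add_divide_distrib distrib_left)

lemma chi_uminus: "chi (\<lambda>j. - h j) \<alpha> = cnj (chi h \<alpha>)"
  by (simp add: chi_def cis_cnj)

lemma chi_sum: "finite I \<Longrightarrow> chi (\<lambda>j. \<Sum>i\<in>I. H i j) \<alpha> = (\<Prod>i\<in>I. chi (H i) \<alpha>)"
proof (induction I rule: finite_induct)
  case empty
  show ?case by (simp add: chi_def)
qed (simp add: chi_add)

lemma sum_cis_eq_0:
  assumes "\<bar>h\<bar> < int N" "h \<noteq> 0"
  shows "(\<Sum>a<N. cis (2 * pi * real a * of_int h / N)) = 0"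
proof -
  define w where "w = cis (2 * pi * of_int h / N)"
  have N: "real N > 0" using N_pos by simp
  have w1: "w \<noteq> 1"
  proof
    assume "w = 1"
    then have "cos (2 * pi * of_int h / N) = 1"
      unfolding w_def by (metis cis.simps(1) one_complex.simps(1))
    then obtain m :: int where "2 * pi * of_int h / N = of_int m * 2 * pi"
      unfolding cos_one_2pi_int by auto
    then have "real_of_int h = real_of_int m * real N"
      using N by (simp add: field_simps)
    then have "h = m * int N"
      by (metis of_int_eq_iff of_int_mult of_int_of_nat_eq)
    then have "int N dvd h" by simp
    then show False using assms zdvd_not_zless[of "\<bar>h\<bar>" "int N"] by auto
  qed
  have "w ^ N = cis (real N * (2 * pi * of_int h / N))"
    unfolding w_def by (rule Complex.DeMoivre)
  also have "real N * (2 * pi * of_int h / N) = 2 * pi * of_int h" using N by simp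
  also have "cis (2 * pi * of_int h) = 1" by (rule cis_multiple_2pi) simp
  finally have wN: "w ^ N = 1" .
  have "(\<Sum>a<N. cis (2 * pi * real a * of_int h / N)) = (\<Sum>a<N. w ^ a)"
    unfolding w_def Complex.DeMoivre by (intro sum.cong) (auto simp: mult_ac)
  also have "\<dots> = 0" using w1 wN by (simp add: geometric_sum)
  finally show ?thesis .
qed

lemma mean_chi:
  assumes "\<And>j. j \<in> {1..k} \<Longrightarrow> \<bar>h j\<bar> < int N"
  shows "mean (chi h) = (if \<forall>j\<in>{1..k}. h j = 0 then 1 else 0)"
proof -
  have "(\<Sum>\<alpha>\<in>points. chi h \<alpha>)
      = (\<Prod>j\<in>{1..k}. \<Sum>a<N. cis (2 * pi * real a * of_int (h j) / N))"
    unfolding chi_def points_def by (subst prod_sum_PiE) auto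
  also have "\<dots> = (if \<forall>j\<in>{1..k}. h j = 0 then of_nat (card points) else 0)"
  proof (cases "\<forall>j\<in>{1..k}. h j = 0")
    case True
    then show ?thesis by (simp add: card_points)
  next
    case False
    then obtain j where "j \<in> {1..k}" "h j \<noteq> 0" by blast
    then show ?thesis using sum_cis_eq_0[of "h j"] assms[of j] by (subst prod_zero) auto
  qed
  finally show ?thesis using card_points_pos by (auto simp: mean_def card_gt_0_iff)
qed

definition e :: "int \<Rightarrow> (nat \<Rightarrow> nat) \<Rightarrow> complex" where
  "e x = chi (\<lambda>j. x ^ j)"

text \<open>The size condition keeps every difference of power sums below \<open>N\<close> in
  absolute value. Hence orthogonality on the torus detects equality of integers and not merely
  congruence modulo \<open>N\<close>.\<close>

lemma mean_e_tuples:
  assumes fin: "finite I" "finite J" and Q: "Q \<ge> 1" "int (card I + card J) * Q ^ k < int N"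
    and x: "\<And>i. i \<in> I \<Longrightarrow> x i \<in> {0..<Q}" and y: "\<And>i. i \<in> I \<Longrightarrow> y i \<in> {0..<Q}"
    and v: "\<And>i. i \<in> J \<Longrightarrow> v i \<in> {0..<Q}" and w: "\<And>i. i \<in> J \<Longrightarrow> w i \<in> {0..<Q}"
  shows "mean (\<lambda>\<alpha>. (\<Prod>i\<in>I. e (x i) \<alpha>) * cnj (\<Prod>i\<in>I. e (y i) \<alpha>)
                    * ((\<Prod>i\<in>J. e (v i) \<alpha>) * cnj (\<Prod>i\<in>J. e (w i) \<alpha>)))
     = (if \<forall>j\<in>{1..k}. (\<Sum>i\<in>I. x i ^ j) + (\<Sum>i\<in>J. v i ^ j) = (\<Sum>i\<in>I. y i ^ j) + (\<Sum>i\<in>J. w i ^ j)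
        then 1 else 0)"
proof -
  define h where "h j = ((\<Sum>i\<in>I. x i ^ j) + - (\<Sum>i\<in>I. y i ^ j)) + ((\<Sum>i\<in>J. v i ^ j) + - (\<Sum>i\<in>J. w i ^ j))" for j
  have eq: "(\<lambda>\<alpha>. (\<Prod>i\<in>I. e (x i) \<alpha>) * cnj (\<Prod>i\<in>I. e (y i) \<alpha>)
                    * ((\<Prod>i\<in>J. e (v i) \<alpha>) * cnj (\<Prod>i\<in>J. e (w i) \<alpha>))) = chi h"
    unfolding h_def chi_add chi_uminus e_def using fin by (simp add: chi_sum fun_eq_iff)
  have pw: "0 \<le> (\<Sum>i\<in>K. u i ^ j) \<and> (\<Sum>i\<in>K. u i ^ j) \<le> int (card K) * Q ^ k"
    if "\<And>i. i \<in> K \<Longrightarrow> u i \<in> {0..<Q}" "j \<le> k" for K :: "'c set" and u j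
  proof -
    have le: "u i ^ j \<le> Q ^ k" if i: "i \<in> K" for i
    proof -
      have "u i ^ j \<le> Q ^ j" using \<open>\<And>i. i \<in> K \<Longrightarrow> u i \<in> {0..<Q}\<close>[OF i] by (intro power_mono) auto
      also have "\<dots> \<le> Q ^ k" using \<open>j \<le> k\<close> Q(1) by (intro power_increasing) auto
      finally show ?thesis .
    qed
    have "0 \<le> (\<Sum>i\<in>K. u i ^ j)" using that by (intro sum_nonneg) auto
    then show ?thesis using sum_bounded_above[of K "\<lambda>i. u i ^ j" "Q ^ k"] le by auto
  qed
  have "\<bar>h j\<bar> < int N" if "j \<in> {1..k}" for j
  proof -
    have j: "j \<le> k" using that by simp
    have "int (card I) * Q ^ k + int (card J) * Q ^ k < int N"
      using Q(2) by (simp add: distrib_right)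
    with pw[of I x j, OF x j, THEN conjunct1] pw[of I y j, OF y j, THEN conjunct1]
      pw[of J v j, OF v j, THEN conjunct1] pw[of J w j, OF w j, THEN conjunct1]
      pw[of I x j, OF x j, THEN conjunct2] pw[of I y j, OF y j, THEN conjunct2]
      pw[of J v j, OF v j, THEN conjunct2] pw[of J w j, OF w j, THEN conjunct2]
    show ?thesis unfolding h_def by linarith
  qed
  then show ?thesis unfolding eq by (subst mean_chi) (auto simp: h_def algebra_simps)
qed

lemma cmod_prod_sum_e_sq:
  assumes "finite I" "\<And>i. i \<in> I \<Longrightarrow> finite (A i)"
  shows "complex_of_real ((cmod (\<Prod>i\<in>I. \<Sum>x\<in>A i. e x \<alpha>))\<^sup>2)
    = (\<Sum>x\<in>PiE I A. \<Sum>y\<in>PiE I A. (\<Prod>i\<in>I. e (x i) \<alpha>) * cnj (\<Prod>i\<in>I. e (y i) \<alpha>))"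
  unfolding complex_norm_square using assms
  by (simp add: prod_sum_PiE sum_product)

lemma mean_prod_sum_e_sq:
  assumes fin: "finite I" and A: "\<And>i. i \<in> I \<Longrightarrow> A i \<subseteq> {0..<Q}"
    and Q: "Q \<ge> 1" "int (card I) * Q ^ k < int N"
  shows "mean (\<lambda>\<alpha>. (cmod (\<Prod>i\<in>I. \<Sum>x\<in>A i. e x \<alpha>))\<^sup>2)
    = real (card {(x, y). x \<in> PiE I A \<and> y \<in> PiE I A \<and>
          (\<forall>j\<in>{1..k}. (\<Sum>i\<in>I. x i ^ j) = (\<Sum>i\<in>I. y i ^ j))})" (is "_ = real (card ?S)")
proof -
  have finA: "finite (A i)" if "i \<in> I" for i using A[OF that] by (rule finite_subset) simp
  have finP: "finite (PiE I A)" using fin finA by (intro finite_PiE) auto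
  have one: "mean (\<lambda>\<alpha>. (\<Prod>i\<in>I. e (x i) \<alpha>) * cnj (\<Prod>i\<in>I. e (y i) \<alpha>))
      = (if \<forall>j\<in>{1..k}. (\<Sum>i\<in>I. x i ^ j) = (\<Sum>i\<in>I. y i ^ j) then 1 else 0)"
    if "x \<in> PiE I A" "y \<in> PiE I A" for x y
    using mean_e_tuples[of I "{} :: nat set" Q x y "\<lambda>_. 0" "\<lambda>_. 0"] that A Q fin by fastforce
  have "complex_of_real (mean (\<lambda>\<alpha>. (cmod (\<Prod>i\<in>I. \<Sum>x\<in>A i. e x \<alpha>))\<^sup>2))
      = (\<Sum>x\<in>PiE I A. \<Sum>y\<in>PiE I A. mean (\<lambda>\<alpha>. (\<Prod>i\<in>I. e (x i) \<alpha>) * cnj (\<Prod>i\<in>I. e (y i) \<alpha>)))"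
    unfolding mean_of_real[symmetric] using fin finA
    by (simp only: cmod_prod_sum_e_sq mean_sum)
  also have "\<dots> = (\<Sum>x\<in>PiE I A. \<Sum>y\<in>PiE I A.
      if \<forall>j\<in>{1..k}. (\<Sum>i\<in>I. x i ^ j) = (\<Sum>i\<in>I. y i ^ j) then 1 else 0)"
    by (intro sum.cong one refl)
  also have "\<dots> = (\<Sum>(x, y)\<in>PiE I A \<times> PiE I A.
      if \<forall>j\<in>{1..k}. (\<Sum>i\<in>I. x i ^ j) = (\<Sum>i\<in>I. y i ^ j) then 1 else 0)"
    by (simp add: sum.cartesian_product)
  also have "\<dots> = (\<Sum>p\<in>?S. 1)"
    using finP by (intro sum.mono_neutral_cong_right) (auto split: if_splits)
  also have "\<dots> = of_real (real (card ?S))" by simp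
  finally show ?thesis unfolding of_real_eq_iff .
qed

lemma mean_cmod_sum_sq:
  fixes w :: "(nat \<Rightarrow> nat) \<Rightarrow> real"
  shows "complex_of_real (mean (\<lambda>\<alpha>. (cmod (\<Sum>x\<in>Y. \<Phi> x \<alpha>))\<^sup>2 * w \<alpha>))
     = (\<Sum>x\<in>Y. \<Sum>y\<in>Y. mean (\<lambda>\<alpha>. \<Phi> x \<alpha> * cnj (\<Phi> y \<alpha>) * of_real (w \<alpha>)))"
proof -
  have "complex_of_real ((cmod (\<Sum>x\<in>Y. \<Phi> x \<alpha>))\<^sup>2 * w \<alpha>)
      = (\<Sum>x\<in>Y. \<Sum>y\<in>Y. \<Phi> x \<alpha> * cnj (\<Phi> y \<alpha>) * of_real (w \<alpha>))" for \<alpha>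
    unfolding of_real_mult complex_norm_square cnj_sum sum_product
    unfolding sum_distrib_right ..
  then show ?thesis unfolding mean_of_real[symmetric] mean_sum[symmetric] by presburger
qed

text \<open>Cross terms between different fibres of \<open>m\<close> vanish, so the mean square
  splits over these fibres. Inside a fibre Cauchy-Schwarz over the at most \<open>D\<close> values
  of \<open>z\<close> costs the factor \<open>D\<close>.\<close>

lemma mean_almost_orthogonal:
  fixes w :: "(nat \<Rightarrow> nat) \<Rightarrow> real"
  assumes fin: "finite X" and w: "\<And>\<alpha>. w \<alpha> \<ge> 0"
    and vanish: "\<And>x y. x \<in> X \<Longrightarrow> y \<in> X \<Longrightarrow> m x \<noteq> m y \<Longrightarrow>
          mean (\<lambda>\<alpha>. \<Phi> x \<alpha> * cnj (\<Phi> y \<alpha>) * of_real (w \<alpha>)) = 0"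
    and D: "\<And>c. real (card (z ` {x \<in> X. m x = c})) \<le> D"
  shows "mean (\<lambda>\<alpha>. (cmod (\<Sum>x\<in>X. \<Phi> x \<alpha>))\<^sup>2 * w \<alpha>)
     \<le> D * (\<Sum>\<zeta>\<in>z ` X. mean (\<lambda>\<alpha>. (cmod (\<Sum>x | x \<in> X \<and> z x = \<zeta>. \<Phi> x \<alpha>))\<^sup>2 * w \<alpha>))"
proof -
  define Q where "Q Y = mean (\<lambda>\<alpha>. (cmod (\<Sum>x\<in>Y. \<Phi> x \<alpha>))\<^sup>2 * w \<alpha>)" for Y
  define G where "G x y = mean (\<lambda>\<alpha>. \<Phi> x \<alpha> * cnj (\<Phi> y \<alpha>) * of_real (w \<alpha>))" for x y
  have Q: "complex_of_real (Q Y) = (\<Sum>x\<in>Y. \<Sum>y\<in>Y. G x y)" for Y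
    unfolding Q_def G_def by (rule mean_cmod_sum_sq)
  have split: "Q Y = (\<Sum>c\<in>m ` X. Q {x \<in> Y. m x = c})" if Y: "Y \<subseteq> X" for Y
  proof -
    have finY: "finite Y" using Y fin by (rule finite_subset)
    have "complex_of_real (Q Y) = (\<Sum>c\<in>m ` X. \<Sum>x | x \<in> Y \<and> m x = c. \<Sum>y\<in>Y. G x y)"
      unfolding Q using Y fin finY by (intro sum.group[symmetric]) auto
    also have "\<dots> = (\<Sum>c\<in>m ` X. \<Sum>x | x \<in> Y \<and> m x = c. \<Sum>y | y \<in> Y \<and> m y = c. G x y)"
    proof (rule sum.cong[OF refl], rule sum.cong[OF refl])
      fix c x assume "x \<in> {x \<in> Y. m x = c}"
      then show "(\<Sum>y\<in>Y. G x y) = (\<Sum>y | y \<in> Y \<and> m y = c. G x y)"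
        using vanish Y finY unfolding G_def by (intro sum.mono_neutral_right) fastforce+
    qed
    also have "\<dots> = of_real (\<Sum>c\<in>m ` X. Q {x \<in> Y. m x = c})"
      by (simp add: Q)
    finally show ?thesis unfolding of_real_eq_iff .
  qed
  have Q_nonneg: "Q Y \<ge> 0" for Y unfolding Q_def using w by (intro mean_nonneg) auto
  have block: "Q Y \<le> D * (\<Sum>\<zeta>\<in>z ` X. Q {x \<in> Y. z x = \<zeta>})" if Y: "Y = {x \<in> X. m x = c}" for Y c
  proof -
    have finY: "finite Y" using Y fin by auto
    have "(cmod (\<Sum>x\<in>Y. \<Phi> x \<alpha>))\<^sup>2 * w \<alpha>
        \<le> D * (\<Sum>\<zeta>\<in>z ` Y. (cmod (\<Sum>x | x \<in> Y \<and> z x = \<zeta>. \<Phi> x \<alpha>))\<^sup>2 * w \<alpha>)" for \<alpha>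
    proof -
      let ?s = "\<lambda>\<zeta>. \<Sum>x | x \<in> Y \<and> z x = \<zeta>. \<Phi> x \<alpha>"
      have "(\<Sum>x\<in>Y. \<Phi> x \<alpha>) = (\<Sum>\<zeta>\<in>z ` Y. ?s \<zeta>)"
        using finY by (intro sum.group[symmetric]) auto
      then have "cmod (\<Sum>x\<in>Y. \<Phi> x \<alpha>) \<le> (\<Sum>\<zeta>\<in>z ` Y. cmod (?s \<zeta>))"
        using norm_sum by metis
      then have "(cmod (\<Sum>x\<in>Y. \<Phi> x \<alpha>))\<^sup>2 \<le> (\<Sum>\<zeta>\<in>z ` Y. cmod (?s \<zeta>))\<^sup>2"
        by (intro power_mono) auto
      also have "\<dots> \<le> real (card (z ` Y)) * (\<Sum>\<zeta>\<in>z ` Y. (cmod (?s \<zeta>))\<^sup>2)"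
        using sum_squared_le_sum_of_squares[of "\<lambda>\<zeta>. cmod (?s \<zeta>)" "z ` Y"] finY by (simp add: mult.commute)
      also have "\<dots> \<le> D * (\<Sum>\<zeta>\<in>z ` Y. (cmod (?s \<zeta>))\<^sup>2)"
        unfolding Y by (intro mult_right_mono D sum_nonneg) auto
      finally show ?thesis using w[of \<alpha>]
        by (simp add: sum_distrib_right[symmetric] mult.assoc[symmetric] mult_right_mono)
    qed
    then have "Q Y \<le> mean (\<lambda>\<alpha>. D * (\<Sum>\<zeta>\<in>z ` Y. (cmod (\<Sum>x | x \<in> Y \<and> z x = \<zeta>. \<Phi> x \<alpha>))\<^sup>2 * w \<alpha>))"
      unfolding Q_def by (rule mean_mono)
    also have "\<dots> = D * (\<Sum>\<zeta>\<in>z ` Y. Q {x \<in> Y. z x = \<zeta>})"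
      unfolding mean_cmult mean_sum Q_def ..
    also have "\<dots> \<le> D * (\<Sum>\<zeta>\<in>z ` X. Q {x \<in> Y. z x = \<zeta>})"
    proof (intro mult_left_mono sum_mono2)
      show "0 \<le> D" using D[of undefined] by (meson of_nat_0_le_iff order_trans)
    qed (use fin Y Q_nonneg in auto)
    finally show ?thesis .
  qed
  have "Q X = (\<Sum>c\<in>m ` X. Q {x \<in> X. m x = c})" by (rule split) simp
  also have "\<dots> \<le> (\<Sum>c\<in>m ` X. D * (\<Sum>\<zeta>\<in>z ` X. Q {x \<in> {x \<in> X. m x = c}. z x = \<zeta>}))"
    by (intro sum_mono block) simp
  \<comment> \<open>After exchanging the sums, the same orthogonality glues the pieces with fixed
    \<open>z x = \<zeta>\<close> together again over all fibres of \<open>m\<close>.\<close>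
  also have "\<dots> = D * (\<Sum>\<zeta>\<in>z ` X. \<Sum>c\<in>m ` X. Q {x \<in> {x \<in> X. z x = \<zeta>}. m x = c})"
    unfolding sum_distrib_left[symmetric] by (subst sum.swap) (simp add: conj_ac)
  also have "\<dots> = D * (\<Sum>\<zeta>\<in>z ` X. Q {x \<in> X. z x = \<zeta>})"
    by (intro arg_cong[of _ _ "\<lambda>s. D * s"] sum.cong refl split[symmetric]) auto
  finally show ?thesis unfolding Q_def .
qed

end

section \<open>Mixed mean values\<close>

text \<open>With a range starting at 0, division by \<open>q ^ b\<close> maps a residue class inside
  \<open>{0..<q ^ n}\<close> into \<open>{0..<q ^ (n - b)}\<close>, so that rescaling stays within
  this family.\<close>

definition J_count :: "nat \<Rightarrow> nat \<Rightarrow> int \<Rightarrow> nat" where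
  "J_count k S Q = card {(x, y). x \<in> PiE {1..S} (\<lambda>_. {0..<Q}) \<and> y \<in> PiE {1..S} (\<lambda>_. {0..<Q}) \<and>
      (\<forall>j\<in>{1..k}. (\<Sum>i\<in>{1..S}. x i ^ j) = (\<Sum>i\<in>{1..S}. y i ^ j))}"

text \<open>The bound on \<open>N\<close> is the size condition of \<open>mean_e_tuples\<close> for
  \<open>r * (t + 1)\<close> variables on each side, all below \<open>q ^ n\<close>.\<close>

locale vinogradov_torus = torus k N for k N +
  fixes r t n :: nat and q :: int
  assumes q: "prime q" and N: "int (r * (t + 1)) * (q ^ n) ^ k < int N"
    and r: "r > 0" and t: "t \<ge> 2"
begin

abbreviation "S \<equiv> r * (t + 1)"

definition cls :: "nat \<Rightarrow> int \<Rightarrow> int set" where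
  "cls b \<eta> = {x \<in> {0..<q ^ n}. q ^ b dvd x - \<eta>}"

definition f :: "nat \<Rightarrow> int \<Rightarrow> (nat \<Rightarrow> nat) \<Rightarrow> complex" where
  "f b \<eta> \<alpha> = (\<Sum>x\<in>cls b \<eta>. e x \<alpha>)"

definition J :: "nat \<Rightarrow> real" where
  "J m = real (J_count k S (q ^ m))"

lemma q_gt_1: "q > 1" using q by (rule prime_gt_1_int)

lemma q_pos [simp]: "q > 0" using q_gt_1 by simp

lemma q_nonneg [simp]: "q \<ge> 0" using q_pos by linarith

lemma J_nonneg [simp]: "J m \<ge> 0" by (simp add: J_def)

lemma finite_cls [simp]: "finite (cls b \<eta>)"
  unfolding cls_def by (rule finite_subset[of _ "{0..<q ^ n}"]) auto

lemma card_tuples_cls: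
  assumes I: "finite I" "card I = S" and b: "b \<le> n"
  shows "mean (\<lambda>\<alpha>. (cmod (\<Prod>i\<in>I. f b \<eta> \<alpha>))\<^sup>2)
      = real (card {(x, y). x \<in> PiE I (\<lambda>_. cls b \<eta>) \<and> y \<in> PiE I (\<lambda>_. cls b \<eta>) \<and>
          (\<forall>j\<in>{1..k}. (\<Sum>i\<in>I. x i ^ j) = (\<Sum>i\<in>I. y i ^ j))})"
  unfolding f_def
  by (rule mean_prod_sum_e_sq[where Q = "q ^ n"]) (use I N q_gt_1 in \<open>auto simp: cls_def\<close>)

text \<open>Translation and dilation invariance: \<open>x div q ^ b\<close> maps the solutions
  within one residue class modulo \<open>q ^ b\<close> injectively to solutions in the shorter
  range.\<close>

lemma mean_f_power_le:
  assumes b: "b \<le> n"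
  shows "mean (\<lambda>\<alpha>. cmod (f b \<eta> \<alpha>) ^ (2 * S)) \<le> J (n - b)"
proof -
  let ?I = "{1..S}"
  let ?T = "{(x, y). x \<in> PiE ?I (\<lambda>_. cls b \<eta>) \<and> y \<in> PiE ?I (\<lambda>_. cls b \<eta>) \<and>
          (\<forall>j\<in>{1..k}. (\<Sum>i\<in>?I. x i ^ j) = (\<Sum>i\<in>?I. y i ^ j))}"
  let ?U = "{(x, y). x \<in> PiE ?I (\<lambda>_. {0..<q ^ (n - b)}) \<and> y \<in> PiE ?I (\<lambda>_. {0..<q ^ (n - b)}) \<and>
      (\<forall>j\<in>{1..k}. (\<Sum>i\<in>?I. x i ^ j) = (\<Sum>i\<in>?I. y i ^ j))}"
  define \<rho> where "\<rho> = \<eta> mod q ^ b"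
  define d where "d x = (\<lambda>i\<in>?I. x i div q ^ b)" for x :: "nat \<Rightarrow> int"
  have rec: "x i = \<rho> + q ^ b * d x i" if "x \<in> PiE ?I (\<lambda>_. cls b \<eta>)" "i \<in> ?I" for x i
  proof -
    have "x i mod q ^ b = \<rho>" using that by (auto simp: cls_def \<rho>_def mod_eq_dvd_iff PiE_iff)
    then show ?thesis using that by (metis d_def mod_mult_div_eq restrict_apply')
  qed
  have dU: "d x \<in> PiE ?I (\<lambda>_. {0..<q ^ (n - b)})" if x: "x \<in> PiE ?I (\<lambda>_. cls b \<eta>)" for x
  proof -
    have "x i div q ^ b \<in> {0..<q ^ (n - b)}" if i: "i \<in> ?I" for i
    proof -
      have xi: "0 \<le> x i" "x i < q ^ b * q ^ (n - b)"
        using x i b by (auto simp: cls_def PiE_iff simp flip: power_add)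
      have "\<not> q ^ (n - b) \<le> x i div q ^ b"
      proof
        assume "q ^ (n - b) \<le> x i div q ^ b"
        then have "q ^ b * q ^ (n - b) \<le> q ^ b * (x i div q ^ b)" by (intro mult_left_mono) auto
        also have "\<dots> \<le> x i"
          using pos_mod_sign[of "q ^ b" "x i"] by (simp flip: minus_mod_eq_mult_div)
        finally show False using xi by simp
      qed
      then show ?thesis using xi by (simp add: pos_imp_zdiv_nonneg_iff)
    qed
    then show ?thesis by (auto simp: d_def)
  qed
  have inj: "inj_on d (PiE ?I (\<lambda>_. cls b \<eta>))"
  proof (rule inj_onI)
    fix x y assume x: "x \<in> PiE ?I (\<lambda>_. cls b \<eta>)" and y: "y \<in> PiE ?I (\<lambda>_. cls b \<eta>)" and "d x = d y"
    then have "x i = y i" if "i \<in> ?I" for i using rec[OF x that] rec[OF y that] by simp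
    with x y show "x = y" by (intro PiE_ext) auto
  qed
  have sys: "(\<Sum>i\<in>?I. d x i ^ j) = (\<Sum>i\<in>?I. d y i ^ j)"
    if xy: "(x, y) \<in> ?T" and j: "j \<in> {1..k}" for x y j
  proof -
    have x: "x \<in> PiE ?I (\<lambda>_. cls b \<eta>)" and y: "y \<in> PiE ?I (\<lambda>_. cls b \<eta>)" using xy by auto
    have "(\<Sum>i\<in>?I. (x i - \<rho>) ^ j) = (\<Sum>i\<in>?I. (y i - \<rho>) ^ j)"
      using power_sums_shift[where J = "{} :: nat set" and I = ?I and x = x and y = y and k = k and j = j and c = \<rho>] xy j by auto
    moreover have "(\<Sum>i\<in>?I. (x i - \<rho>) ^ j) = (q ^ b) ^ j * (\<Sum>i\<in>?I. d x i ^ j)"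
      unfolding sum_distrib_left power_mult_distrib[symmetric] by (intro sum.cong refl) (metis rec[OF x] add_diff_cancel_left')
    moreover have "(\<Sum>i\<in>?I. (y i - \<rho>) ^ j) = (q ^ b) ^ j * (\<Sum>i\<in>?I. d y i ^ j)"
      unfolding sum_distrib_left power_mult_distrib[symmetric] by (intro sum.cong refl) (metis rec[OF y] add_diff_cancel_left')
    ultimately show ?thesis using q_gt_1 by simp
  qed
  have "card ?T \<le> card ?U"
  proof (rule card_inj_on_le)
    show "inj_on (map_prod d d) ?T"
      by (rule inj_on_subset[OF map_prod_inj_on[OF inj inj]]) auto
    show "map_prod d d ` ?T \<subseteq> ?U" using dU sys by auto
    have "finite (PiE ?I (\<lambda>_. {0..<q ^ (n - b)}))" by (intro finite_PiE) auto
    then show "finite ?U"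
      by (intro finite_subset[OF _ finite_cartesian_product[of "PiE ?I (\<lambda>_. {0..<q ^ (n - b)})" "PiE ?I (\<lambda>_. {0..<q ^ (n - b)})"]]) auto
  qed
  moreover have "mean (\<lambda>\<alpha>. cmod (f b \<eta> \<alpha>) ^ (2 * S)) = real (card ?T)"
    using card_tuples_cls[of ?I b \<eta>] b by (simp add: norm_power power_mult[symmetric] mult.commute)
  ultimately show ?thesis by (simp add: J_def J_count_def)
qed

lemma J_eq_mean: "J n = mean (\<lambda>\<alpha>. cmod (f 0 0 \<alpha>) ^ (2 * S))"
proof -
  have "cls 0 0 = {0..<q ^ n}" by (auto simp: cls_def)
  then show ?thesis
    using card_tuples_cls[of "{1..S}" 0 0]
    by (simp add: J_def J_count_def norm_power power_mult[symmetric] mult.commute)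
qed

lemma f_split: "f b \<eta> \<alpha> = (\<Sum>c\<in>{0..<q}. f (Suc b) (\<eta> + c * q ^ b) \<alpha>)"
proof -
  let ?g = "\<lambda>x. ((x - \<eta>) div q ^ b) mod q"
  have "{x \<in> cls b \<eta>. ?g x = c} = cls (Suc b) (\<eta> + c * q ^ b)" if c: "c \<in> {0..<q}" for c
  proof -
    have *: "q ^ b dvd x - \<eta> \<and> ?g x = c \<longleftrightarrow> q ^ Suc b dvd x - (\<eta> + c * q ^ b)" for x
    proof (cases "q ^ b dvd x - \<eta>")
      case True
      then obtain u where u: "x - \<eta> = q ^ b * u" ..
      have "x - (\<eta> + c * q ^ b) = q ^ b * (u - c)" using u by (simp add: algebra_simps)
      then have "q ^ Suc b dvd x - (\<eta> + c * q ^ b) \<longleftrightarrow> q ^ b * q dvd q ^ b * (u - c)"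
        by (simp only: power_Suc2)
      also have "\<dots> \<longleftrightarrow> q dvd u - c" using q_gt_1 by simp
      also have "\<dots> \<longleftrightarrow> u mod q = c" using c by (simp add: mod_eq_dvd_iff[symmetric])
      finally show ?thesis using u q_gt_1 by simp
    next
      case False
      have "\<not> q ^ Suc b dvd x - (\<eta> + c * q ^ b)"
      proof
        assume "q ^ Suc b dvd x - (\<eta> + c * q ^ b)"
        then have "q ^ b dvd x - (\<eta> + c * q ^ b)" by (rule power_le_dvd) simp
        then have "q ^ b dvd x - (\<eta> + c * q ^ b) + c * q ^ b" by (rule dvd_add) simp
        then show False using False by simp
      qed
      then show ?thesis using False by simp
    qed
    then show ?thesis unfolding cls_def by blast
  qed
  then have "(\<Sum>c\<in>{0..<q}. f (Suc b) (\<eta> + c * q ^ b) \<alpha>)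
      = (\<Sum>c\<in>{0..<q}. \<Sum>x | x \<in> cls b \<eta> \<and> ?g x = c. e x \<alpha>)"
    unfolding f_def by (intro sum.cong) auto
  also have "\<dots> = f b \<eta> \<alpha>"
    unfolding f_def by (rule sum.group) auto
  finally show ?thesis ..
qed

lemma cmod_f_le: "cmod (f b \<eta> \<alpha>) \<le> (\<Sum>c\<in>{0..<q}. cmod (f (Suc b) (\<eta> + c * q ^ b) \<alpha>))"
  unfolding f_split[of b] by (rule norm_sum)

definition separated :: "nat \<Rightarrow> (nat \<Rightarrow> int) \<Rightarrow> bool" where
  "separated a \<xi> \<longleftrightarrow> (\<forall>l<r. \<forall>m<r. l \<noteq> m \<longrightarrow> q ^ a dvd \<xi> l - \<xi> m \<and> \<not> q ^ Suc a dvd \<xi> l - \<xi> m)"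

text \<open>A uniform upper bound stands in for the maximum of \<open>I(a,b)\<close> over all
  admissible classes, which avoids a supremum over infinitely many representatives.\<close>

definition I_bound :: "nat \<Rightarrow> nat \<Rightarrow> real \<Rightarrow> bool" where
  "I_bound a b B \<longleftrightarrow> (\<forall>\<xi> \<eta>. separated a \<xi> \<longrightarrow> (\<forall>l<r. \<not> q dvd \<xi> l - \<eta>) \<longrightarrow>
     mean (\<lambda>\<alpha>. (\<Prod>l<r. cmod (f (Suc a) (\<xi> l) \<alpha>))\<^sup>2 * cmod (f b \<eta> \<alpha>) ^ (2 * r * t)) \<le> B)"

text \<open>The intermediate mean value in which the second factor is also conditioned to
  \<open>r\<close> separated subclasses. This makes the roles of \<open>\<xi>\<close> and
  \<open>\<eta>\<close> exchangeable: after the congruencing step the \<open>\<eta>\<close> classes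
  become the separated classes of the next \<open>I_bound\<close>.\<close>

definition K_bound :: "nat \<Rightarrow> nat \<Rightarrow> real \<Rightarrow> bool" where
  "K_bound a b B \<longleftrightarrow> (\<forall>\<xi> \<eta>. separated a \<xi> \<longrightarrow> separated b \<eta> \<longrightarrow> (\<forall>l<r. \<forall>m<r. \<not> q dvd \<xi> l - \<eta> m) \<longrightarrow>
     mean (\<lambda>\<alpha>. (\<Prod>l<r. cmod (f (Suc a) (\<xi> l) \<alpha>))\<^sup>2 * (\<Prod>l<r. cmod (f (Suc b) (\<eta> l) \<alpha>)) ^ (2 * t)) \<le> B)"

definition injections :: "nat \<Rightarrow> (nat \<Rightarrow> int) set" where
  "injections R = {\<sigma> \<in> PiE {..<R} (\<lambda>_. {0..<q}). inj_on \<sigma> {..<R}}"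

lemma finite_injections [simp]: "finite (injections R)"
  unfolding injections_def by (rule finite_subset[of _ "PiE {..<R} (\<lambda>_. {0..<q})"]) (auto intro: finite_PiE)

lemma card_injections: "real (card (injections R)) \<le> of_int q ^ R"
proof -
  have "card (injections R) \<le> card (PiE {..<R} (\<lambda>_. {0..<q}))"
    unfolding injections_def by (intro card_mono finite_PiE) auto
  also have "\<dots> = nat q ^ R" by (simp add: card_PiE)
  finally have "real (card (injections R)) \<le> real (nat q ^ R)" by (simp only: of_nat_le_iff)
  also have "\<dots> = of_int q ^ R" using q_gt_1 by simp
  finally show ?thesis .
qed

lemma separated_injection:
  assumes "\<sigma> \<in> injections R" "r \<le> R"
  shows "separated b (\<lambda>l. \<eta> + \<sigma> l * q ^ b)"
  unfolding separated_def
proof (intro allI impI conjI)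
  fix l m assume lm: "l < r" "m < r" "l \<noteq> m"
  have eq: "\<eta> + \<sigma> l * q ^ b - (\<eta> + \<sigma> m * q ^ b) = q ^ b * (\<sigma> l - \<sigma> m)" by (simp add: algebra_simps)
  show "q ^ b dvd \<eta> + \<sigma> l * q ^ b - (\<eta> + \<sigma> m * q ^ b)" unfolding eq by simp
  show "\<not> q ^ Suc b dvd \<eta> + \<sigma> l * q ^ b - (\<eta> + \<sigma> m * q ^ b)"
  proof
    assume "q ^ Suc b dvd \<eta> + \<sigma> l * q ^ b - (\<eta> + \<sigma> m * q ^ b)"
    then have "q ^ b * q dvd q ^ b * (\<sigma> l - \<sigma> m)" unfolding eq power_Suc2 .
    then have "q dvd \<sigma> l - \<sigma> m" using q_gt_1 by simp
    moreover have "\<sigma> l \<in> {0..<q}" "\<sigma> m \<in> {0..<q}" "\<sigma> l \<noteq> \<sigma> m"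
      using assms lm by (auto simp: injections_def inj_on_def PiE_iff)
    ultimately show False by (auto simp: mod_eq_dvd_iff[symmetric])
  qed
qed

lemma I_boundD:
  assumes "I_bound a b B" "separated a \<xi>" "\<And>l. l < r \<Longrightarrow> \<not> q dvd \<xi> l - \<eta>"
  shows "mean (\<lambda>\<alpha>. (\<Prod>l<r. cmod (f (Suc a) (\<xi> l) \<alpha>))\<^sup>2 * cmod (f b \<eta> \<alpha>) ^ (2 * r * t)) \<le> B"
  using assms unfolding I_bound_def by blast

lemma separated_shift_unit:
  assumes "b \<ge> 1" "\<not> q dvd \<xi> - \<eta>"
  shows "\<not> q dvd \<xi> - (\<eta> + c * q ^ b)"
proof
  assume "q dvd \<xi> - (\<eta> + c * q ^ b)"
  moreover have "q dvd c * q ^ b" using assms(1) by (simp add: dvd_power)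
  ultimately have "q dvd \<xi> - (\<eta> + c * q ^ b) + c * q ^ b" by (rule dvd_add)
  then show False using assms(2) by simp
qed

lemma card_residues [simp]: "real (card {0..<q}) = of_int q"
  using q_gt_1 by simp

text \<open>A crude descent without conditioning. The loss of \<open>q ^ (2 * r * t + 1)\<close> per
  level is acceptable only once the decay rate in \<open>b\<close> is at least
  \<open>2 * r * t + 2\<close>.\<close>

lemma I_bound_Suc:
  assumes b: "b \<ge> 1" and I: "I_bound a (Suc b) B"
  shows "I_bound a b (of_int q ^ (2 * r * t + 1) * B)"
  unfolding I_bound_def
proof (intro allI impI)
  fix \<xi> \<eta> assume sep: "separated a \<xi>" and unit: "\<forall>l<r. \<not> q dvd \<xi> l - \<eta>"
  let ?P = "\<lambda>\<alpha>. (\<Prod>l<r. cmod (f (Suc a) (\<xi> l) \<alpha>))\<^sup>2"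
  let ?g = "\<lambda>c \<alpha>. cmod (f (Suc b) (\<eta> + c * q ^ b) \<alpha>)"
  have "?P \<alpha> * cmod (f b \<eta> \<alpha>) ^ (2 * r * t)
      \<le> of_int q ^ (2 * r * t) * (\<Sum>c\<in>{0..<q}. ?P \<alpha> * ?g c \<alpha> ^ (2 * r * t))" for \<alpha>
  proof -
    have "cmod (f b \<eta> \<alpha>) ^ (2 * r * t) \<le> of_int q ^ (2 * r * t) * (\<Sum>c\<in>{0..<q}. ?g c \<alpha> ^ (2 * r * t))"
      using sum_power_le[of "{0..<q}" "\<lambda>c. ?g c \<alpha>" "cmod (f b \<eta> \<alpha>)" "2 * r * t"] cmod_f_le[of b \<eta> \<alpha>]
        card_residues q_gt_1 by simp
    then have "?P \<alpha> * cmod (f b \<eta> \<alpha>) ^ (2 * r * t)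
        \<le> ?P \<alpha> * (of_int q ^ (2 * r * t) * (\<Sum>c\<in>{0..<q}. ?g c \<alpha> ^ (2 * r * t)))"
      by (intro mult_left_mono) auto
    then show ?thesis by (simp add: sum_distrib_left mult_ac)
  qed
  then have "mean (\<lambda>\<alpha>. ?P \<alpha> * cmod (f b \<eta> \<alpha>) ^ (2 * r * t))
      \<le> of_int q ^ (2 * r * t) * (\<Sum>c\<in>{0..<q}. mean (\<lambda>\<alpha>. ?P \<alpha> * ?g c \<alpha> ^ (2 * r * t)))"
    unfolding mean_sum[symmetric] mean_cmult[symmetric] by (rule mean_mono)
  also have "\<dots> \<le> of_int q ^ (2 * r * t) * (\<Sum>c\<in>{0..<q}. B)"
    using separated_shift_unit[OF b] unit by (intro mult_left_mono sum_mono I_boundD[OF I sep]) auto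
  also have "\<dots> = of_int q ^ (2 * r * t + 1) * B" by (simp only: sum_constant card_residues) simp
  finally show "mean (\<lambda>\<alpha>. ?P \<alpha> * cmod (f b \<eta> \<alpha>) ^ (2 * r * t)) \<le> of_int q ^ (2 * r * t + 1) * B" .
qed

text \<open>The dichotomy \<open>few_or_many_large\<close>, applied at each point of the torus to
  the \<open>q\<close> subclasses. The term with \<open>B1\<close> recurs each time \<open>b\<close>
  is raised, so its constant must stay below the saving; apart from one factor \<open>q\<close> for
  the choice of the subclass it is independent of \<open>q\<close>. The constant of the term with
  \<open>B2\<close> does not compound in this way.\<close>

lemma I_bound_le_K_bound:
  assumes b: "b \<ge> 1" and I: "I_bound a (Suc b) B1" and K: "K_bound a b B2" and B2: "B2 \<ge> 0"
  shows "I_bound a b ((2 * real r) ^ (2 * r * t) * of_int q * B1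
      + (2 * of_int q) ^ (2 * r * t) * of_int q ^ r * B2)"
  unfolding I_bound_def
proof (intro allI impI)
  fix \<xi> \<eta> assume sep: "separated a \<xi>" and unit: "\<forall>l<r. \<not> q dvd \<xi> l - \<eta>"
  let ?P = "\<lambda>\<alpha>. (\<Prod>l<r. cmod (f (Suc a) (\<xi> l) \<alpha>))\<^sup>2"
  let ?g = "\<lambda>c \<alpha>. cmod (f (Suc b) (\<eta> + c * q ^ b) \<alpha>)"
  let ?p = "2 * r * t"
  have "cmod (f b \<eta> \<alpha>) ^ ?p
      \<le> (2 * real r) ^ ?p * (\<Sum>c\<in>{0..<q}. ?g c \<alpha> ^ ?p)
        + (2 * of_int q) ^ ?p * (\<Sum>\<sigma>\<in>injections r. (\<Prod>l<r. ?g (\<sigma> l) \<alpha>) ^ (2 * t))" (is "_ \<le> ?A + ?B")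
    for \<alpha>
  proof -
    have AB: "?A \<ge> 0" "?B \<ge> 0"
      by (auto intro!: mult_nonneg_nonneg sum_nonneg prod_nonneg)
    have ne: "{0..<q} \<noteq> {}" using q_gt_1 by simp
    from few_or_many_large[OF _ ne, of "\<lambda>c. ?g c \<alpha>" "cmod (f b \<eta> \<alpha>)" r, unfolded card_residues]
    consider c where "c \<in> {0..<q}" "cmod (f b \<eta> \<alpha>) \<le> 2 * real r * ?g c \<alpha>"
      | \<sigma> where "\<sigma> \<in> injections r" "\<And>l. l < r \<Longrightarrow> cmod (f b \<eta> \<alpha>) \<le> 2 * of_int q * ?g (\<sigma> l) \<alpha>"
      using cmod_f_le[of b \<eta> \<alpha>] by (auto simp: injections_def)
    then show ?thesis
    proof cases
      case 1
      have "cmod (f b \<eta> \<alpha>) ^ ?p \<le> (2 * real r * ?g c \<alpha>) ^ ?p"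
        by (rule power_mono[OF 1(2)]) simp
      also have "\<dots> \<le> ?A"
        unfolding power_mult_distrib[of _ "?g c \<alpha>"] using 1(1) by (intro mult_left_mono member_le_sum) auto
      finally show ?thesis using AB by linarith
    next
      case 2
      have "cmod (f b \<eta> \<alpha>) ^ ?p = (\<Prod>l<r. cmod (f b \<eta> \<alpha>)) ^ (2 * t)"
        by (simp add: power_mult[symmetric] mult_ac)
      also have "\<dots> \<le> (\<Prod>l<r. 2 * of_int q * ?g (\<sigma> l) \<alpha>) ^ (2 * t)"
        using 2(2) by (intro power_mono prod_mono prod_nonneg) auto
      also have "\<dots> = (2 * of_int q) ^ ?p * (\<Prod>l<r. ?g (\<sigma> l) \<alpha>) ^ (2 * t)"
        by (simp add: prod.distrib power_mult_distrib power_mult[symmetric] mult_ac)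
      also have "\<dots> \<le> ?B"
        using 2(1) by (intro mult_left_mono member_le_sum) (auto intro!: prod_nonneg)
      finally show ?thesis using AB by linarith
    qed
  qed
  then have "?P \<alpha> * cmod (f b \<eta> \<alpha>) ^ ?p
      \<le> (2 * real r) ^ ?p * (\<Sum>c\<in>{0..<q}. ?P \<alpha> * ?g c \<alpha> ^ ?p)
        + (2 * of_int q) ^ ?p * (\<Sum>\<sigma>\<in>injections r. ?P \<alpha> * (\<Prod>l<r. ?g (\<sigma> l) \<alpha>) ^ (2 * t))" for \<alpha>
  proof -
    have "?P \<alpha> * cmod (f b \<eta> \<alpha>) ^ ?p \<le> ?P \<alpha> * ((2 * real r) ^ ?p * (\<Sum>c\<in>{0..<q}. ?g c \<alpha> ^ ?p)
        + (2 * of_int q) ^ ?p * (\<Sum>\<sigma>\<in>injections r. (\<Prod>l<r. ?g (\<sigma> l) \<alpha>) ^ (2 * t)))"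
      by (rule mult_left_mono) (fact, simp)
    then show ?thesis unfolding distrib_left sum_distrib_left by (simp only: mult_ac)
  qed
  then have "mean (\<lambda>\<alpha>. ?P \<alpha> * cmod (f b \<eta> \<alpha>) ^ ?p)
      \<le> (2 * real r) ^ ?p * (\<Sum>c\<in>{0..<q}. mean (\<lambda>\<alpha>. ?P \<alpha> * ?g c \<alpha> ^ ?p))
        + (2 * of_int q) ^ ?p * (\<Sum>\<sigma>\<in>injections r. mean (\<lambda>\<alpha>. ?P \<alpha> * (\<Prod>l<r. ?g (\<sigma> l) \<alpha>) ^ (2 * t)))"
    unfolding mean_sum[symmetric] mean_cmult[symmetric] mean_add[symmetric] by (rule mean_mono)
  also have "\<dots> \<le> (2 * real r) ^ ?p * (of_int q * B1) + (2 * of_int q) ^ ?p * (of_int q ^ r * B2)"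
  proof (intro add_mono mult_left_mono)
    have "(\<Sum>c\<in>{0..<q}. mean (\<lambda>\<alpha>. ?P \<alpha> * ?g c \<alpha> ^ ?p)) \<le> (\<Sum>c\<in>{0..<q}. B1)"
      using separated_shift_unit[OF b] unit by (intro sum_mono I_boundD[OF I sep]) auto
    also have "\<dots> = of_int q * B1" by (simp only: sum_constant card_residues)
    finally show "(\<Sum>c\<in>{0..<q}. mean (\<lambda>\<alpha>. ?P \<alpha> * ?g c \<alpha> ^ ?p)) \<le> of_int q * B1" .
  next
    have "(\<Sum>\<sigma>\<in>injections r. mean (\<lambda>\<alpha>. ?P \<alpha> * (\<Prod>l<r. ?g (\<sigma> l) \<alpha>) ^ (2 * t)))
        \<le> (\<Sum>\<sigma>\<in>injections r. B2)"
    proof (intro sum_mono)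
      fix \<sigma> assume "\<sigma> \<in> injections r"
      then have "separated b (\<lambda>l. \<eta> + \<sigma> l * q ^ b)" by (rule separated_injection) simp
      then show "mean (\<lambda>\<alpha>. ?P \<alpha> * (\<Prod>l<r. ?g (\<sigma> l) \<alpha>) ^ (2 * t)) \<le> B2"
        using K sep unit separated_shift_unit[OF b] unfolding K_bound_def by blast
    qed
    also have "\<dots> \<le> of_int q ^ r * B2"
      using card_injections[of r] B2 by (simp add: mult_right_mono)
    finally show "(\<Sum>\<sigma>\<in>injections r. mean (\<lambda>\<alpha>. ?P \<alpha> * (\<Prod>l<r. ?g (\<sigma> l) \<alpha>) ^ (2 * t)))
        \<le> of_int q ^ r * B2" .
  qed auto
  finally show "mean (\<lambda>\<alpha>. ?P \<alpha> * cmod (f b \<eta> \<alpha>) ^ ?p)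
      \<le> (2 * real r) ^ ?p * of_int q * B1 + (2 * of_int q) ^ ?p * of_int q ^ r * B2"
    by (simp add: mult.assoc)
qed

text \<open>The same dichotomy with \<open>Suc r\<close> subclasses: \<open>r\<close> of them become
  the classes \<open>\<xi>\<close> and the last one becomes \<open>\<eta>\<close>, matching
  \<open>2 * S = 2 * r + 2 * r * t\<close>. Being distinct modulo \<open>q\<close> yields both
  separation at level 0 and the unit condition.\<close>

lemma J_le_I_bound:
  assumes n: "n \<ge> 1" and I: "I_bound 0 1 B" and B: "B \<ge> 0"
  shows "J n \<le> (2 * real (Suc r)) ^ (2 * S) * of_int q * J (n - 1)
      + (2 * of_int q) ^ (2 * S) * of_int q ^ Suc r * B"
proof -
  let ?g = "\<lambda>c \<alpha>. cmod (f (Suc 0) (0 + c * q ^ 0) \<alpha>)"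
  let ?p = "2 * S"
  let ?h = "\<lambda>\<sigma> \<alpha>. (\<Prod>l<r. ?g (\<sigma> l) \<alpha>)\<^sup>2 * ?g (\<sigma> r) \<alpha> ^ (2 * r * t)"
  have pt: "cmod (f 0 0 \<alpha>) ^ ?p
      \<le> (2 * real (Suc r)) ^ ?p * (\<Sum>c\<in>{0..<q}. ?g c \<alpha> ^ ?p)
        + (2 * of_int q) ^ ?p * (\<Sum>\<sigma>\<in>injections (Suc r). ?h \<sigma> \<alpha>)" (is "_ \<le> ?A + ?B") for \<alpha>
  proof -
    have AB: "?A \<ge> 0" "?B \<ge> 0"
      by (auto intro!: mult_nonneg_nonneg sum_nonneg)
    have ne: "{0..<q} \<noteq> {}" using q_gt_1 by simp
    from few_or_many_large[OF _ ne, of "\<lambda>c. ?g c \<alpha>" "cmod (f 0 0 \<alpha>)" "Suc r", unfolded card_residues]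
    consider c where "c \<in> {0..<q}" "cmod (f 0 0 \<alpha>) \<le> 2 * real (Suc r) * ?g c \<alpha>"
      | \<sigma> where "\<sigma> \<in> injections (Suc r)" "\<And>l. l < Suc r \<Longrightarrow> cmod (f 0 0 \<alpha>) \<le> 2 * of_int q * ?g (\<sigma> l) \<alpha>"
      using cmod_f_le[of 0 0 \<alpha>] unfolding injections_def by auto
    then show ?thesis
    proof cases
      case 1
      have "cmod (f 0 0 \<alpha>) ^ ?p \<le> (2 * real (Suc r) * ?g c \<alpha>) ^ ?p"
        by (rule power_mono[OF 1(2)]) simp
      also have "\<dots> \<le> ?A"
        unfolding power_mult_distrib[of _ "?g c \<alpha>"] using 1(1)
        by (intro mult_left_mono member_le_sum[of c _ "\<lambda>c. ?g c \<alpha> ^ ?p"]) auto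
      finally show ?thesis using AB by linarith
    next
      case 2
      have "?p = r * 2 + 2 * r * t" by (simp add: algebra_simps)
      then have "cmod (f 0 0 \<alpha>) ^ ?p = (\<Prod>l<r. cmod (f 0 0 \<alpha>))\<^sup>2 * cmod (f 0 0 \<alpha>) ^ (2 * r * t)"
        by (simp only: power_add power_mult prod_constant card_lessThan)
      also have "\<dots> \<le> (\<Prod>l<r. 2 * of_int q * ?g (\<sigma> l) \<alpha>)\<^sup>2 * (2 * of_int q * ?g (\<sigma> r) \<alpha>) ^ (2 * r * t)"
        using 2(2) by (intro mult_mono power_mono prod_mono prod_nonneg) (auto intro!: mult_nonneg_nonneg)
      also have "\<dots> = (2 * of_int q) ^ ?p * ?h \<sigma> \<alpha>"
        unfolding prod.distrib power_mult_distrib \<open>?p = _\<close> power_add power_mult prod_constant card_lessThan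
        by (simp only: mult_ac)
      also have "\<dots> \<le> ?B"
        using 2(1) by (intro mult_left_mono member_le_sum[of \<sigma> _ "\<lambda>\<sigma>. ?h \<sigma> \<alpha>"]) auto
      finally show ?thesis using AB by linarith
    qed
  qed
  have "J n \<le> (2 * real (Suc r)) ^ ?p * (\<Sum>c\<in>{0..<q}. mean (\<lambda>\<alpha>. ?g c \<alpha> ^ ?p))
        + (2 * of_int q) ^ ?p * (\<Sum>\<sigma>\<in>injections (Suc r). mean (?h \<sigma>))"
    unfolding J_eq_mean mean_sum[symmetric] mean_cmult[symmetric] mean_add[symmetric]
    by (rule mean_mono[OF pt])
  also have "(\<Sum>c\<in>{0..<q}. mean (\<lambda>\<alpha>. ?g c \<alpha> ^ ?p)) \<le> (\<Sum>c\<in>{0..<q}. J (n - 1))"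
    using mean_f_power_le[of "Suc 0"] n by (intro sum_mono) simp
  also have "(\<Sum>\<sigma>\<in>injections (Suc r). mean (?h \<sigma>)) \<le> (\<Sum>\<sigma>\<in>injections (Suc r). B)"
  proof (intro sum_mono)
    fix \<sigma> assume \<sigma>: "\<sigma> \<in> injections (Suc r)"
    have sep: "separated 0 (\<lambda>l. 0 + \<sigma> l * q ^ 0)" by (rule separated_injection[OF \<sigma>]) simp
    have unit: "\<not> q dvd (0 + \<sigma> l * q ^ 0) - (0 + \<sigma> r * q ^ 0)" if "l < r" for l
    proof -
      have "\<sigma> l \<in> {0..<q}" "\<sigma> r \<in> {0..<q}" "\<sigma> l \<noteq> \<sigma> r"
        using \<sigma> that by (auto simp: injections_def inj_on_def PiE_iff)
      then show ?thesis by (auto simp: mod_eq_dvd_iff[symmetric])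
    qed
    show "mean (?h \<sigma>) \<le> B" using I_boundD[OF I sep unit] by simp
  qed
  also have "\<dots> \<le> of_int q ^ Suc r * B"
    using card_injections[of "Suc r"] B by (simp add: mult_right_mono)
  also have "(\<Sum>c\<in>{0..<q}. J (n - 1)) = of_int q * J (n - 1)" by (simp only: sum_constant card_residues)
  finally show ?thesis by (simp add: mult.assoc)
qed

text \<open>No arithmetic enters: the total degree is \<open>2 * S\<close>, and Hoelder with weights
  \<open>1 / (t + 1)\<close> and \<open>t / (t + 1)\<close> separates the two kinds of classes. This
  estimate starts the iteration.\<close>

lemma I_bound_trivial:
  assumes "Suc a \<le> n" "b \<le> n"
  shows "I_bound a b (real r * (J (n - Suc a) powr (1 / (real t + 1)) * J (n - b) powr (real t / (real t + 1))))"
  unfolding I_bound_def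
proof (intro allI impI)
  fix \<xi> \<eta>
  let ?p = "1 / (real t + 1)"
  let ?h = "\<lambda>\<alpha>. cmod (f b \<eta> \<alpha>)"
  have p1: "1 - ?p = real t / (real t + 1)" by (simp add: field_simps)
  have one: "mean (\<lambda>\<alpha>. cmod (f (Suc a) \<xi> \<alpha>) ^ (r * 2) * ?h \<alpha> ^ (2 * r * t))
      \<le> J (n - Suc a) powr ?p * J (n - b) powr (real t / (real t + 1))" for \<xi>
  proof -
    have "mean (\<lambda>\<alpha>. cmod (f (Suc a) \<xi> \<alpha>) ^ (r * 2) * ?h \<alpha> ^ (2 * r * t))
      \<le> mean (\<lambda>\<alpha>. cmod (f (Suc a) \<xi> \<alpha>) ^ (2 * S) * ?h \<alpha> ^ 0) powr ?p
        * mean (\<lambda>\<alpha>. cmod (f (Suc a) \<xi> \<alpha>) ^ 0 * ?h \<alpha> ^ (2 * S)) powr (1 - ?p)"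
    proof (rule mean_interpolation)
      have S2: "real (2 * S) = 2 * real r * (real t + 1)" by (simp add: algebra_simps)
      have "real (2 * S) * ?p = 2 * real r * ((real t + 1) * ?p)" unfolding S2 by (rule mult.assoc)
      also have "(real t + 1) * ?p = 1" by simp
      finally show "real (2 * S) * ?p + real 0 * (1 - ?p) = real (r * 2)" by simp
      have "real (2 * S) * (1 - ?p) = 2 * real r * ((real t + 1) * (real t / (real t + 1)))"
        unfolding p1 S2 by (rule mult.assoc)
      also have "(real t + 1) * (real t / (real t + 1)) = real t" by simp
      finally show "real 0 * ?p + real (2 * S) * (1 - ?p) = real (2 * r * t)" by simp
    qed (use r t in auto)
    also have "\<dots> \<le> J (n - Suc a) powr ?p * J (n - b) powr (1 - ?p)"
      using mean_f_power_le assms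
      by (intro mult_mono powr_mono2) (auto simp: p1 intro!: mean_nonneg)
    finally show ?thesis by (simp only: p1)
  qed
  have "mean (\<lambda>\<alpha>. (\<Prod>l<r. cmod (f (Suc a) (\<xi> l) \<alpha>))\<^sup>2 * ?h \<alpha> ^ (2 * r * t))
      \<le> mean (\<lambda>\<alpha>. \<Sum>l<r. cmod (f (Suc a) (\<xi> l) \<alpha>) ^ (r * 2) * ?h \<alpha> ^ (2 * r * t))"
    unfolding sum_distrib_right[symmetric]
    by (intro mean_mono mult_right_mono prod_power_le_sum r) auto
  also have "\<dots> \<le> (\<Sum>l<r. J (n - Suc a) powr ?p * J (n - b) powr (real t / (real t + 1)))"
    unfolding mean_sum by (intro sum_mono one)
  finally show "mean (\<lambda>\<alpha>. (\<Prod>l<r. cmod (f (Suc a) (\<xi> l) \<alpha>))\<^sup>2 * ?h \<alpha> ^ (2 * r * t))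
      \<le> real r * (J (n - Suc a) powr ?p * J (n - b) powr (real t / (real t + 1)))" by simp
qed

section \<open>The congruencing step\<close>

text \<open>Expanding the weight gives variables that all agree with \<open>\<eta> 0\<close> modulo
  \<open>q ^ b\<close>. After translation by \<open>\<eta> 0\<close> their \<open>j\<close>-th
  powers are divisible by \<open>q ^ (j * b)\<close>, so a solution of the full system would force
  the congruence between \<open>x\<close> and \<open>y\<close> that \<open>nd\<close>
  excludes.\<close>

lemma mean_weighted_vanishes:
  assumes b: "b \<ge> 1" and \<eta>: "separated b \<eta>"
    and x: "x \<in> PiE {..<r} (\<lambda>l. cls a (\<xi> l))" and y: "y \<in> PiE {..<r} (\<lambda>l. cls a (\<xi> l))"
    and j: "1 \<le> j" "j \<le> k"
    and nd: "\<not> q ^ (j * b) dvd (\<Sum>l<r. (x l - \<eta> 0) ^ j) - (\<Sum>l<r. (y l - \<eta> 0) ^ j)"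
  shows "mean (\<lambda>\<alpha>. (\<Prod>l<r. e (x l) \<alpha>) * cnj (\<Prod>l<r. e (y l) \<alpha>)
      * of_real ((\<Prod>l<r. cmod (f (Suc b) (\<eta> l) \<alpha>)) ^ (2 * t))) = 0"
proof -
  \<comment> \<open>Each class \<open>\<eta> l\<close> occurs \<open>t\<close> times, because the
    power \<open>2 * t\<close> of the modulus is the square of the modulus of a \<open>t\<close>-th
    power.\<close>
  let ?J = "{..<r} \<times> {..<t}"
  let ?A = "\<lambda>p :: nat \<times> nat. cls (Suc b) (\<eta> (fst p))"
  have w: "complex_of_real ((\<Prod>l<r. cmod (f (Suc b) (\<eta> l) \<alpha>)) ^ (2 * t))
      = (\<Sum>v\<in>PiE ?J ?A. \<Sum>u\<in>PiE ?J ?A. (\<Prod>p\<in>?J. e (v p) \<alpha>) * cnj (\<Prod>p\<in>?J. e (u p) \<alpha>))" for \<alpha>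
  proof -
    have "(\<Prod>p\<in>?J. f (Suc b) (\<eta> (fst p)) \<alpha>) = (\<Prod>l<r. f (Suc b) (\<eta> l) \<alpha>) ^ t"
      using prod.cartesian_product[of "\<lambda>l _. f (Suc b) (\<eta> l) \<alpha>" "{..<t}" "{..<r}"]
      by (simp add: prod_power_distrib case_prod_unfold)
    then have "(\<Prod>l<r. cmod (f (Suc b) (\<eta> l) \<alpha>)) ^ (2 * t)
        = (cmod (\<Prod>p\<in>?J. \<Sum>x\<in>?A p. e x \<alpha>))\<^sup>2"
      unfolding f_def[symmetric] by (simp add: norm_power prod_norm power_mult[symmetric] mult.commute)
    then show ?thesis by (simp only:) (rule cmod_prod_sum_e_sq, auto)
  qed
  have zero: "mean (\<lambda>\<alpha>. (\<Prod>l<r. e (x l) \<alpha>) * cnj (\<Prod>l<r. e (y l) \<alpha>)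
      * ((\<Prod>p\<in>?J. e (v p) \<alpha>) * cnj (\<Prod>p\<in>?J. e (u p) \<alpha>))) = 0"
    if v: "v \<in> PiE ?J ?A" and u: "u \<in> PiE ?J ?A" for v u
  proof -
    have near: "q ^ b dvd s p - \<eta> 0" if "s \<in> PiE ?J ?A" "p \<in> ?J" for s p
    proof -
      have "q ^ Suc b dvd s p - \<eta> (fst p)" using that by (auto simp: PiE_iff cls_def)
      then have "q ^ b dvd s p - \<eta> (fst p)" by (rule power_le_dvd) simp
      moreover have "q ^ b dvd \<eta> (fst p) - \<eta> 0"
        using \<eta> that r by (cases "fst p = 0") (auto simp: separated_def)
      ultimately have "q ^ b dvd (s p - \<eta> (fst p)) + (\<eta> (fst p) - \<eta> 0)" by (rule dvd_add)
      then show ?thesis by simp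
    qed
    have dvdJ: "q ^ (j * b) dvd (\<Sum>p\<in>?J. (s p - \<eta> 0) ^ j)" if s: "s \<in> PiE ?J ?A" for s
    proof (rule dvd_sum)
      fix p assume "p \<in> ?J"
      from near[OF s this] show "q ^ (j * b) dvd (s p - \<eta> 0) ^ j"
        by (metis dvd_power_same mult.commute power_mult)
    qed
    have "\<not> (\<forall>j\<in>{1..k}. (\<Sum>l<r. x l ^ j) + (\<Sum>p\<in>?J. v p ^ j) = (\<Sum>l<r. y l ^ j) + (\<Sum>p\<in>?J. u p ^ j))"
    proof
      assume "\<forall>j\<in>{1..k}. (\<Sum>l<r. x l ^ j) + (\<Sum>p\<in>?J. v p ^ j) = (\<Sum>l<r. y l ^ j) + (\<Sum>p\<in>?J. u p ^ j)"
      from power_sums_shift[OF this j(2), of "\<eta> 0"]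
      have "(\<Sum>l<r. (x l - \<eta> 0) ^ j) - (\<Sum>l<r. (y l - \<eta> 0) ^ j)
          = (\<Sum>p\<in>?J. (u p - \<eta> 0) ^ j) - (\<Sum>p\<in>?J. (v p - \<eta> 0) ^ j)" by simp
      then show False using nd dvd_diff[OF dvdJ[OF u] dvdJ[OF v]] by simp
    qed
    moreover have "int (card {..<r} + card ?J) * (q ^ n) ^ k < int N"
      using N by (simp add: algebra_simps)
    moreover have "x l \<in> {0..<q ^ n} \<and> y l \<in> {0..<q ^ n}" if "l \<in> {..<r}" for l
      using x y that unfolding PiE_iff cls_def by blast
    moreover have "v p \<in> {0..<q ^ n} \<and> u p \<in> {0..<q ^ n}" if "p \<in> ?J" for p
      using v u that unfolding PiE_iff cls_def by blast
    ultimately show ?thesis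
      using q_gt_1 by (subst mean_e_tuples[where Q = "q ^ n"]) auto
  qed
  have "mean (\<lambda>\<alpha>. (\<Prod>l<r. e (x l) \<alpha>) * cnj (\<Prod>l<r. e (y l) \<alpha>)
      * of_real ((\<Prod>l<r. cmod (f (Suc b) (\<eta> l) \<alpha>)) ^ (2 * t)))
    = (\<Sum>v\<in>PiE ?J ?A. \<Sum>u\<in>PiE ?J ?A. mean (\<lambda>\<alpha>. (\<Prod>l<r. e (x l) \<alpha>) * cnj (\<Prod>l<r. e (y l) \<alpha>)
      * ((\<Prod>p\<in>?J. e (v p) \<alpha>) * cnj (\<Prod>p\<in>?J. e (u p) \<alpha>))))"
    unfolding w sum_distrib_left mean_sum ..
  also have "\<dots> = 0" using zero by (intro sum.neutral ballI) auto
  finally show ?thesis .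
qed

definition residue_tuple :: "nat \<Rightarrow> (nat \<Rightarrow> int) \<Rightarrow> nat \<Rightarrow> int" where
  "residue_tuple c x = (\<lambda>l\<in>{..<r}. x l mod q ^ c)"

text \<open>As \<open>c\<close> is at least \<open>Suc a\<close>, a residue modulo
  \<open>q ^ c\<close> that occurs in the class of \<open>\<xi> l\<close> already implies membership
  in it; the sum therefore factors.\<close>

lemma sum_residue_class:
  assumes c: "Suc a \<le> c" and \<zeta>: "\<zeta> \<in> residue_tuple c ` PiE {..<r} (\<lambda>l. cls (Suc a) (\<xi> l))"
  shows "(\<Sum>x | x \<in> PiE {..<r} (\<lambda>l. cls (Suc a) (\<xi> l)) \<and> residue_tuple c x = \<zeta>. \<Prod>l<r. e (x l) \<alpha>)
      = (\<Prod>l<r. f c (\<zeta> l) \<alpha>)"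
proof -
  obtain x0 where x0: "x0 \<in> PiE {..<r} (\<lambda>l. cls (Suc a) (\<xi> l))" "\<zeta> = residue_tuple c x0" using \<zeta> by auto
  have "{x. x \<in> PiE {..<r} (\<lambda>l. cls (Suc a) (\<xi> l)) \<and> residue_tuple c x = \<zeta>}
      = PiE {..<r} (\<lambda>l. cls c (\<zeta> l))" (is "?L = ?R")
  proof (intro equalityI subsetI)
    fix x assume x: "x \<in> ?L"
    then have "x l mod q ^ c = \<zeta> l" if "l < r" for l
      using that by (auto simp: residue_tuple_def fun_eq_iff restrict_def split: if_splits)
    then have "q ^ c dvd x l - \<zeta> l" if "l < r" for l
      using that by (metis mod_eq_dvd_iff mod_mod_trivial)
    then show "x \<in> ?R" using x by (auto simp: PiE_iff cls_def)
  next
    fix x assume x: "x \<in> ?R"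
    have xc: "q ^ c dvd x l - x0 l mod q ^ c" if "l < r" for l
      using x that by (auto simp: PiE_iff cls_def x0(2) residue_tuple_def)
    have xx: "q ^ c dvd x l - x0 l" if "l < r" for l
      using xc[OF that] by (metis mod_eq_dvd_iff mod_mod_trivial)
    have "q ^ Suc a dvd x l - \<xi> l" if l: "l < r" for l
    proof -
      have "q ^ Suc a dvd x l - x0 l" using xx[OF l] c by (rule power_le_dvd)
      moreover have "q ^ Suc a dvd x0 l - \<xi> l" using x0(1) l unfolding PiE_iff cls_def by blast
      ultimately have "q ^ Suc a dvd (x l - x0 l) + (x0 l - \<xi> l)" by (rule dvd_add)
      then show ?thesis by simp
    qed
    moreover have "residue_tuple c x = \<zeta>"
      unfolding x0(2) residue_tuple_def using xx by (auto simp: mod_eq_dvd_iff)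
    ultimately show "x \<in> ?L" using x by (auto simp: PiE_iff cls_def)
  qed
  then show ?thesis unfolding f_def by (simp add: prod_sum_PiE)
qed

lemma card_residue_tuples:
  assumes c: "Suc a \<le> c"
  shows "real (card (residue_tuple c ` PiE {..<r} (\<lambda>l. cls (Suc a) (\<xi> l)))) \<le> of_int q ^ (r * (c - a))"
proof -
  let ?R = "\<lambda>l. {y \<in> {0..<q ^ Suc a * q ^ (c - Suc a)}. q ^ Suc a dvd y - \<xi> l}"
  have fin: "finite (?R l)" for l by (rule card_residues_le) auto
  have "residue_tuple c ` PiE {..<r} (\<lambda>l. cls (Suc a) (\<xi> l)) \<subseteq> PiE {..<r} ?R"
  proof (rule image_subsetI)
    fix x assume x: "x \<in> PiE {..<r} (\<lambda>l. cls (Suc a) (\<xi> l))"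
    have "x l mod q ^ c \<in> ?R l" if l: "l < r" for l
    proof -
      have "q ^ Suc a dvd x l - \<xi> l" using x l unfolding PiE_iff cls_def by blast
      moreover have "q ^ Suc a dvd q ^ c * (x l div q ^ c)" using c by (intro dvd_mult2 le_imp_power_dvd)
      ultimately have "q ^ Suc a dvd (x l - \<xi> l) - q ^ c * (x l div q ^ c)" by (rule dvd_diff)
      also have "(x l - \<xi> l) - q ^ c * (x l div q ^ c) = x l mod q ^ c - \<xi> l"
        by (simp add: minus_mult_div_eq_mod[symmetric])
      finally show ?thesis using c q_pos by (simp flip: power_add power_Suc)
    qed
    then show "residue_tuple c x \<in> PiE {..<r} ?R" by (auto simp: residue_tuple_def)
  qed
  then have "card (residue_tuple c ` PiE {..<r} (\<lambda>l. cls (Suc a) (\<xi> l))) \<le> card (PiE {..<r} ?R)"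
    using fin by (intro card_mono finite_PiE) auto
  then have "int (card (residue_tuple c ` PiE {..<r} (\<lambda>l. cls (Suc a) (\<xi> l)))) \<le> (\<Prod>l<r. int (card (?R l)))"
    by (simp add: card_PiE flip: of_nat_prod)
  also have "\<dots> \<le> (\<Prod>l<r. q ^ (c - Suc a))"
    by (intro prod_mono conjI card_residues_le) auto
  also have "\<dots> = q ^ (r * (c - Suc a))" by (simp add: power_mult[symmetric] mult.commute)
  \<comment> \<open>Rounding the exponent up from \<open>c - Suc a\<close> costs the bounded factor
    \<open>q ^ r\<close> and simplifies the later exponents.\<close>
  also have "\<dots> \<le> q ^ (r * (c - a))"
    using q_gt_1 by (intro power_increasing mult_le_mono2) auto
  finally show ?thesis by (metis of_int_le_iff of_int_of_nat_eq of_int_power)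
qed

text \<open>Tuples \<open>x\<close> and \<open>y\<close> interact only if their power sums about
  \<open>\<eta> 0\<close> agree modulo \<open>q ^ (j * b)\<close> for all \<open>j\<close>, which is
  what \<open>m\<close> records. Each such family meets few residue tuples modulo
  \<open>q ^ (t * b)\<close>, so \<open>mean_almost_orthogonal\<close> applies; the total number of
  residue tuples is then estimated trivially.\<close>

lemma mean_congruencing:
  assumes kq: "int k < q" and rt: "r \<le> k" "t \<le> k" "k \<le> r + t" and ab: "(k - t - 1) * a \<le> b"
    and b: "b \<ge> 1" "Suc a \<le> t * b"
    and \<xi>: "separated a \<xi>" and \<eta>: "separated b \<eta>" and unit: "\<And>l. l < r \<Longrightarrow> \<not> q dvd \<xi> l - \<eta> 0"
    and B: "\<And>\<zeta> l. l < r \<Longrightarrow> q ^ Suc a dvd \<zeta> - \<xi> l \<Longrightarrow>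
      mean (\<lambda>\<alpha>. cmod (f (t * b) \<zeta> \<alpha>) ^ (r * 2) * (\<Prod>l<r. cmod (f (Suc b) (\<eta> l) \<alpha>)) ^ (2 * t)) \<le> B"
    and B0: "B \<ge> 0"
  shows "mean (\<lambda>\<alpha>. (\<Prod>l<r. cmod (f (Suc a) (\<xi> l) \<alpha>))\<^sup>2 * (\<Prod>l<r. cmod (f (Suc b) (\<eta> l) \<alpha>)) ^ (2 * t))
    \<le> of_int q ^ (mu_exp r t k * b + nu_exp r t k * a) * (of_int q ^ (r * (t * b - a)) * (real r * B))"
proof -
  let ?X = "PiE {..<r} (\<lambda>l. cls (Suc a) (\<xi> l))"
  let ?\<Phi> = "\<lambda>x \<alpha>. \<Prod>l<r. e (x l) \<alpha>"
  let ?w = "\<lambda>\<alpha>. (\<Prod>l<r. cmod (f (Suc b) (\<eta> l) \<alpha>)) ^ (2 * t)"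
  let ?z = "residue_tuple (t * b)"
  let ?D = "of_int q ^ (mu_exp r t k * b + nu_exp r t k * a) :: real"
  define m where "m x = (\<lambda>j\<in>{1..k}. (\<Sum>l<r. (x l - \<eta> 0) ^ j) mod q ^ (j * b))" for x :: "nat \<Rightarrow> int"
  have finX: "finite ?X" by (intro finite_PiE) auto
  have w0: "?w \<alpha> \<ge> 0" for \<alpha> by (simp add: prod_nonneg)
  have "(\<Prod>l<r. cmod (f (Suc a) (\<xi> l) \<alpha>))\<^sup>2 = (cmod (\<Sum>x\<in>?X. ?\<Phi> x \<alpha>))\<^sup>2" for \<alpha>
    unfolding prod_norm f_def by (subst prod_sum_PiE) auto
  then have "mean (\<lambda>\<alpha>. (\<Prod>l<r. cmod (f (Suc a) (\<xi> l) \<alpha>))\<^sup>2 * ?w \<alpha>)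
      = mean (\<lambda>\<alpha>. (cmod (\<Sum>x\<in>?X. ?\<Phi> x \<alpha>))\<^sup>2 * ?w \<alpha>)" by simp
  also have "\<dots> \<le> ?D * (\<Sum>\<zeta>\<in>?z ` ?X. mean (\<lambda>\<alpha>. (cmod (\<Sum>x | x \<in> ?X \<and> ?z x = \<zeta>. ?\<Phi> x \<alpha>))\<^sup>2 * ?w \<alpha>))"
  proof (rule mean_almost_orthogonal[OF finX w0, where m = m])
    fix x y assume x: "x \<in> ?X" and y: "y \<in> ?X" and "m x \<noteq> m y"
    then obtain j where j: "1 \<le> j" "j \<le> k"
      "(\<Sum>l<r. (x l - \<eta> 0) ^ j) mod q ^ (j * b) \<noteq> (\<Sum>l<r. (y l - \<eta> 0) ^ j) mod q ^ (j * b)"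
      by (auto simp: m_def restrict_def fun_eq_iff split: if_splits)
    show "mean (\<lambda>\<alpha>. ?\<Phi> x \<alpha> * cnj (?\<Phi> y \<alpha>) * complex_of_real (?w \<alpha>)) = 0"
      by (rule mean_weighted_vanishes[OF b(1) \<eta> x y j(1,2)]) (use j(3) in \<open>simp add: mod_eq_dvd_iff\<close>)
  next
    fix c
    let ?A = "{x \<in> ?X. m x = c}"
    have "int (card ((\<lambda>x. \<lambda>l\<in>{..<r}. x l mod q ^ (t * b)) ` ?A)) \<le> q ^ (mu_exp r t k * b + nu_exp r t k * a)"
    proof (rule card_congruence_solutions[OF q kq rt ab, of \<xi> "\<eta> 0"])
      fix x y j assume x: "x \<in> ?A" and y: "y \<in> ?A" and j: "1 \<le> j" "j \<le> k"
      then have "m x j = m y j" by simp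
      then show "q ^ (j * b) dvd (\<Sum>l<r. (x l - \<eta> 0) ^ j) - (\<Sum>l<r. (y l - \<eta> 0) ^ j)"
        using j by (simp add: m_def mod_eq_dvd_iff)
    next
      fix l m assume "l < r" "m < r" "l \<noteq> m"
      then show "q ^ a dvd \<xi> l - \<xi> m \<and> \<not> q ^ Suc a dvd \<xi> l - \<xi> m"
        using \<xi> unfolding separated_def by blast
    next
      fix x l assume "x \<in> ?A" "l < r"
      then show "q ^ Suc a dvd x l - \<xi> l" unfolding PiE_iff cls_def by blast
    qed (fact unit)
    then have "real_of_int (int (card (?z ` ?A)))
        \<le> real_of_int (q ^ (mu_exp r t k * b + nu_exp r t k * a))"
      unfolding residue_tuple_def of_int_le_iff .
    then show "real (card (?z ` ?A)) \<le> ?D" by simp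
  qed
  also have "\<dots> \<le> ?D * (\<Sum>\<zeta>\<in>?z ` ?X. real r * B)"
  proof (intro mult_left_mono sum_mono)
    fix \<zeta> assume \<zeta>: "\<zeta> \<in> ?z ` ?X"
    have near: "q ^ Suc a dvd \<zeta> l - \<xi> l" if l: "l < r" for l
    proof -
      obtain x where x: "x \<in> ?X" "\<zeta> = ?z x" using \<zeta> by auto
      have "q ^ (t * b) dvd \<zeta> l - x l"
        using l by (simp add: x(2) residue_tuple_def mod_eq_dvd_iff[symmetric])
      then have "q ^ Suc a dvd \<zeta> l - x l" using b(2) by (rule power_le_dvd)
      moreover have "q ^ Suc a dvd x l - \<xi> l" using x(1) l unfolding PiE_iff cls_def by blast
      ultimately have "q ^ Suc a dvd (\<zeta> l - x l) + (x l - \<xi> l)" by (rule dvd_add)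
      then show ?thesis by simp
    qed
    have "mean (\<lambda>\<alpha>. (cmod (\<Sum>x | x \<in> ?X \<and> ?z x = \<zeta>. ?\<Phi> x \<alpha>))\<^sup>2 * ?w \<alpha>)
        \<le> mean (\<lambda>\<alpha>. \<Sum>l<r. cmod (f (t * b) (\<zeta> l) \<alpha>) ^ (r * 2) * ?w \<alpha>)"
      unfolding sum_residue_class[OF b(2) \<zeta>] sum_distrib_right[symmetric] prod_norm[symmetric]
      by (intro mean_mono mult_right_mono prod_power_le_sum r w0) auto
    also have "\<dots> \<le> (\<Sum>l<r. B)"
      unfolding mean_sum using near by (intro sum_mono B) auto
    finally show "mean (\<lambda>\<alpha>. (cmod (\<Sum>x | x \<in> ?X \<and> ?z x = \<zeta>. ?\<Phi> x \<alpha>))\<^sup>2 * ?w \<alpha>) \<le> real r * B" by simp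
  qed simp
  also have "\<dots> \<le> ?D * (of_int q ^ (r * (t * b - a)) * (real r * B))"
    using card_residue_tuples[OF b(2)] B0 by (auto intro!: mult_left_mono mult_right_mono)
  finally show ?thesis .
qed

text \<open>Hoelder with \<open>(2r, 2t) = (1/t) (2rt, 2) + (1 - 1/t) (0, 2t + 2)\<close>. The first
  mean is an instance of \<open>I(b, t * b)\<close> with the \<open>\<eta>\<close> classes as
  separated classes; the second has total degree \<open>2 * S\<close> and is controlled by
  \<open>J (n - Suc b)\<close>.\<close>

lemma K_bound_step:
  assumes kq: "int k < q" and rt: "r \<le> k" "t \<le> k" "k \<le> r + t" and ab: "(k - t - 1) * a \<le> b"
    and b: "b \<ge> 1" "Suc a \<le> t * b" and n: "Suc b \<le> n"
    and I: "I_bound b (t * b) B" and B: "B \<ge> 0"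
  shows "K_bound a b (of_int q ^ (mu_exp r t k * b + nu_exp r t k * a) * (of_int q ^ (r * (t * b - a))
     * (real r * (B powr (1 / real t) * (real r * J (n - Suc b)) powr (1 - 1 / real t)))))"
  unfolding K_bound_def
proof (intro allI impI)
  fix \<xi> \<eta> assume \<xi>: "separated a \<xi>" and \<eta>: "separated b \<eta>" and unit: "\<forall>l<r. \<forall>m<r. \<not> q dvd \<xi> l - \<eta> m"
  let ?P = "\<lambda>\<alpha>. \<Prod>l<r. cmod (f (Suc b) (\<eta> l) \<alpha>)"
  let ?p = "1 / real t"
  have P0: "?P \<alpha> \<ge> 0" for \<alpha> by (simp add: prod_nonneg)
  have t0: "real t > 0" using t by simp
  show "mean (\<lambda>\<alpha>. (\<Prod>l<r. cmod (f (Suc a) (\<xi> l) \<alpha>))\<^sup>2 * ?P \<alpha> ^ (2 * t))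
    \<le> of_int q ^ (mu_exp r t k * b + nu_exp r t k * a) * (of_int q ^ (r * (t * b - a))
     * (real r * (B powr ?p * (real r * J (n - Suc b)) powr (1 - ?p))))"
  proof (rule mean_congruencing[OF kq rt ab b \<xi> \<eta>])
    fix \<zeta> l assume l: "l < r" and \<zeta>: "q ^ Suc a dvd \<zeta> - \<xi> l"
    have "mean (\<lambda>\<alpha>. cmod (f (t * b) \<zeta> \<alpha>) ^ (r * 2) * ?P \<alpha> ^ (2 * t))
        \<le> mean (\<lambda>\<alpha>. cmod (f (t * b) \<zeta> \<alpha>) ^ (2 * r * t) * ?P \<alpha> ^ 2) powr ?p
          * mean (\<lambda>\<alpha>. cmod (f (t * b) \<zeta> \<alpha>) ^ 0 * ?P \<alpha> ^ (2 * t + 2)) powr (1 - ?p)"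
    proof (rule mean_interpolation)
      show "real (2 * r * t) * ?p + real 0 * (1 - ?p) = real (r * 2)" using t0 by simp
      show "real 2 * ?p + real (2 * t + 2) * (1 - ?p) = real (2 * t)" using t0 by (simp add: field_simps)
    qed (use P0 r t in auto)
    also have "\<dots> \<le> B powr ?p * (real r * J (n - Suc b)) powr (1 - ?p)"
    proof (intro mult_mono powr_mono2)
      \<comment> \<open>The unit condition survives the exchange of roles, since
        \<open>\<zeta>\<close> and \<open>\<xi> l\<close> agree modulo \<open>q\<close>.\<close>
      have "\<not> q dvd \<eta> m - \<zeta>" if m: "m < r" for m
      proof
        assume "q dvd \<eta> m - \<zeta>"
        moreover have "q dvd \<zeta> - \<xi> l" using \<zeta> by (metis dvd_mult_left power_Suc)
        ultimately have "q dvd (\<eta> m - \<zeta>) + (\<zeta> - \<xi> l)" by (rule dvd_add)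
        then have "q dvd \<xi> l - \<eta> m" by (simp add: dvd_diff_commute)
        then show False using unit l m by blast
      qed
      from I_boundD[OF I \<eta> this]
      show "mean (\<lambda>\<alpha>. cmod (f (t * b) \<zeta> \<alpha>) ^ (2 * r * t) * (?P \<alpha>)\<^sup>2) \<le> B"
        by (simp add: mult.commute)
      have "mean (\<lambda>\<alpha>. cmod (f (t * b) \<zeta> \<alpha>) ^ 0 * ?P \<alpha> ^ (2 * t + 2))
          \<le> mean (\<lambda>\<alpha>. \<Sum>l<r. cmod (f (Suc b) (\<eta> l) \<alpha>) ^ (r * (2 * t + 2)))"
        unfolding power_0 mult_1 by (intro mean_mono prod_power_le_sum r) auto
      also have "\<dots> \<le> (\<Sum>l<r. J (n - Suc b))"
      proof -
        have "r * (2 * t + 2) = 2 * S" by simp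
        then show ?thesis unfolding mean_sum using mean_f_power_le[OF n] by (simp only: sum_mono)
      qed
      finally show "mean (\<lambda>\<alpha>. cmod (f (t * b) \<zeta> \<alpha>) ^ 0 * ?P \<alpha> ^ (2 * t + 2)) \<le> real r * J (n - Suc b)" by simp
    qed (use t P0 in \<open>auto intro!: mean_nonneg\<close>)
    finally show "mean (\<lambda>\<alpha>. cmod (f (t * b) \<zeta> \<alpha>) ^ (r * 2) * ?P \<alpha> ^ (2 * t))
        \<le> B powr ?p * (real r * J (n - Suc b)) powr (1 - ?p)" .
  qed (use unit r in auto)
qed

section \<open>Iteration\<close>

lemma I_bound_mono: "I_bound a b B \<Longrightarrow> B \<le> B' \<Longrightarrow> I_bound a b B'"
  unfolding I_bound_def by (meson order_trans)

lemma K_bound_mono: "K_bound a b B \<Longrightarrow> B \<le> B' \<Longrightarrow> K_bound a b B'"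
  unfolding K_bound_def by (meson order_trans)

abbreviation Q :: real where "Q \<equiv> of_int q"

lemma Q_gt_1: "Q > 1" using q_gt_1 by simp

lemma Q_pos [simp]: "Q > 0" using q_gt_1 by simp

lemma q_neq_0 [simp]: "q \<noteq> 0" using q_gt_1 by simp

definition growth :: "real \<Rightarrow> real \<Rightarrow> bool" where
  "growth C E \<longleftrightarrow> (\<forall>m\<le>n. J m \<le> C * Q powr (real m * E))"

lemma growthD: "growth C E \<Longrightarrow> m \<le> n \<Longrightarrow> J m \<le> C * Q powr (real m * E)"
  by (simp add: growth_def)

text \<open>Since \<open>E / (t + 1)\<close> is at least \<open>r\<close>, the trivial bound already
  decays at rate \<open>r\<close>, hence \<open>\<alpha>\<close>, in \<open>a\<close> and at rate
  \<open>r * t\<close> in \<open>b\<close>.\<close>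

lemma I_bound_growth:
  assumes growth: "growth C E" and C: "C \<ge> 0" and E: "E \<ge> real S" and \<alpha>: "\<alpha> \<le> real r"
    and ab: "Suc a \<le> n" "b \<le> n"
  shows "I_bound a b (real r * C * Q powr (real n * E - \<alpha> * real a - real (r * t) * real b))"
proof (rule I_bound_mono[OF I_bound_trivial[OF ab]])
  let ?p = "1 / (real t + 1)" and ?p' = "real t / (real t + 1)"
  have pp: "?p + ?p' = 1" by (simp add: add_divide_distrib[symmetric])
  have E0: "E \<ge> 0" using E by (meson of_nat_0_le_iff order_trans)
  have "J (n - Suc a) \<le> C * Q powr (real (n - Suc a) * E)" by (rule growthD[OF growth]) simp
  also have "\<dots> \<le> C * Q powr ((real n - real a) * E)"
    using C E0 ab Q_gt_1 by (intro mult_left_mono powr_mono mult_right_mono) auto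
  finally have "J (n - Suc a) powr ?p \<le> (C * Q powr ((real n - real a) * E)) powr ?p"
    by (intro powr_mono2) auto
  moreover have "J (n - b) \<le> C * Q powr ((real n - real b) * E)"
    using growthD[OF growth, of "n - b"] ab by (simp add: of_nat_diff)
  then have "J (n - b) powr ?p' \<le> (C * Q powr ((real n - real b) * E)) powr ?p'"
    by (intro powr_mono2) auto
  ultimately have "J (n - Suc a) powr ?p * J (n - b) powr ?p'
      \<le> (C * Q powr ((real n - real a) * E)) powr ?p * (C * Q powr ((real n - real b) * E)) powr ?p'"
    by (intro mult_mono) auto
  also have "\<dots> = (C powr ?p * C powr ?p') * (Q powr ((real n - real a) * E * ?p) * Q powr ((real n - real b) * E * ?p'))"
    using C by (simp add: powr_mult powr_powr mult_ac)
  also have "C powr ?p * C powr ?p' = C"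
    using C pp by (simp add: powr_add[symmetric])
  also have "Q powr ((real n - real a) * E * ?p) * Q powr ((real n - real b) * E * ?p')
      = Q powr (real n * E * (?p + ?p') - (E * ?p) * a - (E * ?p) * (real t * b))"
    unfolding powr_add[symmetric] by (simp add: algebra_simps)
  also have "\<dots> \<le> Q powr (real n * E - \<alpha> * real a - real (r * t) * real b)"
  proof (rule powr_mono)
    have Er: "E * ?p \<ge> real r"
      using E by (simp add: field_simps)
    have "\<alpha> * real a \<le> E * ?p * real a" using \<alpha> Er by (intro mult_right_mono) auto
    moreover have "real r * (real t * real b) \<le> E * ?p * (real t * real b)" using Er by (intro mult_right_mono) auto
    ultimately show "real n * E * (?p + ?p') - (E * ?p) * a - (E * ?p) * (real t * b)
        \<le> real n * E - \<alpha> * real a - real (r * t) * real b" unfolding pp by simp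
  qed (use Q_gt_1 in simp)
  finally have "J (n - Suc a) powr ?p * J (n - b) powr ?p'
      \<le> C * Q powr (real n * E - \<alpha> * real a - real (r * t) * real b)"
    using C by (simp add: mult_left_mono)
  then show "real r * (J (n - Suc a) powr ?p * J (n - b) powr ?p')
      \<le> real r * C * Q powr (real n * E - \<alpha> * real a - real (r * t) * real b)"
    unfolding mult.assoc by (rule mult_left_mono) simp
qed

text \<open>Adding up the exponents of \<open>K_bound_step\<close>: the coefficient of
  \<open>a\<close> is \<open>nu_exp - r = - \<alpha>\<close>, so the rate in \<open>a\<close>
  reproduces itself. The coefficient of \<open>b\<close> is
  \<open>mu_exp + r * t - \<alpha> / t - \<beta> - (1 - 1 / t) * E\<close>, which is
  \<open>- (\<beta> + g)\<close>.\<close>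

lemma K_bound_growth:
  fixes A C E \<alpha> g \<beta> :: real
  assumes kq: "int k < q" and rt: "r \<le> k" "t \<le> k" "k \<le> r + t" and ab: "(k - t - 1) * a \<le> b"
    and b: "b \<ge> 1" "Suc a \<le> t * b" and n: "Suc b \<le> n"
    and growth: "growth C E" and C: "C \<ge> 0" and E: "E \<ge> 0" and A: "A \<ge> 0"
    and \<alpha>: "\<alpha> = real r - real (nu_exp r t k)"
    and g: "g = (1 - 1 / real t) * E + \<alpha> / real t - real (mu_exp r t k) - real (r * t)"
    and I: "I_bound b (t * b) (A * Q powr (real n * E - \<alpha> * real b - \<beta> * real (t * b)))"
  shows "K_bound a b (real r * A powr (1 / real t) * (real r * C) powr (1 - 1 / real t)
      * Q powr (real n * E - \<alpha> * real a - (\<beta> + g) * real b))"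
proof (rule K_bound_mono[OF K_bound_step[OF kq rt ab b n I]])
  let ?p = "1 / real t"
  have t0: "real t > 0" using t by simp
  have p: "0 < ?p" "?p < 1" using t by auto
  show "A * Q powr (real n * E - \<alpha> * real b - \<beta> * real (t * b)) \<ge> 0" using A by simp
  have "J (n - Suc b) \<le> C * Q powr (real (n - Suc b) * E)" by (rule growthD[OF growth]) simp
  also have "\<dots> \<le> C * Q powr ((real n - real b) * E)"
    using C E n Q_gt_1 by (intro mult_left_mono powr_mono mult_right_mono) auto
  finally have "real r * J (n - Suc b) \<le> real r * C * Q powr ((real n - real b) * E)"
    unfolding mult.assoc by (intro mult_left_mono) auto
  then have "(real r * J (n - Suc b)) powr (1 - ?p) \<le> (real r * C * Q powr ((real n - real b) * E)) powr (1 - ?p)"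
    using p by (intro powr_mono2) auto
  also have "\<dots> = (real r * C) powr (1 - ?p) * Q powr ((real n - real b) * E * (1 - ?p))"
    using C by (simp add: powr_mult powr_powr)
  finally have JJ: "(real r * J (n - Suc b)) powr (1 - ?p)
      \<le> (real r * C) powr (1 - ?p) * Q powr ((real n - real b) * E * (1 - ?p))" .
  have BB: "(A * Q powr (real n * E - \<alpha> * real b - \<beta> * real (t * b))) powr ?p
      = A powr ?p * Q powr ((real n * E - \<alpha> * real b - \<beta> * real (t * b)) * ?p)"
    using A by (simp add: powr_mult powr_powr)
  have natexp: "Q ^ (mu_exp r t k * b + nu_exp r t k * a) * Q ^ (r * (t * b - a))
      = Q powr (real (mu_exp r t k) * real b + real (nu_exp r t k) * real a + real r * (real t * real b - real a))"
  proof -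
    have "a \<le> t * b" using b(2) by simp
    then show ?thesis
      by (simp add: powr_realpow[symmetric] powr_add[symmetric] of_nat_diff)
  qed
  have expo: "real (mu_exp r t k) * real b + real (nu_exp r t k) * real a + real r * (real t * real b - real a)
      + (real n * E - \<alpha> * real b - \<beta> * real (t * b)) * ?p + (real n - real b) * E * (1 - ?p)
      = real n * E - \<alpha> * real a - (\<beta> + g) * real b"
    unfolding g \<alpha> using t0 by (simp add: field_simps)
  have "Q ^ (mu_exp r t k * b + nu_exp r t k * a) * (Q ^ (r * (t * b - a))
     * (real r * ((A * Q powr (real n * E - \<alpha> * real b - \<beta> * real (t * b))) powr ?p
        * (real r * J (n - Suc b)) powr (1 - ?p))))
    \<le> Q ^ (mu_exp r t k * b + nu_exp r t k * a) * (Q ^ (r * (t * b - a))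
     * (real r * ((A powr ?p * Q powr ((real n * E - \<alpha> * real b - \<beta> * real (t * b)) * ?p))
        * ((real r * C) powr (1 - ?p) * Q powr ((real n - real b) * E * (1 - ?p))))))"
    unfolding BB using JJ A by (intro mult_left_mono) auto
  also have "\<dots> = real r * A powr ?p * (real r * C) powr (1 - ?p) * (
      (Q ^ (mu_exp r t k * b + nu_exp r t k * a) * Q ^ (r * (t * b - a)))
      * Q powr ((real n * E - \<alpha> * real b - \<beta> * real (t * b)) * ?p) * Q powr ((real n - real b) * E * (1 - ?p)))"
    by (simp only: mult_ac)
  also have "\<dots> = real r * A powr ?p * (real r * C) powr (1 - ?p)
      * Q powr (real n * E - \<alpha> * real a - (\<beta> + g) * real b)"
    unfolding natexp powr_add[symmetric] expo ..
  finally show "Q ^ (mu_exp r t k * b + nu_exp r t k * a) * (Q ^ (r * (t * b - a))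
     * (real r * ((A * Q powr (real n * E - \<alpha> * real b - \<beta> * real (t * b))) powr ?p
        * (real r * J (n - Suc b)) powr (1 - ?p))))
    \<le> real r * A powr ?p * (real r * C) powr (1 - ?p)
      * Q powr (real n * E - \<alpha> * real a - (\<beta> + g) * real b)" .
qed

text \<open>Trivially \<open>\<beta> = r * t\<close>. Every congruencing step increases \<open>\<beta>\<close> by \<open>g\<close>, at the price of shrinking the
  range of \<open>b\<close> by a constant factor.\<close>

definition I_decay :: "real \<Rightarrow> real \<Rightarrow> real \<Rightarrow> nat \<Rightarrow> real \<Rightarrow> bool" where
  "I_decay E \<alpha> \<beta> L A \<longleftrightarrow> (\<forall>a b. 1 \<le> b \<longrightarrow> a \<le> b \<longrightarrow> (k - t - 1) * a \<le> b \<longrightarrow> Suc a \<le> n \<longrightarrow> L * b \<le> n \<longrightarrow>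
     I_bound a b (A * Q powr (real n * E - \<alpha> * real a - \<beta> * real b)))"

text \<open>The range parameter grows by \<open>t * G\<close>: a factor \<open>t\<close> because
  \<open>K(a,b')\<close> is estimated through \<open>I(b', t * b')\<close>, and a factor
  \<open>G\<close> because \<open>b'\<close> runs up to \<open>G * b\<close>. The size of
  \<open>G\<close> is dictated by the decay that the trivial estimate at \<open>G * b\<close>
  lacks.\<close>

lemma I_decay_step:
  fixes A C E \<alpha> g \<beta> :: real
  assumes kq: "int k < q" and rt: "r \<le> k" "t \<le> k" "k \<le> r + t" "k \<le> 2 * t + 1"
    and large: "2 * (2 * real r) ^ (2 * r * t) \<le> Q"
    and growth: "growth C E" and C: "C \<ge> 0" and E: "E \<ge> real S" and A: "A \<ge> 0"
    and \<alpha>: "\<alpha> = real r - real (nu_exp r t k)"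
    and g: "g = (1 - 1 / real t) * E + \<alpha> / real t - real (mu_exp r t k) - real (r * t)" "g \<ge> 0"
    and \<beta>: "\<beta> \<ge> real (r * t)"
    and G: "G \<ge> 1" "Q powr (\<beta> + g - real (r * t)) \<le> 2 ^ (G - 1)" and L: "L \<ge> 1"
    and I: "I_decay E \<alpha> \<beta> L A"
  shows "I_decay E \<alpha> (\<beta> + g) (L * (t * G))
     (2 * ((2 * Q) ^ (2 * r * t) * Q ^ r * (real r * A powr (1 / real t) * (real r * C) powr (1 - 1 / real t)))
        + real r * C)"
  unfolding I_decay_def
proof (intro allI impI)
  fix a b :: nat
  assume b: "1 \<le> b" and ab: "a \<le> b" "(k - t - 1) * a \<le> b" and an: "Suc a \<le> n" and Lb: "L * (t * G) * b \<le> n"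
  have rt2: "real (r * t) \<ge> 2"
  proof -
    have "1 * 2 \<le> r * t" using r t by (intro mult_le_mono) auto
    then have "2 \<le> r * t" by simp
    then show ?thesis by (metis of_nat_le_iff of_nat_numeral)
  qed
  \<comment> \<open>Raise \<open>b\<close> in steps of one up to \<open>G * b\<close>: the geometric gain \<open>c1 * Q * Q powr (- (r * t)) \<le> 1 / 2\<close>
    then makes the trivial estimate at the end point sufficient.\<close>
  define c1 where "c1 = (2 * real r) ^ (2 * r * t)"
  define c2 where "c2 = (2 * Q) ^ (2 * r * t) * Q ^ r"
  define cK where "cK = real r * A powr (1 / real t) * (real r * C) powr (1 - 1 / real t)"
  define Y where "Y = Q powr (real n * E - \<alpha> * real a)"
  define e where "e = \<beta> + g"
  have YQ: "Y * Q powr (- c * s) = Q powr (real n * E - \<alpha> * real a - c * s)" for c s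
    unfolding Y_def powr_add[symmetric] by simp
  have c1: "c1 \<ge> 0" "2 * c1 \<le> Q" using large by (auto simp: c1_def)
  have c2: "c2 \<ge> 0" "cK \<ge> 0" "Y > 0" using A C q_gt_1 by (auto simp: c2_def cK_def Y_def)
  have e2: "e \<ge> real (r * t)" using \<beta> g(2) by (simp add: e_def)
  have half: "c1 * Q * Q powr (- s) \<le> 1 / 2" if "s \<ge> 2" for s
  proof -
    have "c1 * Q * Q powr (- s) \<le> c1 * Q * Q powr (- 2)"
      using that c1 Q_gt_1 by (intro mult_left_mono powr_mono) auto
    also have "\<dots> = c1 / Q" by (simp add: powr_minus power2_eq_square field_simps)
    also have "\<dots> \<le> 1 / 2" using c1 by (simp add: field_simps)
    finally show ?thesis .
  qed
  have E0: "E \<ge> 0" using E by (meson of_nat_0_le_iff order_trans)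
  have \<alpha>r: "\<alpha> \<le> real r" using \<alpha> by simp
  have tG: "G * b \<le> n" "\<And>b'. b' \<le> G * b \<Longrightarrow> L * (t * b') \<le> n"
  proof -
    have *: "L * (t * (G * b)) \<le> n" using Lb by (simp add: mult.assoc)
    show "L * (t * b') \<le> n" if "b' \<le> G * b" for b'
      using mult_le_mono2[OF mult_le_mono2[OF that, of t], of L] * by (rule order_trans)
    have "1 * (1 * (G * b)) \<le> L * (t * (G * b))" using L t by (intro mult_le_mono) auto
    from order_trans[OF this *] show "G * b \<le> n" by (simp only: mult_1)
  qed
  have K: "K_bound a b' (cK * (Y * Q powr (- e * real b')))" if b': "b \<le> b'" "b' < G * b" for b'
  proof -
    have b'1: "1 \<le> b'" and n': "Suc b' \<le> n" using b b' tG(1) by auto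
    have tb: "2 * b' \<le> t * b'" using t by (intro mult_le_mono1)
    then have "Suc a \<le> t * b'" using ab(1) b b' by linarith
    moreover have "(k - t - 1) * b' \<le> t * b'" using rt(4) by (intro mult_le_mono1) simp
    moreover have "(k - t - 1) * a \<le> b'" using ab(2) b' by simp
    moreover have "I_bound b' (t * b') (A * Q powr (real n * E - \<alpha> * real b' - \<beta> * real (t * b')))"
      using I[unfolded I_decay_def, rule_format, of "t * b'" b'] b'1 tb \<open>(k - t - 1) * b' \<le> t * b'\<close> n' tG(2)[of b'] b'
      by linarith
    ultimately have "K_bound a b' (cK * Q powr (real n * E - \<alpha> * real a - (\<beta> + g) * real b'))"
      unfolding cK_def using K_bound_growth[OF kq rt(1-3) _ b'1 _ n' growth C E0 A \<alpha> g(1)] by blast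
    then show ?thesis unfolding YQ e_def .
  qed
  \<comment> \<open>\<open>h\<close> counts levels downwards from \<open>G * b\<close>. The first
    summand collects the terms from \<open>K_bound\<close>, a geometric sum at most twice its newest
    term; the second is the trivial bound with its accumulated constants.\<close>
  have claim: "h \<le> (G - 1) * b \<Longrightarrow> I_bound a (G * b - h)
      (2 * (c2 * cK) * (Y * Q powr (- e * real (G * b - h)))
        + real r * C * (Y * Q powr (- real (r * t) * real (G * b))) * (c1 * Q) ^ h)" for h
  proof (induction h)
    case 0
    have "I_bound a (G * b) (real r * C * (Y * Q powr (- real (r * t) * real (G * b))))"
      unfolding YQ by (rule I_bound_growth[OF growth C E \<alpha>r an tG(1)])
    then show ?case unfolding minus_nat.diff_0 power_0 mult_1_right
      by (rule I_bound_mono) (use c2 in simp)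
  next
    case (Suc h)
    define b' where "b' = G * b - Suc h"
    have "G * b = b + (G - 1) * b" using G(1) by (cases G) auto
    then have b': "b \<le> b'" "b' < G * b" "G * b - h = Suc b'" using Suc.prems b by (auto simp: b'_def)
    let ?T = "real r * C * (Y * Q powr (- real (r * t) * real (G * b)))"
    have "I_bound a (Suc b') (2 * (c2 * cK) * (Y * Q powr (- e * real (Suc b'))) + ?T * (c1 * Q) ^ h)"
      using Suc b'(3) by simp
    from I_bound_le_K_bound[OF _ this K[OF b'(1,2)]] b b' c2
    have "I_bound a b' (c1 * Q * (2 * (c2 * cK) * (Y * Q powr (- e * real (Suc b'))) + ?T * (c1 * Q) ^ h)
        + c2 * (cK * (Y * Q powr (- e * real b'))))"
      unfolding c1_def c2_def by simp
    moreover have "c1 * Q * (2 * (c2 * cK) * (Y * Q powr (- e * real (Suc b'))) + ?T * (c1 * Q) ^ h)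
        + c2 * (cK * (Y * Q powr (- e * real b')))
      \<le> 2 * (c2 * cK) * (Y * Q powr (- e * real b')) + ?T * (c1 * Q) ^ Suc h"
    proof -
      let ?V = "c2 * cK * (Y * Q powr (- e * real b'))"
      have "Q powr (- e * real (Suc b')) = Q powr (- e) * Q powr (- e * real b')"
        unfolding powr_add[symmetric] by (simp add: algebra_simps)
      then have "c1 * Q * (2 * (c2 * cK) * (Y * Q powr (- e * real (Suc b'))))
          = c1 * Q * Q powr (- e) * (2 * ?V)" by (simp only: mult_ac)
      also have "\<dots> \<le> 1 / 2 * (2 * ?V)"
        using half[of e] e2 rt2 c2 by (intro mult_right_mono) auto
      finally show ?thesis by (simp add: distrib_left mult_ac)
    qed
    ultimately show ?case unfolding b'_def[symmetric] by (rule I_bound_mono)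
  qed
  have Gb: "G * b - (G - 1) * b = b" using G(1) by (cases G) auto
  have Gb': "real (G * b) = real b + real ((G - 1) * b)" using G(1) by (cases G) (auto simp: algebra_simps)
  have pw: "(Q powr s) ^ m = Q powr (s * real m)" for s and m :: nat
    using powr_realpow[of "Q powr s" m] q_gt_1 by (simp add: powr_powr)
  \<comment> \<open>Over \<open>(G - 1) * b\<close> levels the trivial rate \<open>r * t\<close>
    beats the constants by at least \<open>1 / 2\<close> per level. By the choice of
    \<open>G\<close> this supplies the missing decay from \<open>r * t\<close> to
    \<open>e\<close>.\<close>
  have "Q powr (- real (r * t) * real (G * b)) * (c1 * Q) ^ ((G - 1) * b)
      = Q powr (- real (r * t) * real b) * (c1 * Q * Q powr (- real (r * t))) ^ ((G - 1) * b)"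
    unfolding Gb' power_mult_distrib pw distrib_left powr_add by (simp only: mult_ac)
  also have "\<dots> \<le> Q powr (- real (r * t) * real b) * (1 / 2) ^ ((G - 1) * b)"
    using half[OF rt2] c1 by (intro mult_left_mono power_mono) auto
  also have "\<dots> \<le> Q powr (- real (r * t) * real b) * (Q powr (- (e - real (r * t)))) ^ b"
  proof -
    have "(1 / 2) ^ (G - 1) \<le> Q powr (- (e - real (r * t)))"
    proof -
      have "inverse (2 ^ (G - 1)) \<le> inverse (Q powr (e - real (r * t)))"
        using G(2) by (intro le_imp_inverse_le) (auto simp: e_def)
      then show ?thesis by (simp only: powr_minus power_one_over inverse_eq_divide)
    qed
    then have "((1 / 2) ^ (G - 1)) ^ b \<le> (Q powr (- (e - real (r * t)))) ^ b"
      by (intro power_mono) auto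
    then show ?thesis unfolding power_mult[symmetric] by (intro mult_left_mono) auto
  qed
  also have "\<dots> = Q powr (- e * real b)"
    unfolding pw powr_add[symmetric] by (simp add: algebra_simps)
  finally have T: "Q powr (- real (r * t) * real (G * b)) * (c1 * Q) ^ ((G - 1) * b) \<le> Q powr (- e * real b)" .
  have "real r * C * (Y * Q powr (- real (r * t) * real (G * b))) * (c1 * Q) ^ ((G - 1) * b)
      = real r * C * Y * (Q powr (- real (r * t) * real (G * b)) * (c1 * Q) ^ ((G - 1) * b))"
    by (simp only: mult_ac)
  also have "\<dots> \<le> real r * C * Y * Q powr (- e * real b)"
    using T C c2 by (intro mult_left_mono) auto
  finally have "real r * C * (Y * Q powr (- real (r * t) * real (G * b))) * (c1 * Q) ^ ((G - 1) * b)
      \<le> real r * C * (Y * Q powr (- e * real b))" by (simp only: mult.assoc)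
  then have T': "2 * (c2 * cK) * (Y * Q powr (- e * real b))
      + real r * C * (Y * Q powr (- real (r * t) * real (G * b))) * (c1 * Q) ^ ((G - 1) * b)
      \<le> (2 * (c2 * cK) + real r * C) * (Y * Q powr (- e * real b))"
    unfolding distrib_right by (rule add_left_mono)
  have "I_bound a b ((2 * (c2 * cK) + real r * C) * (Y * Q powr (- e * real b)))"
    using I_bound_mono[OF claim[of "(G - 1) * b", unfolded Gb] T'] by simp
  then show "I_bound a b ((2 * ((2 * Q) ^ (2 * r * t) * Q ^ r * (real r * A powr (1 / real t) * (real r * C) powr (1 - 1 / real t)))
        + real r * C) * Q powr (real n * E - \<alpha> * real a - (\<beta> + g) * real b))"
    unfolding YQ c2_def cK_def e_def .
qed

lemma I_decay_0:
  assumes growth: "growth C E" and C: "C \<ge> 0" and E: "E \<ge> real S" and \<alpha>: "\<alpha> \<le> real r"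
  shows "I_decay E \<alpha> (real (r * t)) 1 (real r * C)"
  unfolding I_decay_def using I_bound_growth[OF growth C E \<alpha>] by simp

lemma I_bound_first:
  assumes "I_bound 0 (Suc i) B"
  shows "I_bound 0 1 (Q ^ ((2 * r * t + 1) * i) * B)"
  using assms
proof (induction i arbitrary: B)
  case (Suc i)
  have "I_bound 0 (Suc i) (Q ^ (2 * r * t + 1) * B)"
    by (rule I_bound_Suc[OF _ Suc.prems]) simp
  moreover have "Q ^ ((2 * r * t + 1) * i) * (Q ^ (2 * r * t + 1) * B)
      = Q ^ ((2 * r * t + 1) * Suc i) * B"
    unfolding mult_Suc_right power_add[of Q "2 * r * t + 1"] by (simp only: mult_ac)
  ultimately show ?case using Suc.IH by metis
qed simp

text \<open>Take \<open>m = n div L\<close>. Descending from \<open>I(0, m)\<close> to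
  \<open>I(0, 1)\<close> costs at most \<open>Q ^ ((2 * r * t + 1) * m)\<close>, while the decay
  gains \<open>Q powr (\<beta> * m)\<close>. The net saving \<open>Q ^ m\<close> is
  \<open>Q powr (n / L)\<close> up to a factor \<open>Q\<close>. For \<open>n < L\<close> the growth
  bound itself loses at most that factor.\<close>

lemma J_recursion:
  assumes growth: "growth C E" and C: "C \<ge> 0" and A: "A \<ge> 0" and L: "L \<ge> 1"
    and I: "I_decay E \<alpha> \<beta> L A" and \<beta>: "\<beta> \<ge> real (2 * r * t + 2)" and n: "n \<ge> 1"
  shows "J n \<le> (2 * real (Suc r)) ^ (2 * S) * Q * J (n - 1)
     + (C * Q + (2 * Q) ^ (2 * S) * Q ^ Suc r * (A * Q)) * Q powr (real n * (E - 1 / real L))"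
proof (cases "L \<le> n")
  case False
  have L0: "real L > 0" using L by simp
  have "J n \<le> C * Q powr (real n * E)" by (rule growthD[OF growth]) simp
  also have "\<dots> \<le> C * Q powr (1 + real n * (E - 1 / real L))"
  proof (intro mult_left_mono powr_mono)
    have "real n * (1 / real L) \<le> 1" using False L0 by simp
    then show "real n * E \<le> 1 + real n * (E - 1 / real L)" by (simp add: right_diff_distrib)
  qed (use C Q_gt_1 in auto)
  also have "\<dots> = C * Q * Q powr (real n * (E - 1 / real L))"
    by (simp add: powr_add)
  also have "\<dots> \<le> (C * Q + (2 * Q) ^ (2 * S) * Q ^ Suc r * (A * Q)) * Q powr (real n * (E - 1 / real L))"
    using A by (intro mult_right_mono) auto
  finally show ?thesis by (simp add: add_increasing)
next
  case True
  have L0: "real L > 0" using L by simp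
  define m where "m = n div L"
  have m: "m \<ge> 1" "L * m \<le> n"
    using True L by (auto simp: m_def div_greater_zero_iff Suc_le_eq)
  have "n mod L < L" using L by simp
  then have "n \<le> L * m + L" unfolding m_def using mult_div_mod_eq[of L n] by linarith
  then have "real n \<le> real L * real m + real L" by (metis of_nat_add of_nat_le_iff of_nat_mult)
  then have mn: "real n * (1 / real L) \<le> real m + 1"
    using L0 by (simp add: field_simps)
  obtain i where i: "m = Suc i" using m(1) by (cases m) auto
  have "I_bound 0 m (A * Q powr (real n * E - \<alpha> * real 0 - \<beta> * real m))"
    using I[unfolded I_decay_def, rule_format, of m 0] m n by simp
  then have "I_bound 0 1 (Q ^ ((2 * r * t + 1) * i) * (A * Q powr (real n * E - \<beta> * real m)))"
    using I_bound_first i by simp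
  moreover have "Q ^ ((2 * r * t + 1) * i) * (A * Q powr (real n * E - \<beta> * real m))
      \<le> A * Q * Q powr (real n * (E - 1 / real L))"
  proof -
    have "Q ^ ((2 * r * t + 1) * i) * (A * Q powr (real n * E - \<beta> * real m))
        = A * Q powr (real ((2 * r * t + 1) * i) + (real n * E - \<beta> * real m))"
      by (simp add: powr_add powr_realpow[symmetric] del: of_nat_mult of_nat_add)
    also have "\<dots> \<le> A * Q powr (1 + real n * (E - 1 / real L))"
    proof (intro mult_left_mono powr_mono)
      have "real ((2 * r * t + 1) * i) \<le> real ((2 * r * t + 1) * m)" unfolding i by simp
      moreover have "real (2 * r * t + 2) * real m \<le> \<beta> * real m" using \<beta> by (intro mult_right_mono) auto
      moreover have "real (2 * r * t + 2) * real m = real ((2 * r * t + 1) * m) + real m"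
        by (simp add: algebra_simps)
      ultimately show "real ((2 * r * t + 1) * i) + (real n * E - \<beta> * real m) \<le> 1 + real n * (E - 1 / real L)"
        using mn unfolding right_diff_distrib by linarith
    qed (use A Q_gt_1 in auto)
    also have "\<dots> = A * Q * Q powr (real n * (E - 1 / real L))" by (simp add: powr_add)
    finally show ?thesis .
  qed
  ultimately have "I_bound 0 1 (A * Q * Q powr (real n * (E - 1 / real L)))" by (rule I_bound_mono)
  from J_le_I_bound[OF n this] A
  have "J n \<le> (2 * real (Suc r)) ^ (2 * S) * Q * J (n - 1)
      + (2 * Q) ^ (2 * S) * Q ^ Suc r * (A * Q * Q powr (real n * (E - 1 / real L)))" by simp
  also have "(2 * Q) ^ (2 * S) * Q ^ Suc r * (A * Q * Q powr (real n * (E - 1 / real L)))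
      = (2 * Q) ^ (2 * S) * Q ^ Suc r * (A * Q) * Q powr (real n * (E - 1 / real L))"
    by (simp only: mult_ac)
  also have "\<dots> \<le> (C * Q + (2 * Q) ^ (2 * S) * Q ^ Suc r * (A * Q)) * Q powr (real n * (E - 1 / real L))"
    using C by (intro mult_right_mono) auto
  finally show ?thesis by simp
qed

end

section \<open>Lowering the growth exponent along powers of the prime\<close>

lemma vinogradov_torus_exists:
  assumes "prime q" "r > 0" "t \<ge> 2"
  shows "\<exists>N. vinogradov_torus k N r t n q"
proof
  let ?M = "int (r * (t + 1)) * (q ^ n) ^ k"
  have "?M < int (nat ?M + 1)" by linarith
  then show "vinogradov_torus k (nat ?M + 1) r t n q"
    using assms by unfold_locales auto
qed

definition growth_exponent :: "nat \<Rightarrow> nat \<Rightarrow> int \<Rightarrow> real \<Rightarrow> bool" where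
  "growth_exponent k S q E \<longleftrightarrow>
     (\<exists>C. \<forall>n. real (J_count k S (q ^ n)) \<le> C * of_int q powr (real n * E))"

text \<open>Stated outside the locale so that one constant \<open>A\<close> serves all
  \<open>n\<close> and \<open>N\<close>; the final bound must be uniform in
  \<open>n\<close>.\<close>

lemma I_decay_iterated:
  fixes C E \<alpha> g :: real
  assumes q: "prime q" and pos: "r > 0" "t \<ge> 2"
    and kq: "int k < q" and rt: "r \<le> k" "t \<le> k" "k \<le> r + t" "k \<le> 2 * t + 1"
    and large: "2 * (2 * real r) ^ (2 * r * t) \<le> of_int q"
    and C: "C \<ge> 0" and E: "E \<ge> real (r * (t + 1))"
    and \<alpha>: "\<alpha> = real r - real (nu_exp r t k)"
    and g: "g = (1 - 1 / real t) * E + \<alpha> / real t - real (mu_exp r t k) - real (r * t)" "g \<ge> 0"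
    and G: "G \<ge> 1" "of_int q powr (real M * g) \<le> 2 ^ (G - 1)" and i: "i \<le> M"
  shows "\<exists>A\<ge>0. \<forall>n N. vinogradov_torus k N r t n q \<longrightarrow> vinogradov_torus.growth k r t n q C E \<longrightarrow>
     vinogradov_torus.I_decay k N r t n q E \<alpha> (real (r * t) + real i * g) ((t * G) ^ i) A"
  using i
proof (induction i)
  case 0
  have "real r * C \<ge> 0" using C by simp
  moreover have "vinogradov_torus.I_decay k N r t n q E \<alpha> (real (r * t) + real 0 * g) ((t * G) ^ 0) (real r * C)"
    if v: "vinogradov_torus k N r t n q" and gr: "vinogradov_torus.growth k r t n q C E" for n N
  proof -
    interpret vinogradov_torus k N r t n q by (rule v)
    show ?thesis using I_decay_0[OF gr C E, of \<alpha>] \<alpha> by simp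
  qed
  ultimately show ?case by blast
next
  case (Suc i)
  then obtain A where A: "A \<ge> 0" and dec: "\<And>n N. vinogradov_torus k N r t n q \<Longrightarrow>
      vinogradov_torus.growth k r t n q C E \<Longrightarrow>
      vinogradov_torus.I_decay k N r t n q E \<alpha> (real (r * t) + real i * g) ((t * G) ^ i) A"
    by auto
  let ?\<beta> = "real (r * t) + real i * g"
  let ?A = "2 * ((2 * of_int q) ^ (2 * r * t) * of_int q ^ r
      * (real r * A powr (1 / real t) * (real r * C) powr (1 - 1 / real t))) + real r * C"
  have q0: "q > 1" using q by (rule prime_gt_1_int)
  have "?A \<ge> 0" using C A q0 by simp
  moreover have "vinogradov_torus.I_decay k N r t n q E \<alpha> (real (r * t) + real (Suc i) * g) ((t * G) ^ Suc i) ?A"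
    if v: "vinogradov_torus k N r t n q" and gr: "vinogradov_torus.growth k r t n q C E" for n N
  proof -
    interpret vinogradov_torus k N r t n q by (rule v)
    have "real (Suc i) * g \<le> real M * g" using Suc.prems g(2) by (intro mult_right_mono) auto
    then have "?\<beta> + g - real (r * t) \<le> real M * g" by (simp add: algebra_simps)
    then have "Q powr (?\<beta> + g - real (r * t)) \<le> Q powr (real M * g)"
      using Q_gt_1 by (intro powr_mono) auto
    then have "Q powr (?\<beta> + g - real (r * t)) \<le> 2 ^ (G - 1)" using G(2) by linarith
    moreover have "?\<beta> \<ge> real (r * t)" using g(2) by simp
    moreover have "(t * G) ^ i \<ge> 1" using pos G(1) by simp
    ultimately have "I_decay E \<alpha> (?\<beta> + g) ((t * G) ^ i * (t * G)) ?A"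
      using I_decay_step[OF kq rt large gr C E A \<alpha> g _ G(1) _ _ dec[OF v gr]] by blast
    moreover have "?\<beta> + g = real (r * t) + real (Suc i) * g" by (simp add: algebra_simps)
    ultimately show ?thesis by (simp only: power_Suc2)
  qed
  ultimately show ?case by blast
qed

text \<open>By \<open>fixed\<close>, the gain \<open>g\<close> vanishes at \<open>E0\<close> and
  equals \<open>(1 - 1 / t) * lam\<close> at \<open>E0 + lam\<close>. The point is that
  \<open>\<delta>\<close> is chosen before \<open>lam\<close>, so that finitely many applications
  bring \<open>lam\<close> down to \<open>\<epsilon>\<close>.\<close>

lemma growth_exponent_improve:
  fixes E0 \<epsilon> \<Lambda> :: real
  assumes q: "prime q" and pos: "r > 0" "t \<ge> 2"
    and kq: "int k < q" and rt: "r \<le> k" "t \<le> k" "k \<le> r + t" "k \<le> 2 * t + 1"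
    and large: "2 * (2 * real (Suc r)) ^ (2 * (r * (t + 1))) \<le> of_int q"
    and E0: "E0 \<ge> real (r * (t + 1))"
    and fixed: "(1 - 1 / real t) * E0
        = real (mu_exp r t k) + real (r * t) - (real r - real (nu_exp r t k)) / real t"
    and \<epsilon>: "\<epsilon> > 0"
  shows "\<exists>\<delta>>0. \<forall>lam. \<epsilon> \<le> lam \<longrightarrow> lam \<le> \<Lambda> \<longrightarrow> growth_exponent k (r * (t + 1)) q (E0 + lam)
      \<longrightarrow> growth_exponent k (r * (t + 1)) q (E0 + lam - \<delta>)"
proof -
  define \<theta> where "\<theta> = 1 - 1 / real t"
  have \<theta>: "\<theta> > 0" using pos by (simp add: \<theta>_def)
  have q1: "q > 1" using q by (rule prime_gt_1_int)
  \<comment> \<open>\<open>M\<close> congruencing steps lift the decay rate from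
    \<open>r * t\<close> to the \<open>2 * r * t + 2\<close> that \<open>J_recursion\<close> asks
    for, even for the smallest admissible \<open>lam\<close>.\<close>
  obtain M :: nat where M: "real (r * t + 2) < real M * (\<theta> * \<epsilon>)"
    using reals_Archimedean3[of "\<theta> * \<epsilon>"] \<theta> \<epsilon> by (auto simp: mult_pos_pos)
  \<comment> \<open>One \<open>G\<close> has to serve all steps and all \<open>lam\<close>, hence
    the largest possible total gain appears here.\<close>
  obtain G' :: nat where G': "of_int q powr (real M * (\<theta> * \<Lambda>)) < 2 ^ G'"
    using real_arch_pow[of 2] by auto
  define G where "G = Suc G'"
  define L where "L = (t * G) ^ M"
  have L: "L \<ge> 1" using pos by (simp add: L_def G_def)
  have c1: "2 * (2 * real r) ^ (2 * r * t) \<le> of_int q"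
  proof -
    have "(2 * real r) ^ (2 * r * t) \<le> (2 * real (Suc r)) ^ (2 * r * t)" by (intro power_mono) auto
    also have "\<dots> \<le> (2 * real (Suc r)) ^ (2 * (r * (t + 1)))" by (intro power_increasing) auto
    finally show ?thesis using large by linarith
  qed
  have "growth_exponent k (r * (t + 1)) q (E0 + lam - 1 / real L)"
    if lam: "\<epsilon> \<le> lam" "lam \<le> \<Lambda>" and ge: "growth_exponent k (r * (t + 1)) q (E0 + lam)" for lam
  proof -
    define E where "E = E0 + lam"
    define \<alpha> where "\<alpha> = real r - real (nu_exp r t k)"
    define g where "g = \<theta> * lam"
    let ?J = "\<lambda>n. real (J_count k (r * (t + 1)) (q ^ n))"
    have E: "E \<ge> real (r * (t + 1))" using E0 lam \<epsilon> by (simp add: E_def)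
    have g: "g = (1 - 1 / real t) * E + \<alpha> / real t - real (mu_exp r t k) - real (r * t)"
      unfolding E_def distrib_left fixed by (simp add: g_def \<theta>_def \<alpha>_def)
    have g0: "g \<ge> 0" using \<theta> lam \<epsilon> by (simp add: g_def)
    obtain C where C: "\<And>n. ?J n \<le> C * of_int q powr (real n * E)"
      using ge unfolding growth_exponent_def E_def by blast
    have C0: "C \<ge> 0" using order_trans[OF of_nat_0_le_iff C[of 0]] q1 by simp
    have "of_int q powr (real M * g) \<le> of_int q powr (real M * (\<theta> * \<Lambda>))"
      unfolding g_def using q1 lam \<theta> by (intro powr_mono mult_left_mono) auto
    then have "of_int q powr (real M * g) \<le> 2 ^ (G - 1)" using G' by (simp add: G_def)
    from I_decay_iterated[OF q pos kq rt c1 C0 E \<alpha>_def g g0 _ this order_refl]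
    obtain A where A: "A \<ge> 0" and dec: "\<And>n N. vinogradov_torus k N r t n q \<Longrightarrow>
      vinogradov_torus.growth k r t n q C E \<Longrightarrow>
      vinogradov_torus.I_decay k N r t n q E \<alpha> (real (r * t) + real M * g) L A"
      unfolding L_def G_def by auto
    have "\<theta> * \<epsilon> \<le> g" unfolding g_def using \<theta> lam by simp
    then have "real M * (\<theta> * \<epsilon>) \<le> real M * g" by (intro mult_left_mono) auto
    then have \<beta>: "real (r * t) + real M * g \<ge> real (2 * r * t + 2)" using M by simp
    define B where "B = C * of_int q + (2 * of_int q) ^ (2 * (r * (t + 1))) * of_int q ^ Suc r * (A * of_int q)"
    define F where "F = E - 1 / real L"
    have B0: "B \<ge> C" "B \<ge> 0"
    proof -
      have "C * 1 \<le> C * of_int q" using C0 q1 by (intro mult_left_mono) auto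
      moreover have "0 \<le> (2 * of_int q) ^ (2 * (r * (t + 1))) * of_int q ^ Suc r * (A * of_int q :: real)"
        using A q1 by simp
      ultimately show "B \<ge> C" unfolding B_def by linarith
      then show "B \<ge> 0" using C0 by linarith
    qed
    have rec: "?J n \<le> (2 * real (Suc r)) ^ (2 * (r * (t + 1))) * of_int q * ?J (n - 1)
        + B * of_int q powr (real n * F)" if n: "n \<ge> 1" for n
    proof -
      obtain N where v: "vinogradov_torus k N r t n q"
        using vinogradov_torus_exists[OF q pos] by blast
      interpret vinogradov_torus k N r t n q by (rule v)
      have gr: "growth C E" unfolding growth_def J_def using C by blast
      show ?thesis
        using J_recursion[OF gr C0 A L dec[OF v gr] \<beta> n] unfolding J_def B_def F_def .
    qed
    have F2: "F \<ge> 2"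
    proof -
      have "1 / real L \<le> 1" using L by simp
      moreover have "1 * 3 \<le> r * (t + 1)" using pos by (intro mult_le_mono) auto
      then have "3 \<le> real (r * (t + 1))" by (metis mult_1 of_nat_le_iff of_nat_numeral)
      ultimately show ?thesis using E unfolding F_def by linarith
    qed
    \<comment> \<open>The recursion is contracting: \<open>F >= 2\<close> and the size of
      \<open>q\<close> make the factor in front of the previous term at most \<open>1 / 2\<close>
      after normalization, so twice the inhomogeneous term is an upper bound.\<close>
    have "?J n \<le> 2 * B * of_int q powr (real n * F)" for n
    proof (induction n)
      case 0
      have "?J 0 \<le> C" using C[of 0] q1 by simp
      then show ?case using B0 q1 by simp
    next
      case (Suc n)
      let ?c = "(2 * real (Suc r)) ^ (2 * (r * (t + 1)))"
      have "?J (Suc n) \<le> ?c * of_int q * ?J n + B * of_int q powr (real (Suc n) * F)"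
        using rec[of "Suc n"] by simp
      also have "?c * of_int q * ?J n \<le> ?c * of_int q * (2 * B * of_int q powr (real n * F))"
        using Suc.IH q1 by (intro mult_left_mono) auto
      also have "\<dots> = ?c * of_int q * of_int q powr (- F) * (2 * B * of_int q powr (real (Suc n) * F))"
      proof -
        have "of_int q powr (real n * F) = of_int q powr (- F) * of_int q powr (real (Suc n) * F)"
          unfolding powr_add[symmetric] by (simp add: algebra_simps)
        then show ?thesis by (simp only: mult_ac)
      qed
      also have "\<dots> \<le> 1 / 2 * (2 * B * of_int q powr (real (Suc n) * F))"
      proof (rule mult_right_mono)
        have "?c * of_int q * of_int q powr (- F) \<le> ?c * of_int q * of_int q powr (- 2)"
          using F2 q1 by (intro mult_left_mono powr_mono) auto
        also have "\<dots> = ?c / of_int q" using q1 by (simp add: powr_minus power2_eq_square field_simps)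
        also have "\<dots> \<le> 1 / 2" using large q1 by (simp add: field_simps)
        finally show "?c * of_int q * of_int q powr (- F) \<le> 1 / 2" .
      qed (use B0 in simp)
      finally show ?case by simp
    qed
    then show ?thesis unfolding growth_exponent_def F_def E_def by blast
  qed
  then show ?thesis using L by (intro exI[of _ "1 / real L"]) auto
qed

lemma growth_exponent_mono:
  assumes "growth_exponent k S q E" "E \<le> E'" "q > 1"
  shows "growth_exponent k S q E'"
proof -
  obtain C where C: "\<And>n. real (J_count k S (q ^ n)) \<le> C * of_int q powr (real n * E)"
    using assms(1) unfolding growth_exponent_def by blast
  have "C \<ge> 0" using order_trans[OF of_nat_0_le_iff C[of 0]] assms(3) by simp
  then have "C * of_int q powr (real n * E) \<le> C * of_int q powr (real n * E')" for n
    using assms by (intro mult_left_mono powr_mono) auto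
  then show ?thesis unfolding growth_exponent_def using C order_trans by blast
qed

lemma growth_exponent_trivial:
  assumes "q > 1"
  shows "growth_exponent k S q (2 * real S)"
proof -
  have "real (J_count k S (q ^ n)) \<le> 1 * of_int q powr (real n * (2 * real S))" for n
  proof -
    let ?X = "PiE {1..S} (\<lambda>_. {0..<q ^ n})"
    have fin: "finite ?X" by (intro finite_PiE) auto
    have "J_count k S (q ^ n) \<le> card (?X \<times> ?X)"
      unfolding J_count_def using fin by (intro card_mono) auto
    also have "\<dots> = (nat (q ^ n) ^ S) * (nat (q ^ n) ^ S)"
      by (simp add: card_cartesian_product card_PiE)
    finally have "real (J_count k S (q ^ n)) \<le> real ((nat (q ^ n) ^ S) * (nat (q ^ n) ^ S))"
      by (simp only: of_nat_le_iff)
    also have "\<dots> = (of_int q ^ n) ^ S * (of_int q ^ n) ^ S" using assms by simp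
    also have "\<dots> = of_int q ^ (n * (S + S))" by (simp add: power_mult power_add distrib_left)
    also have "\<dots> = 1 * of_int q powr (real n * (2 * real S))"
      using assms by (simp add: powr_realpow[symmetric])
    finally show ?thesis .
  qed
  then show ?thesis unfolding growth_exponent_def by blast
qed

section \<open>Evaluation of the exponents and passage to real \<open>X\<close>\<close>

lemma sum_nat_atLeastLessThan:
  "a \<le> b \<Longrightarrow> real (\<Sum>i\<in>{a..<b}. i) = (real b * (real b - 1) - real a * (real a - 1)) / 2"
proof (induction b rule: dec_induct)
  case (step n)
  then show ?case by (simp add: field_simps)
qed simp

lemma real_nu_exp:
  assumes "t \<le> k" "k \<le> r + t"
  shows "real (nu_exp r t k) = (real r * (real r - 1) - (real k - real t) * (real k - real t - 1)) / 2"
  using assms sum_nat_atLeastLessThan[of "k - t" r] by (simp add: nu_exp_def of_nat_diff)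

lemma real_mu_exp:
  assumes "r \<le> k" "k \<le> r + t"
  shows "real (mu_exp r t k) = (real t + real r - real k) * (real t + real r - real k - 1) / 2"
proof -
  have "mu_exp r t k = (\<Sum>i\<in>{0..<t + r - k}. i)"
    unfolding mu_exp_def
    by (rule sum.reindex_bij_witness[where i = "\<lambda>i. t - i" and j = "\<lambda>j. t - j"]) (use assms in auto)
  then show ?thesis using sum_nat_atLeastLessThan[of 0 "t + r - k"] assms by (simp add: of_nat_diff add.commute)
qed

lemma vinogradov_J_le_J_count:
  assumes "X < of_int Q"
  shows "vinogradov_J s k X \<le> J_count k s Q"
proof -
  let ?P = "PiE {1..s} (\<lambda>_. {0..<Q})"
  have sub: "{1..s} \<rightarrow>\<^sub>E {a. 1 \<le> a \<and> real_of_int a \<le> X} \<subseteq> ?P"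
    using assms by (intro PiE_mono) auto
  have fin: "finite ?P" by (intro finite_PiE) auto
  let ?T = "{(x, y). x \<in> ?P \<and> y \<in> ?P \<and> (\<forall>j\<in>{1..k}. (\<Sum>i\<in>{1..s}. x i ^ j) = (\<Sum>i\<in>{1..s}. y i ^ j))}"
  have "vinogradov_solutions s k X \<subseteq> ?T"
    unfolding vinogradov_solutions_def using sub by (auto simp: sum_subtractf)
  moreover have "finite ?T" by (rule finite_subset[OF _ finite_cartesian_product[OF fin fin]]) auto
  ultimately show ?thesis unfolding vinogradov_J_def J_count_def by (intro card_mono)
qed

theorem theorem1p3:
  fixes k r t :: nat and \<epsilon> :: real
  assumes "k > 0" and "r > 0" and "t > 0"
    and "k \<ge> 2"
    and "max 2 (1/2 * (real k - 1)) \<le> real t" and "t \<le> k"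
    and "1 \<le> r" and "r \<le> k"
    and "r + t \<ge> k"
    and "\<epsilon> > 0"
  shows "\<exists>C::real. \<forall>X::real. X \<ge> 1 \<longrightarrow>
           real (vinogradov_J (r * (t + 1)) k X)
             \<le> C * X powr (2 * real r * (real t + 1) - kappa r t k + \<epsilon>)"
proof -
  let ?S = "r * (t + 1)"
  have t2: "t \<ge> 2" and kt: "k \<le> 2 * t + 1" using assms(5) by auto
  \<comment> \<open>A prime above \<open>b\<close> exceeds \<open>k\<close>, which makes
    \<open>fact k\<close> a unit, and exceeds twice the constants that arise in both
    dichotomies.\<close>
  define b where "b = k + nat \<lceil>2 * (2 * real (Suc r)) ^ (2 * ?S)\<rceil>"
  obtain p :: nat where p: "prime p" "p > b" using bigger_prime by blast
  define q where "q = int p"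
  have q: "prime q" using p by (simp add: q_def)
  have q1: "q > 1" using q by (rule prime_gt_1_int)
  have kq: "int k < q" using p by (simp add: q_def b_def)
  have large: "2 * (2 * real (Suc r)) ^ (2 * ?S) \<le> of_int q"
  proof -
    have "2 * (2 * real (Suc r)) ^ (2 * ?S) \<le> real (nat \<lceil>2 * (2 * real (Suc r)) ^ (2 * ?S)\<rceil>)"
      by (rule real_nat_ceiling_ge)
    also have "\<dots> \<le> real p" using p(2) unfolding b_def of_nat_le_iff by linarith
    finally show ?thesis by (simp add: q_def)
  qed
  define E0 where "E0 = 2 * real r * (real t + 1) - kappa r t k"
  define w where "w = real t + real r - real k"
  have t1: "real t - 1 > 0" using t2 by simp
  have E0: "E0 = real r * (real t + 1) + 1/2 * w * (w - 1 + (2 * real r - 2) / (real t - 1))"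
    unfolding E0_def kappa_def w_def by simp
  have "w * (w - 1 + (2 * real r - 2) / (real t - 1)) \<ge> 0"
  proof (cases "r + t = k")
    case True
    then have "w = 0" by (simp add: w_def)
    then show ?thesis by simp
  next
    case False
    then have "k + 1 \<le> r + t" using assms by simp
    then have "w \<ge> 1" unfolding w_def by linarith
    moreover have "(2 * real r - 2) / (real t - 1) \<ge> 0" using t1 assms(7) by simp
    ultimately show ?thesis by (intro mult_nonneg_nonneg) auto
  qed
  then have E0S: "E0 \<ge> real ?S" unfolding E0 by (simp add: algebra_simps)
  \<comment> \<open>The equation \<open>g = 0\<close>. With \<open>w = t + r - k\<close> one has
    \<open>k - t = r - w\<close>, which expresses \<open>mu_exp\<close> and \<open>nu_exp\<close> in
    terms of \<open>r\<close> and \<open>w\<close>.\<close>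
  have fixed: "(1 - 1 / real t) * E0
      = real (mu_exp r t k) + real (r * t) - (real r - real (nu_exp r t k)) / real t"
  proof -
    have mu: "real (mu_exp r t k) = w * (w - 1) / 2"
      using real_mu_exp[of r k t] assms by (simp add: w_def)
    have nu: "real (nu_exp r t k) = (real r * (real r - 1) - (real r - w) * (real r - w - 1)) / 2"
      using real_nu_exp[of t k r] assms by (simp add: w_def)
    have "(real t - 1) * E0 = (real t - 1) * (real r * (real t + 1)) + 1/2 * w * ((real t - 1) * (w - 1) + (2 * real r - 2))"
      unfolding E0 using t1 by (simp add: field_simps)
    also have "\<dots> = real t * (real (mu_exp r t k) + real (r * t)) - (real r - real (nu_exp r t k))"
      unfolding mu nu by (simp add: field_simps)
    finally show ?thesis using t2 by (simp add: field_simps)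
  qed
  obtain \<delta> where \<delta>: "\<delta> > 0" and improve: "\<And>lam. \<epsilon> \<le> lam \<Longrightarrow> lam \<le> 2 * real ?S \<Longrightarrow>
      growth_exponent k ?S q (E0 + lam) \<Longrightarrow> growth_exponent k ?S q (E0 + lam - \<delta>)"
    using growth_exponent_improve[OF q assms(2) t2 kq assms(8,6) _ kt large E0S fixed assms(10), of "2 * real ?S"]
      assms(9) by auto
  \<comment> \<open>Starting from the trivial exponent, each application of \<open>improve\<close>
    lowers the excess over \<open>E0\<close> by \<open>\<delta>\<close> until it would fall below
    \<open>\<epsilon>\<close>.\<close>
  have "growth_exponent k ?S q (E0 + max \<epsilon> (2 * real ?S - real i * \<delta>))" for i
  proof (induction i)
    case 0
    have "0 \<le> E0" using E0S by (meson of_nat_0_le_iff order_trans)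
    then have "2 * real ?S \<le> E0 + max \<epsilon> (2 * real ?S - real 0 * \<delta>)" by linarith
    then show ?case by (rule growth_exponent_mono[OF growth_exponent_trivial[OF q1] _ q1])
  next
    case (Suc i)
    show ?case
    proof (cases "\<epsilon> \<le> 2 * real ?S - real i * \<delta>")
      case True
      then have "growth_exponent k ?S q (E0 + (2 * real ?S - real i * \<delta>) - \<delta>)"
        using Suc \<delta> by (intro improve) auto
      then show ?thesis by (rule growth_exponent_mono[OF _ _ q1]) (simp add: algebra_simps)
    next
      case False
      show ?thesis by (rule growth_exponent_mono[OF Suc _ q1]) (use False in auto)
    qed
  qed
  moreover obtain i :: nat where "2 * real ?S < real i * \<delta>"
    using reals_Archimedean3[OF \<delta>] by blast
  then have "max \<epsilon> (2 * real ?S - real i * \<delta>) = \<epsilon>" using assms(10) by simp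
  ultimately have "growth_exponent k ?S q (E0 + \<epsilon>)" by metis
  then obtain C where C: "\<And>n. real (J_count k ?S (q ^ n)) \<le> C * of_int q powr (real n * (E0 + \<epsilon>))"
    unfolding growth_exponent_def by blast
  have C0: "C \<ge> 0" using order_trans[OF of_nat_0_le_iff C[of 0]] q1 by simp
  have Epos: "E0 + \<epsilon> \<ge> 0" using E0S assms(10) by (meson add_nonneg_nonneg less_imp_le of_nat_0_le_iff order_trans)
  have "real (vinogradov_J ?S k X) \<le> C * of_int q powr (E0 + \<epsilon>) * X powr (E0 + \<epsilon>)" if X: "X \<ge> 1" for X
  proof -
    \<comment> \<open>Rounding \<open>X\<close> up to a power of \<open>q\<close> costs at most the
      factor \<open>q\<close>. The inequality is strict because the variables of
      \<open>J_count\<close> stay below \<open>q ^ n\<close>.\<close>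
    define n where "n = (LEAST n. X < of_int q ^ n)"
    have "\<exists>n. X < of_int q ^ n" using real_arch_pow[of "of_int q" X] q1 by simp
    then have n: "X < of_int q ^ n" unfolding n_def by (rule LeastI_ex)
    then have "n \<noteq> 0" using X by (intro notI) simp
    then obtain m where m: "n = Suc m" by (cases n) auto
    have "\<not> X < of_int q ^ m" using not_less_Least[of m "\<lambda>n. X < of_int q ^ n"] m unfolding n_def by simp
    then have qn: "of_int q ^ n \<le> of_int q * X" using q1 by (simp add: m)
    have "real (vinogradov_J ?S k X) \<le> real (J_count k ?S (q ^ n))"
      using vinogradov_J_le_J_count[of X "q ^ n" ?S k] n by simp
    also have "\<dots> \<le> C * of_int q powr (real n * (E0 + \<epsilon>))" by (rule C)
    also have "of_int q powr (real n * (E0 + \<epsilon>)) = (of_int q ^ n) powr (E0 + \<epsilon>)"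
      using q1 by (simp add: powr_powr[symmetric] powr_realpow)
    also have "C * \<dots> \<le> C * (of_int q * X) powr (E0 + \<epsilon>)"
      using qn C0 Epos q1 by (intro mult_left_mono powr_mono2) auto
    also have "\<dots> = C * of_int q powr (E0 + \<epsilon>) * X powr (E0 + \<epsilon>)"
      using q1 X by (simp add: powr_mult)
    finally show ?thesis .
  qed
  then show ?thesis unfolding E0_def by blast
qed

end
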